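(* Let $\mathbb{A}=(A,\le,\to,\Sigma)$ be an implicative algebra such that $|A|<\kappa$ for some strongly inaccessible cardinal $\kappa$, and let $\mathcal{E}=\mathbf{Set}[\mathsf{P}_{\mathbb{A}}]$ be the topos obtained from the implicative tripos $\mathsf{P}_{\mathbb{A}}$ by the tripos-to-topos construction. Then $\mathcal{E}$ hosts a model of $\mathbf{IZF}$. If $\mathbb{A}$ is classical, then $\mathcal{E}$ hosts a model of $\mathbf{ZF}$.
   Context: An implicative algebra is a quadruple $\mathbb{A}=(A,\le,\to,\Sigma)$ where $(A,\le)$ is a complete lattice; $\to:A\times A\to A$ is anti-monotone in its first and monotone in its second argument and satisfies $a\to\bigwedge_{i}b_i=\bigwedge_{i}(a\to b_i)$; and $\Sigma\subseteq A$ is upward closed, closed under modus ponens, and contains $\mathbf{K}=\bigwedge_{a,b}(a\to(b\to a))$ and $\mathbf{S}=\bigwedge_{a,b,c}((a\to(b\to c))\to((a\to b)\to(a\to c)))$. $\mathbb{A}$ is classical if $\bigwedge_{a,b}(((a\to b)\to a)\to a)\in\Sigma$. The implicative tripos $\mathsf{P}_{\mathbb{A}}:\mathbf{Set}^{op}\to\mathbf{Heyt}$ sends a set $I$ to the posetal reflection of the preorder $(A^I,\vdash_{\Sigma[I]})$, where $f\vdash_{\Sigma[I]}g$ iff $\bigwedge_{i\in I}(f(i)\to g(i))\in\Sigma$ (Heyting operations given pointwise by $a\times b:=\bigwedge_{x}((a\to(b\to x))\to x)$, $a+b:=\bigwedge_x((a\to x)\to((b\to x)\to x))$ and $\to$;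 quantifiers along maps given by $\bigwedge$ and $\exists_{i\in I}a_i:=\bigwedge_x(\bigwedge_i(a_i\to x)\to x)$), and a function $f:I\to J$ to precomposition with $f$. The tripos-to-topos construction (Hyland–Johnstone–Pitts) produces the elementary topos $\mathbf{Set}[\mathsf{P}_{\mathbb{A}}]$. A topos $\mathcal{E}$ hosts a model of $\mathbf{IZF}$ (resp. $\mathbf{ZF}$) if there are an object $V$ and a subobject $\varepsilon\rightarrowtail V\times V$ such that, interpreting the language of set theory in the internal logic (subobject doctrine) of $\mathcal{E}$ with universe $V$, membership $\varepsilon$ and equality the diagonal of $V\times V$, every axiom of $\mathbf{IZF}$ (resp. $\mathbf{ZF}$) is interpreted as the maximal subobject. The axioms of $\mathbf{IZF}$/$\mathbf{ZF}$ (intuitionistic/classical logic) are Extensionality, Pairing, Union, Powerset, Infinity, Separation schema, Collection schema and $\in$-Induction schema. *)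

theory Defs
  imports Main "HOL-Library.FuncSet"
begin

unbundle cardinal_syntax

section \<open>Implicative algebras\<close>

record 'a impl_alg =
  arrow :: "'a \<Rightarrow> 'a \<Rightarrow> 'a"
  separator :: "'a set"

text \<open>The underlying complete lattice is the whole type.\<close>

definition implicative_algebra :: "'a::complete_lattice impl_alg \<Rightarrow> bool" where
  "implicative_algebra A \<longleftrightarrow>
     (\<forall>a a' b b'. a' \<le> a \<longrightarrow> b \<le> b' \<longrightarrow> arrow A a b \<le> arrow A a' b') \<and>
     (\<forall>a B. arrow A a (Inf B) = (INF b\<in>B. arrow A a b)) \<and>
     (\<forall>a b. a \<in> separator A \<longrightarrow> a \<le> b \<longrightarrow> b \<in> separator A) \<and>
     (\<forall>a b. arrow A a b \<in> separator A \<longrightarrow> a \<in> separator A \<longrightarrow> b \<in> separator A) \<and>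
     (INF a. INF b. arrow A a (arrow A b a)) \<in> separator A \<and>
     (INF a. INF b. INF c. arrow A (arrow A a (arrow A b c))
                             (arrow A (arrow A a b) (arrow A a c))) \<in> separator A"

definition classical_alg :: "'a::complete_lattice impl_alg \<Rightarrow> bool" where
  "classical_alg A \<longleftrightarrow>
     (INF a. INF b. arrow A (arrow A (arrow A a b) a) a) \<in> separator A"

definition alg_conj :: "'a::complete_lattice impl_alg \<Rightarrow> 'a \<Rightarrow> 'a \<Rightarrow> 'a" where
  "alg_conj A a b = (INF x. arrow A (arrow A a (arrow A b x)) x)"

definition alg_ex :: "'a::complete_lattice impl_alg \<Rightarrow> 'i set \<Rightarrow> ('i \<Rightarrow> 'a) \<Rightarrow> 'a" where
  "alg_ex A I f = (INF x. arrow A (INF i\<in>I. arrow A (f i) x) x)"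


section \<open>The implicative tripos\<close>

definition entails ::
  "'a::complete_lattice impl_alg \<Rightarrow> 'i set \<Rightarrow> ('i \<Rightarrow> 'a) \<Rightarrow> ('i \<Rightarrow> 'a) \<Rightarrow> bool" where
  "entails A I f g \<longleftrightarrow> (INF i\<in>I. arrow A (f i) (g i)) \<in> separator A"

definition tripos_rel :: "'a::complete_lattice impl_alg \<Rightarrow> 'i set \<Rightarrow> ('i \<Rightarrow> 'a) rel" where
  "tripos_rel A I =
     {(f, g). f \<in> extensional I \<and> g \<in> extensional I \<and> entails A I f g \<and> entails A I g f}"

text \<open>The fibre over \<open>I\<close> is the posetal reflection of \<open>A\<^sup>I\<close>; its elements are equivalence classes.
  The operations below are computed on representatives.\<close>

definition tripos :: "'a::complete_lattice impl_alg \<Rightarrow> 'i set \<Rightarrow> ('i \<Rightarrow> 'a) set set" where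
  "tripos A I = extensional I // tripos_rel A I"

definition pred_class ::
  "'a::complete_lattice impl_alg \<Rightarrow> 'i set \<Rightarrow> ('i \<Rightarrow> 'a) \<Rightarrow> ('i \<Rightarrow> 'a) set" where
  "pred_class A I f = tripos_rel A I `` {restrict f I}"

definition pred_rep :: "('i \<Rightarrow> 'a) set \<Rightarrow> 'i \<Rightarrow> 'a" where
  "pred_rep F = (SOME f. f \<in> F)"

definition pred_le ::
  "'a::complete_lattice impl_alg \<Rightarrow> 'i set \<Rightarrow> ('i \<Rightarrow> 'a) set \<Rightarrow> ('i \<Rightarrow> 'a) set \<Rightarrow> bool" where
  "pred_le A I F G \<longleftrightarrow> entails A I (pred_rep F) (pred_rep G)"

definition pred_conj ::
  "'a::complete_lattice impl_alg \<Rightarrow> 'i set \<Rightarrow> ('i \<Rightarrow> 'a) set \<Rightarrow> ('i \<Rightarrow> 'a) set \<Rightarrow> ('i \<Rightarrow> 'a) set" where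
  "pred_conj A I F G = pred_class A I (\<lambda>i. alg_conj A (pred_rep F i) (pred_rep G i))"

text \<open>\<open>reindex A I h\<close> is the action of the tripos on a map \<open>h\<close> with domain \<open>I\<close>, and
  \<open>pred_ex A I J h\<close> is its left adjoint when \<open>h\<close> maps \<open>I\<close> to \<open>J\<close>.\<close>

definition reindex ::
  "'a::complete_lattice impl_alg \<Rightarrow> 'i set \<Rightarrow> ('i \<Rightarrow> 'j) \<Rightarrow> ('j \<Rightarrow> 'a) set \<Rightarrow> ('i \<Rightarrow> 'a) set" where
  "reindex A I h F = pred_class A I (\<lambda>i. pred_rep F (h i))"

definition pred_ex ::
  "'a::complete_lattice impl_alg \<Rightarrow> 'i set \<Rightarrow> 'j set \<Rightarrow> ('i \<Rightarrow> 'j) \<Rightarrow> ('i \<Rightarrow> 'a) set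
     \<Rightarrow> ('j \<Rightarrow> 'a) set" where
  "pred_ex A I J h F = pred_class A J (\<lambda>j. alg_ex A {i \<in> I. h i = j} (pred_rep F))"


section \<open>Categories and subobjects\<close>

record ('o, 'm) cat =
  Obj :: "'o set"
  Arr :: "'m set"
  Dom :: "'m \<Rightarrow> 'o"
  Cod :: "'m \<Rightarrow> 'o"
  Ide :: "'o \<Rightarrow> 'm"
  Comp :: "'m \<Rightarrow> 'm \<Rightarrow> 'm"  \<comment> \<open>\<open>Comp C g f\<close> is \<open>g\<close> after \<open>f\<close>\<close>

definition hom :: "('o, 'm) cat \<Rightarrow> 'o \<Rightarrow> 'o \<Rightarrow> 'm set" where
  "hom C X Y = {f \<in> Arr C. Dom C f = X \<and> Cod C f = Y}"

definition monic :: "('o, 'm) cat \<Rightarrow> 'm \<Rightarrow> bool" where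
  "monic C m \<longleftrightarrow> m \<in> Arr C \<and>
     (\<forall>X\<in>Obj C. \<forall>f\<in>hom C X (Dom C m). \<forall>g\<in>hom C X (Dom C m).
        Comp C m f = Comp C m g \<longrightarrow> f = g)"

text \<open>Subobjects of \<open>X\<close> are represented by monomorphisms into \<open>X\<close>, preordered by factorization.
  All notions below are invariant under the induced equivalence.\<close>

definition Sub :: "('o, 'm) cat \<Rightarrow> 'o \<Rightarrow> 'm set" where
  "Sub C X = {m. monic C m \<and> Cod C m = X}"

definition sub_le :: "('o, 'm) cat \<Rightarrow> 'm \<Rightarrow> 'm \<Rightarrow> bool" where
  "sub_le C m n \<longleftrightarrow> (\<exists>k\<in>hom C (Dom C m) (Dom C n). Comp C n k = m)"

definition is_top :: "('o, 'm) cat \<Rightarrow> 'o \<Rightarrow> 'm \<Rightarrow> bool" where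
  "is_top C X s \<longleftrightarrow> s \<in> Sub C X \<and> (\<forall>t\<in>Sub C X. sub_le C t s)"

definition is_bot :: "('o, 'm) cat \<Rightarrow> 'o \<Rightarrow> 'm \<Rightarrow> bool" where
  "is_bot C X s \<longleftrightarrow> s \<in> Sub C X \<and> (\<forall>t\<in>Sub C X. sub_le C s t)"

definition is_meet :: "('o, 'm) cat \<Rightarrow> 'o \<Rightarrow> 'm \<Rightarrow> 'm \<Rightarrow> 'm \<Rightarrow> bool" where
  "is_meet C X a b s \<longleftrightarrow> s \<in> Sub C X \<and>
     (\<forall>t\<in>Sub C X. sub_le C t s \<longleftrightarrow> sub_le C t a \<and> sub_le C t b)"

definition is_join :: "('o, 'm) cat \<Rightarrow> 'o \<Rightarrow> 'm \<Rightarrow> 'm \<Rightarrow> 'm \<Rightarrow> bool" where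
  "is_join C X a b s \<longleftrightarrow> s \<in> Sub C X \<and>
     (\<forall>t\<in>Sub C X. sub_le C s t \<longleftrightarrow> sub_le C a t \<and> sub_le C b t)"

definition is_implication :: "('o, 'm) cat \<Rightarrow> 'o \<Rightarrow> 'm \<Rightarrow> 'm \<Rightarrow> 'm \<Rightarrow> bool" where
  "is_implication C X a b s \<longleftrightarrow> s \<in> Sub C X \<and>
     (\<forall>t\<in>Sub C X. sub_le C t s \<longleftrightarrow> (\<exists>m. is_meet C X t a m \<and> sub_le C m b))"

text \<open>\<open>p\<close> is the pullback of the subobject \<open>m\<close> along \<open>f\<close>.\<close>

definition is_pullback :: "('o, 'm) cat \<Rightarrow> 'm \<Rightarrow> 'm \<Rightarrow> 'm \<Rightarrow> bool" where
  "is_pullback C f m p \<longleftrightarrow> p \<in> Sub C (Dom C f) \<and>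
     (\<exists>g\<in>hom C (Dom C p) (Dom C m). Comp C m g = Comp C f p \<and>
        (\<forall>X\<in>Obj C. \<forall>h\<in>hom C X (Dom C f). \<forall>k\<in>hom C X (Dom C m).
           Comp C m k = Comp C f h \<longrightarrow>
             (\<exists>!u. u \<in> hom C X (Dom C p) \<and> Comp C p u = h \<and> Comp C g u = k)))"

text \<open>Universal and existential quantification of the subobject \<open>a\<close> of the domain of \<open>q\<close> along \<open>q\<close>:
  the right and left adjoints of pulling back.\<close>

definition is_forall :: "('o, 'm) cat \<Rightarrow> 'm \<Rightarrow> 'm \<Rightarrow> 'm \<Rightarrow> bool" where
  "is_forall C q a s \<longleftrightarrow> s \<in> Sub C (Cod C q) \<and>
     (\<forall>t\<in>Sub C (Cod C q). sub_le C t s \<longleftrightarrow> (\<exists>p. is_pullback C q t p \<and> sub_le C p a))"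

definition is_exists :: "('o, 'm) cat \<Rightarrow> 'm \<Rightarrow> 'm \<Rightarrow> 'm \<Rightarrow> bool" where
  "is_exists C q a s \<longleftrightarrow> s \<in> Sub C (Cod C q) \<and>
     (\<forall>t\<in>Sub C (Cod C q). sub_le C s t \<longleftrightarrow> (\<exists>p. is_pullback C q t p \<and> sub_le C a p))"

text \<open>\<open>P\<close> with projections \<open>p 0, \<dots>, p (n - 1)\<close> is an \<open>n\<close>-th power of \<open>V\<close>.\<close>

definition is_power :: "('o, 'm) cat \<Rightarrow> 'o \<Rightarrow> nat \<Rightarrow> 'o \<Rightarrow> (nat \<Rightarrow> 'm) \<Rightarrow> bool" where
  "is_power C V n P p \<longleftrightarrow> P \<in> Obj C \<and> (\<forall>i<n. p i \<in> hom C P V) \<and>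
     (\<forall>X\<in>Obj C. \<forall>f. (\<forall>i<n. f i \<in> hom C X V) \<longrightarrow>
        (\<exists>!u. u \<in> hom C X P \<and> (\<forall>i<n. Comp C (p i) u = f i)))"


section \<open>The category of sets and the tripos-to-topos construction\<close>

text \<open>The category of sets is rendered by a universe \<open>U\<close> of small subsets of a type: up to
  bijection, \<open>U\<close> is closed under subsets, images (replacement), power sets and small unions, and has
  an infinite member. Cartesian products \<open>X \<times> Y\<close> of members live in the product type, over which
  the tripos is also available; products inside the universe arise through bijections.\<close>

definition set_universe :: "'u set set \<Rightarrow> bool" where
  "set_universe U \<longleftrightarrow>
     (\<forall>X\<in>U. \<forall>Y. |Y| \<le>o |X| \<longrightarrow> Y \<in> U) \<and>
     (\<forall>X\<in>U. \<exists>P\<in>U. |P| =o |Pow X| ) \<and>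
     (\<forall>X\<in>U. \<forall>F. (\<forall>x\<in>X. F x \<in> U) \<longrightarrow> (\<Union>x\<in>X. F x) \<in> U) \<and>
     (\<exists>X\<in>U. infinite X)"

definition strongly_inaccessible :: "'k rel \<Rightarrow> bool" where
  "strongly_inaccessible \<kappa> \<longleftrightarrow>
     Card_order \<kappa> \<and> natLeq <o \<kappa> \<and> regularCard \<kappa> \<and>
     (\<forall>X :: 'k set. |X| <o \<kappa> \<longrightarrow> |Pow X| <o \<kappa>)"

type_synonym ('u, 'a) per_obj = "'u set \<times> ('u \<times> 'u \<Rightarrow> 'a) set"
type_synonym ('u, 'a) per_arr = "('u, 'a) per_obj \<times> ('u, 'a) per_obj \<times> ('u \<times> 'u \<Rightarrow> 'a) set"

definition is_per :: "'a::complete_lattice impl_alg \<Rightarrow> 'u set \<Rightarrow> ('u \<times> 'u \<Rightarrow> 'a) set \<Rightarrow> bool" where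
  "is_per A X E \<longleftrightarrow> E \<in> tripos A (X \<times> X) \<and>
     pred_le A (X \<times> X) E (reindex A (X \<times> X) (\<lambda>(x, y). (y, x)) E) \<and>
     (let I = X \<times> X \<times> X in
      pred_le A I
        (pred_conj A I (reindex A I (\<lambda>(x, y, z). (x, y)) E) (reindex A I (\<lambda>(x, y, z). (y, z)) E))
        (reindex A I (\<lambda>(x, y, z). (x, z)) E))"

text \<open>Functional relations: strict, compatible with the partial equivalence relations,
  single-valued and total.\<close>

definition functional_rel ::
  "'a::complete_lattice impl_alg \<Rightarrow> ('u, 'a) per_obj \<Rightarrow> ('u, 'a) per_obj
     \<Rightarrow> ('u \<times> 'u \<Rightarrow> 'a) set \<Rightarrow> bool" where
  "functional_rel A = (\<lambda>(X, E) (Y, D) F. F \<in> tripos A (X \<times> Y) \<and>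
     pred_le A (X \<times> Y) F
       (pred_conj A (X \<times> Y) (reindex A (X \<times> Y) (\<lambda>(x, y). (x, x)) E)
                            (reindex A (X \<times> Y) (\<lambda>(x, y). (y, y)) D)) \<and>
     (let I = (X \<times> X) \<times> (Y \<times> Y) in
      pred_le A I
        (pred_conj A I
           (pred_conj A I (reindex A I (\<lambda>((x, x'), (y, y')). (x, x')) E)
                          (reindex A I (\<lambda>((x, x'), (y, y')). (x, y)) F))
           (reindex A I (\<lambda>((x, x'), (y, y')). (y, y')) D))
        (reindex A I (\<lambda>((x, x'), (y, y')). (x', y')) F)) \<and>
     (let I = X \<times> Y \<times> Y in
      pred_le A I
        (pred_conj A I (reindex A I (\<lambda>(x, y, y'). (x, y)) F) (reindex A I (\<lambda>(x, y, y'). (x, y')) F))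
        (reindex A I (\<lambda>(x, y, y'). (y, y')) D)) \<and>
     pred_le A X (reindex A X (\<lambda>x. (x, x)) E) (pred_ex A (X \<times> Y) X fst F))"

definition rel_comp ::
  "'a::complete_lattice impl_alg \<Rightarrow> 'u set \<Rightarrow> 'u set \<Rightarrow> 'u set
     \<Rightarrow> ('u \<times> 'u \<Rightarrow> 'a) set \<Rightarrow> ('u \<times> 'u \<Rightarrow> 'a) set \<Rightarrow> ('u \<times> 'u \<Rightarrow> 'a) set" where
  "rel_comp A X Y Z G F =
     (let I = X \<times> Y \<times> Z in
      pred_ex A I (X \<times> Z) (\<lambda>(x, y, z). (x, z))
        (pred_conj A I (reindex A I (\<lambda>(x, y, z). (x, y)) F) (reindex A I (\<lambda>(x, y, z). (y, z)) G)))"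

definition tripos_topos ::
  "'u set set \<Rightarrow> 'a::complete_lattice impl_alg \<Rightarrow> (('u, 'a) per_obj, ('u, 'a) per_arr) cat" where
  "tripos_topos U A =
     (let Ob = {(X, E). X \<in> U \<and> is_per A X E} in
      \<lparr> Obj = Ob,
        Arr = {(S, T, F). S \<in> Ob \<and> T \<in> Ob \<and> functional_rel A S T F},
        Dom = (\<lambda>(S, T, F). S),
        Cod = (\<lambda>(S, T, F). T),
        Ide = (\<lambda>S. (S, S, snd S)),
        Comp = (\<lambda>(T', R, G) (S, T, F). (S, R, rel_comp A (fst S) (fst T) (fst R) G F)) \<rparr>)"


section \<open>The language of set theory and its interpretation in a category\<close>

text \<open>Variables are de Bruijn indices: in a context of length \<open>n\<close> the variables are
  \<open>0, \<dots>, n - 1\<close>, and a quantifier binds the index \<open>0\<close> of its body.\<close>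

datatype fm =
    Mem nat nat
  | Eq nat nat
  | Falsum
  | And fm fm
  | Or fm fm
  | Imp fm fm
  | Forall fm
  | Exists fm

definition Neg :: "fm \<Rightarrow> fm" where
  "Neg \<phi> = Imp \<phi> Falsum"

definition Iff :: "fm \<Rightarrow> fm \<Rightarrow> fm" where
  "Iff \<phi> \<psi> = And (Imp \<phi> \<psi>) (Imp \<psi> \<phi>)"

primrec in_context :: "fm \<Rightarrow> nat \<Rightarrow> bool" where
  "in_context (Mem i j) n \<longleftrightarrow> i < n \<and> j < n"
| "in_context (Eq i j) n \<longleftrightarrow> i < n \<and> j < n"
| "in_context Falsum n \<longleftrightarrow> True"
| "in_context (And \<phi> \<psi>) n \<longleftrightarrow> in_context \<phi> n \<and> in_context \<psi> n"
| "in_context (Or \<phi> \<psi>) n \<longleftrightarrow> in_context \<phi> n \<and> in_context \<psi> n"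
| "in_context (Imp \<phi> \<psi>) n \<longleftrightarrow> in_context \<phi> n \<and> in_context \<psi> n"
| "in_context (Forall \<phi>) n \<longleftrightarrow> in_context \<phi> (Suc n)"
| "in_context (Exists \<phi>) n \<longleftrightarrow> in_context \<phi> (Suc n)"

text \<open>\<open>insert_var k \<phi>\<close> weakens \<open>\<phi>\<close> by a fresh variable with index \<open>k\<close>.\<close>

primrec insert_var :: "nat \<Rightarrow> fm \<Rightarrow> fm" where
  "insert_var k (Mem i j) = Mem (if i < k then i else Suc i) (if j < k then j else Suc j)"
| "insert_var k (Eq i j) = Eq (if i < k then i else Suc i) (if j < k then j else Suc j)"
| "insert_var k Falsum = Falsum"
| "insert_var k (And \<phi> \<psi>) = And (insert_var k \<phi>) (insert_var k \<psi>)"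
| "insert_var k (Or \<phi> \<psi>) = Or (insert_var k \<phi>) (insert_var k \<psi>)"
| "insert_var k (Imp \<phi> \<psi>) = Imp (insert_var k \<phi>) (insert_var k \<psi>)"
| "insert_var k (Forall \<phi>) = Forall (insert_var (Suc k) \<phi>)"
| "insert_var k (Exists \<phi>) = Exists (insert_var (Suc k) \<phi>)"

text \<open>\<open>interp C V P p e \<phi> n s\<close>: the subobject \<open>s\<close> of \<open>P n\<close>, the \<open>n\<close>-th power of \<open>V\<close> with projections
  \<open>p n i\<close>, interprets \<open>\<phi>\<close> in the context of length \<open>n\<close>; membership is the subobject \<open>e\<close> of \<open>P 2\<close>,
  equality the diagonal. The subobject \<open>s\<close> is determined up to equivalence.\<close>

definition is_var_pair ::
  "('o, 'm) cat \<Rightarrow> (nat \<Rightarrow> 'o) \<Rightarrow> (nat \<Rightarrow> nat \<Rightarrow> 'm) \<Rightarrow> nat \<Rightarrow> nat \<Rightarrow> nat \<Rightarrow> 'm \<Rightarrow> bool" where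
  "is_var_pair C P p n i j u \<longleftrightarrow>
     u \<in> hom C (P n) (P 2) \<and> Comp C (p 2 0) u = p n i \<and> Comp C (p 2 1) u = p n j"

definition is_diagonal ::
  "('o, 'm) cat \<Rightarrow> 'o \<Rightarrow> (nat \<Rightarrow> 'o) \<Rightarrow> (nat \<Rightarrow> nat \<Rightarrow> 'm) \<Rightarrow> 'm \<Rightarrow> bool" where
  "is_diagonal C V P p d \<longleftrightarrow>
     d \<in> hom C V (P 2) \<and> Comp C (p 2 0) d = Ide C V \<and> Comp C (p 2 1) d = Ide C V"

definition is_weakening ::
  "('o, 'm) cat \<Rightarrow> (nat \<Rightarrow> 'o) \<Rightarrow> (nat \<Rightarrow> nat \<Rightarrow> 'm) \<Rightarrow> nat \<Rightarrow> 'm \<Rightarrow> bool" where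
  "is_weakening C P p n q \<longleftrightarrow>
     q \<in> hom C (P (Suc n)) (P n) \<and> (\<forall>i<n. Comp C (p n i) q = p (Suc n) (Suc i))"

primrec interp ::
  "('o, 'm) cat \<Rightarrow> 'o \<Rightarrow> (nat \<Rightarrow> 'o) \<Rightarrow> (nat \<Rightarrow> nat \<Rightarrow> 'm) \<Rightarrow> 'm \<Rightarrow> fm \<Rightarrow> nat \<Rightarrow> 'm \<Rightarrow> bool" where
  "interp C V P p e (Mem i j) n s \<longleftrightarrow>
     (\<exists>u. is_var_pair C P p n i j u \<and> is_pullback C u e s)"
| "interp C V P p e (Eq i j) n s \<longleftrightarrow>
     (\<exists>u d. is_var_pair C P p n i j u \<and> is_diagonal C V P p d \<and> is_pullback C u d s)"
| "interp C V P p e Falsum n s \<longleftrightarrow> is_bot C (P n) s"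
| "interp C V P p e (And \<phi> \<psi>) n s \<longleftrightarrow>
     (\<exists>a b. interp C V P p e \<phi> n a \<and> interp C V P p e \<psi> n b \<and> is_meet C (P n) a b s)"
| "interp C V P p e (Or \<phi> \<psi>) n s \<longleftrightarrow>
     (\<exists>a b. interp C V P p e \<phi> n a \<and> interp C V P p e \<psi> n b \<and> is_join C (P n) a b s)"
| "interp C V P p e (Imp \<phi> \<psi>) n s \<longleftrightarrow>
     (\<exists>a b. interp C V P p e \<phi> n a \<and> interp C V P p e \<psi> n b \<and> is_implication C (P n) a b s)"
| "interp C V P p e (Forall \<phi>) n s \<longleftrightarrow>
     (\<exists>q a. is_weakening C P p n q \<and> interp C V P p e \<phi> (Suc n) a \<and> is_forall C q a s)"
| "interp C V P p e (Exists \<phi>) n s \<longleftrightarrow>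
     (\<exists>q a. is_weakening C P p n q \<and> interp C V P p e \<phi> (Suc n) a \<and> is_exists C q a s)"

text \<open>\<open>T\<close> is a set of sentences.\<close>

definition hosts_model :: "('o, 'm) cat \<Rightarrow> fm set \<Rightarrow> bool" where
  "hosts_model C T \<longleftrightarrow>
     (\<exists>V\<in>Obj C. \<exists>P p e. (\<forall>n. is_power C V n (P n) (p n)) \<and> e \<in> Sub C (P 2) \<and>
        (\<forall>\<phi>\<in>T. \<exists>s. interp C V P p e \<phi> 0 s \<and> is_top C (P 0) s))"


section \<open>The axioms\<close>

definition Extensionality_Axiom :: fm where
  "Extensionality_Axiom = Forall (Forall (Imp (Forall (Iff (Mem 0 2) (Mem 0 1))) (Eq 1 0)))"

definition Pairing_Axiom :: fm where
  "Pairing_Axiom = Forall (Forall (Exists (Forall (Iff (Mem 0 1) (Or (Eq 0 3) (Eq 0 2))))))"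

definition Union_Axiom :: fm where
  "Union_Axiom = Forall (Exists (Forall (Iff (Mem 0 1) (Exists (And (Mem 0 3) (Mem 1 0))))))"

definition Powerset_Axiom :: fm where
  "Powerset_Axiom = Forall (Exists (Forall (Iff (Mem 0 1) (Forall (Imp (Mem 0 1) (Mem 0 3))))))"

definition Infinity_Axiom :: fm where
  "Infinity_Axiom = Exists (And
     (Exists (And (Mem 0 1) (Forall (Neg (Mem 0 1)))))
     (Forall (Imp (Mem 0 1)
        (Exists (And (Mem 0 2) (Forall (Iff (Mem 0 1) (Or (Mem 0 2) (Eq 0 2)))))))))"

text \<open>In the schemas the parameters of \<open>\<phi>\<close> come after the following variables. Separation:
  \<open>\<phi>(x, a)\<close> has \<open>x = 0\<close>, \<open>a = 1\<close>. Collection: \<open>\<phi>(y, x, a)\<close> has \<open>y = 0\<close>, \<open>x = 1\<close>, \<open>a = 2\<close>.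
  Induction: \<open>\<phi>(x)\<close> has \<open>x = 0\<close>.\<close>

definition Separation :: "fm \<Rightarrow> fm" where
  "Separation \<phi> = Forall (Exists (Forall (Iff (Mem 0 1) (And (Mem 0 2) (insert_var 1 \<phi>)))))"

definition Collection :: "fm \<Rightarrow> fm" where
  "Collection \<phi> = Forall (Imp
     (Forall (Imp (Mem 0 1) (Exists \<phi>)))
     (Exists (Forall (Imp (Mem 0 2) (Exists (And (Mem 0 2) (insert_var 2 \<phi>)))))))"

definition Mem_Induction :: "fm \<Rightarrow> fm" where
  "Mem_Induction \<phi> = Imp
     (Forall (Imp (Forall (Imp (Mem 0 1) (insert_var 1 \<phi>))) \<phi>))
     (Forall \<phi>)"

definition closure :: "nat \<Rightarrow> fm \<Rightarrow> fm" where
  "closure n \<phi> = (Forall ^^ n) \<phi>"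

definition IZF :: "fm set" where
  "IZF = {Extensionality_Axiom, Pairing_Axiom, Union_Axiom, Powerset_Axiom, Infinity_Axiom}
     \<union> {closure n (Separation \<phi>) | n \<phi>. in_context \<phi> (n + 2)}
     \<union> {closure n (Collection \<phi>) | n \<phi>. in_context \<phi> (n + 3)}
     \<union> {closure n (Mem_Induction \<phi>) | n \<phi>. in_context \<phi> (n + 1)}"

text \<open>The interpretation validates intuitionistic logic only, so the classical logic of ZF
  is expressed by the schema of excluded middle.\<close>

definition ZF :: "fm set" where
  "ZF = IZF \<union> {closure n (Or \<phi> (Neg \<phi>)) | n \<phi>. in_context \<phi> n}"

end

theory Submission
  imports Defs
begin

text \<open>
  Realizability over the algebra is done with the elements themselves: \<open>t\<close> realizes \<open>a\<close> when \<open>t \<le> a\<close>,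
  and by combinatory completeness every closed \<open>\<lambda>\<close>-term over the separator lies in the separator. A
  sequent of the tripos holds when one such term realizes all its instances.

  In the topos, the subobjects of \<open>(X, e)\<close> correspond to the strict extensional predicates on \<open>X\<close>: a
  monomorphism goes to its image predicate, and its internal injectivity comes from its kernel pair.
  Hence the categorical connectives and quantifiers on subobjects are the algebraic ones, and the value
  of a sentence is computed by the usual recursion on formulas.

  The universe of the model consists of names of hereditary size below \<open>\<kappa>\<close>, coded by the elements of
  \<open>Field \<kappa>\<close>. Equality of names is defined by recursion, and induction on names is realized by a fixed
  point combinator. Extensional comprehension over a small set of names yields Pairing, Union,
  Powerset and Separation; Collection holds because an existential quantifier takes the same value over
  any set of witnesses that attains all its truth values, and there are fewer than \<open>\<kappa>\<close> of these.
\<close>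

section \<open>Realizers in an implicative algebra\<close>

text \<open>Equality is read as the categorical diagonal, so the partial equivalence relation of the
  universe has to be the equality of names itself. One realizer of self-equality serves all names:
  the object is total, its quantifiers range over the bare set of names without an existence
  predicate, and its powers are carried by codes of tuples inside that same set. Every realizer must
  be independent of the individuals; this shapes the recursion on names, which may use realizers of
  smaller instances but never the name under consideration. A realizer for n-tuples may depend on n,
  so sequents about tuples are derived in the preorder of the fibre by induction on n and turned
  into realizers afterwards. The bound |A| < \<kappa> enters beyond Collection in two counts: a
  small set carries fewer than \<kappa> weight functions, which bounds the power set of a name, and
  there are at most \<kappa> weighted small sets of names, so that \<open>Field \<kappa>\<close> can
  name them all. Regularity bounds a small set in the well-order; this keeps names above their
  potential elements and membership well-founded.\<close>

locale impl =
  fixes A :: "'a::complete_lattice impl_alg"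
  assumes impl: "implicative_algebra A"
begin

abbreviation arr (infixr "\<leadsto>" 60) where "a \<leadsto> b \<equiv> arrow A a b"
abbreviation cnj (infixr "\<otimes>" 65) where "a \<otimes> b \<equiv> alg_conj A a b"
abbreviation ex where "ex I f \<equiv> alg_ex A I f"
abbreviation Sep ("\<Sigma>") where "\<Sigma> \<equiv> separator A"

definition dsj (infixr "\<oplus>" 64) where
  "a \<oplus> b = (INF x. (a \<leadsto> x) \<leadsto> (b \<leadsto> x) \<leadsto> x)"

lemma arr_mono: "a' \<le> a \<Longrightarrow> b \<le> b' \<Longrightarrow> a \<leadsto> b \<le> a' \<leadsto> b'"
  using impl unfolding implicative_algebra_def by blast

lemma arr_Inf: "a \<leadsto> Inf B = (INF b\<in>B. a \<leadsto> b)"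
  using impl unfolding implicative_algebra_def by blast

lemma sep_up: "a \<in> \<Sigma> \<Longrightarrow> a \<le> b \<Longrightarrow> b \<in> \<Sigma>"
  using impl unfolding implicative_algebra_def by blast

lemma sep_mp: "a \<leadsto> b \<in> \<Sigma> \<Longrightarrow> a \<in> \<Sigma> \<Longrightarrow> b \<in> \<Sigma>"
  using impl unfolding implicative_algebra_def by blast

definition app (infixl "\<cdot>" 70) where "t \<cdot> u = Inf {c. t \<le> u \<leadsto> c}"

definition lam where "lam f = (INF a. a \<leadsto> f a)"

text \<open>The arrow commutes with meets in its second argument, so the meet defining
  \<open>t \<cdot> u\<close> belongs to the set over which it is taken. Application is thus left
  adjoint to the arrow, and the typing rules below rest on this adjunction.\<close>

lemma app_le_iff: "t \<cdot> u \<le> c \<longleftrightarrow> t \<le> u \<leadsto> c"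
proof
  have "t \<le> u \<leadsto> (t \<cdot> u)"
    unfolding app_def arr_Inf by (auto intro: INF_greatest)
  moreover assume "t \<cdot> u \<le> c"
  ultimately show "t \<le> u \<leadsto> c" using arr_mono order_trans by blast
qed (auto simp: app_def intro: Inf_lower)

lemma app_mono: "t \<le> t' \<Longrightarrow> u \<le> u' \<Longrightarrow> t \<cdot> u \<le> t' \<cdot> u'"
  by (meson app_le_iff arr_mono order_refl order_trans)

text \<open>Reduction goes upwards in the order: a redex lies below its reduct, and no converse is
  claimed. Realizers are accordingly bounded from above and never computed.\<close>

lemma beta: "lam f \<cdot> a \<le> f a"
  unfolding app_le_iff lam_def by (auto intro: INF_lower)

lemma app_sep: "t \<in> \<Sigma> \<Longrightarrow> u \<in> \<Sigma> \<Longrightarrow> t \<cdot> u \<in> \<Sigma>"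
  by (metis app_le_iff order_refl sep_mp sep_up)

definition cK where "cK = (INF a. INF b. a \<leadsto> b \<leadsto> a)"

definition cS where
  "cS = (INF a. INF b. INF c. (a \<leadsto> b \<leadsto> c) \<leadsto> (a \<leadsto> b) \<leadsto> a \<leadsto> c)"

lemma cK_sep: "cK \<in> \<Sigma>" and cS_sep: "cS \<in> \<Sigma>"
  using impl unfolding implicative_algebra_def by (simp_all add: cK_def cS_def)

lemma cK_app: "cK \<cdot> a \<cdot> b \<le> a"
  unfolding app_le_iff cK_def by (meson INF_lower2 INF_lower UNIV_I order_refl)

text \<open>Elements of the lattice are types and terms at once: \<open>cS\<close> is instantiated
  at the types \<open>c\<close>, \<open>b \<cdot> c\<close> and
  \<open>a \<cdot> c \<cdot> (b \<cdot> c)\<close>, and the adjunction then types the three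
  arguments.\<close>

lemma cS_app: "cS \<cdot> a \<cdot> b \<cdot> c \<le> a \<cdot> c \<cdot> (b \<cdot> c)"
proof -
  have "cS \<le> (c \<leadsto> b \<cdot> c \<leadsto> a \<cdot> c \<cdot> (b \<cdot> c)) \<leadsto> (c \<leadsto> b \<cdot> c) \<leadsto> c \<leadsto> a \<cdot> c \<cdot> (b \<cdot> c)"
    unfolding cS_def by (meson INF_lower2 INF_lower UNIV_I order_refl)
  also have "\<dots> \<le> a \<leadsto> b \<leadsto> c \<leadsto> a \<cdot> c \<cdot> (b \<cdot> c)"
    by (intro arr_mono order_refl) (simp_all flip: app_le_iff)
  finally show ?thesis by (simp add: app_le_iff)
qed

section \<open>Combinatory completeness\<close>

inductive comb :: "((nat \<Rightarrow> 'a) \<Rightarrow> 'a) \<Rightarrow> bool" where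
  comb_var: "comb (\<lambda>\<rho>. \<rho> n)"
| comb_const: "c \<in> \<Sigma> \<Longrightarrow> comb (\<lambda>\<rho>. c)"
| comb_app: "comb f \<Longrightarrow> comb g \<Longrightarrow> comb (\<lambda>\<rho>. f \<rho> \<cdot> g \<rho>)"

text \<open>Realizers are only needed up to refinement, so an open term counts as definable as soon as a
  combinatory term lies below it; environments play the role of de Bruijn contexts.\<close>

definition definable :: "((nat \<Rightarrow> 'a) \<Rightarrow> 'a) \<Rightarrow> bool" where
  "definable f \<longleftrightarrow> (\<exists>g. comb g \<and> (\<forall>\<rho>. g \<rho> \<le> f \<rho>))"

text \<open>Bracket abstraction of the variable 0 by S and K, with SKK as the identity. The other
  variables move down by one place.\<close>

lemma comb_abstract: "comb f \<Longrightarrow> \<exists>g. comb g \<and> (\<forall>\<rho>. g (\<lambda>n. \<rho> (Suc n)) \<cdot> \<rho> 0 \<le> f \<rho>)"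
proof (induction rule: comb.induct)
  case (comb_var n)
  show ?case
  proof (cases n)
    case 0
    have "cS \<cdot> cK \<cdot> cK \<cdot> a \<le> a" for a
      using cS_app[of cK cK a] cK_app[of a "cK \<cdot> a"] by order
    then show ?thesis using 0
      by (intro exI[of _ "\<lambda>_. cS \<cdot> cK \<cdot> cK"]) (simp add: comb.intros cS_sep cK_sep app_sep)
  next
    case (Suc m)
    then show ?thesis
      by (intro exI[of _ "\<lambda>\<rho>. cK \<cdot> \<rho> m"]) (auto intro!: comb.intros cK_sep cK_app)
  qed
next
  case (comb_const c)
  then show ?case
    by (intro exI[of _ "\<lambda>\<rho>. cK \<cdot> c"]) (auto intro!: comb.comb_const app_sep cK_sep cK_app)
next
  case (comb_app f g)
  then obtain f' g' where "comb f'" "comb g'"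
    and *: "\<And>\<rho>. f' (\<lambda>n. \<rho> (Suc n)) \<cdot> \<rho> 0 \<le> f \<rho>" "\<And>\<rho>. g' (\<lambda>n. \<rho> (Suc n)) \<cdot> \<rho> 0 \<le> g \<rho>"
    by blast
  moreover have "cS \<cdot> f' (\<lambda>n. \<rho> (Suc n)) \<cdot> g' (\<lambda>n. \<rho> (Suc n)) \<cdot> \<rho> 0 \<le> f \<rho> \<cdot> g \<rho>" for \<rho>
    using cS_app app_mono[OF *] order_trans by fast
  ultimately show ?case
    by (intro exI[of _ "\<lambda>\<rho>. cS \<cdot> f' \<rho> \<cdot> g' \<rho>"]) (auto intro!: comb.intros cS_sep)
qed

lemma definable_var: "definable (\<lambda>\<rho>. \<rho> n)"
  unfolding definable_def using comb_var by blast

lemma definable_const: "c \<in> \<Sigma> \<Longrightarrow> definable (\<lambda>\<rho>. c)"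
  unfolding definable_def using comb_const by blast

lemma definable_app:
  assumes "definable f" and "definable g"
  shows "definable (\<lambda>\<rho>. f \<rho> \<cdot> g \<rho>)"
proof -
  obtain f' g' where "comb f'" "\<And>\<rho>. f' \<rho> \<le> f \<rho>" and "comb g'" "\<And>\<rho>. g' \<rho> \<le> g \<rho>"
    using assms unfolding definable_def by blast
  then show ?thesis
    unfolding definable_def
    by (intro exI[of _ "\<lambda>\<rho>. f' \<rho> \<cdot> g' \<rho>"]) (simp add: comb_app app_mono)
qed

lemma definable_lam:
  assumes "definable (\<lambda>\<rho>. f (\<lambda>n. \<rho> (Suc n)) (\<rho> 0))"
  shows "definable (\<lambda>\<rho>. lam (f \<rho>))"
proof -
  obtain g where g: "comb g" "\<And>\<rho>. g \<rho> \<le> f (\<lambda>n. \<rho> (Suc n)) (\<rho> 0)"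
    using assms unfolding definable_def by blast
  obtain h where h: "comb h" "\<And>\<rho>. h (\<lambda>n. \<rho> (Suc n)) \<cdot> \<rho> 0 \<le> g \<rho>"
    using comb_abstract[OF g(1)] by blast
  have "h \<rho> \<cdot> a \<le> f \<rho> a" for \<rho> a
    using order_trans[OF h(2)[of "case_nat a \<rho>"] g(2)] by simp
  then have "h \<rho> \<le> lam (f \<rho>)" for \<rho>
    unfolding lam_def app_le_iff by (auto intro: INF_greatest)
  then show ?thesis using h(1) unfolding definable_def by blast
qed

text \<open>A combinatory term evaluated at separator elements stays in the separator; here every
  variable is sent to \<open>cK\<close>. Since \<open>t\<close> does not depend on the environment,
  it lies above such a value.\<close>

lemma sepI: "t \<le> a \<Longrightarrow> definable (\<lambda>\<rho>. t) \<Longrightarrow> a \<in> \<Sigma>"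
proof -
  have "comb f \<Longrightarrow> f (\<lambda>_. cK) \<in> \<Sigma>" for f
    by (induction rule: comb.induct) (auto intro: app_sep cK_sep)
  then show "t \<le> a \<Longrightarrow> definable (\<lambda>\<rho>. t) \<Longrightarrow> a \<in> \<Sigma>"
    unfolding definable_def using sep_up by meson
qed

section \<open>Lambda-encodings of the connectives and of recursion\<close>

definition pr where "pr s t = lam (\<lambda>k. k \<cdot> s \<cdot> t)"
definition p1 where "p1 t = t \<cdot> lam (\<lambda>x. lam (\<lambda>y. x))"
definition p2 where "p2 t = t \<cdot> lam (\<lambda>x. lam (\<lambda>y. y))"
definition wit where "wit t = lam (\<lambda>k. k \<cdot> t)"
definition unwit where "unwit t f = t \<cdot> lam f"
definition inl where "inl t = lam (\<lambda>f. lam (\<lambda>g. f \<cdot> t))"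
definition inr where "inr t = lam (\<lambda>f. lam (\<lambda>g. g \<cdot> t))"
definition cases where "cases t f g = t \<cdot> lam f \<cdot> lam g"
text \<open>Curry's paradoxical combinator, written out for a function \<open>f\<close> on the
  lattice.\<close>

definition fixpt where "fixpt f = lam (\<lambda>x. f (x \<cdot> x)) \<cdot> lam (\<lambda>x. f (x \<cdot> x))"

lemma definable_shift:
  assumes "definable f"
  shows "definable (\<lambda>\<rho>. f (\<lambda>n. \<rho> (Suc n)))"
proof -
  have "comb g \<Longrightarrow> comb (\<lambda>\<rho>. g (\<lambda>n. \<rho> (Suc n)))" for g
    by (induction rule: comb.induct) (auto intro: comb.intros)
  then show ?thesis
    using assms unfolding definable_def by fast
qed

lemma definable_pr: "definable f \<Longrightarrow> definable g \<Longrightarrow> definable (\<lambda>\<rho>. pr (f \<rho>) (g \<rho>))"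
  unfolding pr_def by (intro definable_lam definable_app definable_var definable_shift)

lemma definable_p1: "definable f \<Longrightarrow> definable (\<lambda>\<rho>. p1 (f \<rho>))"
  unfolding p1_def by (intro definable_lam definable_app definable_var)

lemma definable_p2: "definable f \<Longrightarrow> definable (\<lambda>\<rho>. p2 (f \<rho>))"
  unfolding p2_def by (intro definable_lam definable_app definable_var)

lemma definable_wit: "definable f \<Longrightarrow> definable (\<lambda>\<rho>. wit (f \<rho>))"
  unfolding wit_def by (intro definable_lam definable_app definable_var definable_shift)

lemma definable_unwit:
  "definable f \<Longrightarrow> definable (\<lambda>\<rho>. g (\<lambda>n. \<rho> (Suc n)) (\<rho> 0)) \<Longrightarrow> definable (\<lambda>\<rho>. unwit (f \<rho>) (g \<rho>))"
  unfolding unwit_def by (intro definable_lam definable_app)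

lemma definable_inl: "definable f \<Longrightarrow> definable (\<lambda>\<rho>. inl (f \<rho>))"
  using definable_shift[OF definable_shift, of f]
  unfolding inl_def by (intro definable_lam definable_app definable_var)

lemma definable_inr: "definable f \<Longrightarrow> definable (\<lambda>\<rho>. inr (f \<rho>))"
  using definable_shift[OF definable_shift, of f]
  unfolding inr_def by (intro definable_lam definable_app definable_var)

lemma definable_cases:
  "\<lbrakk>definable f; definable (\<lambda>\<rho>. g (\<lambda>n. \<rho> (Suc n)) (\<rho> 0)); definable (\<lambda>\<rho>. h (\<lambda>n. \<rho> (Suc n)) (\<rho> 0))\<rbrakk>
      \<Longrightarrow> definable (\<lambda>\<rho>. cases (f \<rho>) (g \<rho>) (h \<rho>))"
  unfolding cases_def by (intro definable_lam definable_app)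

text \<open>Definability of \<open>f\<close> is given at a variable, but the combinator puts
  \<open>x \<cdot> x\<close> in its place. The term \<open>lam f \<cdot> (x \<cdot> x)\<close> is
  definable and lies below \<open>f (x \<cdot> x)\<close> by \<open>beta\<close>, which suffices
  because definability is closed upwards.\<close>

lemma definable_fixpt:
  assumes "definable (\<lambda>\<rho>. f (\<lambda>n. \<rho> (Suc n)) (\<rho> 0))"
  shows "definable (\<lambda>\<rho>. fixpt (f \<rho>))"
proof -
  have "definable (\<lambda>\<rho>. lam (\<lambda>u. f \<rho> u) \<cdot> (\<rho> 0 \<cdot> \<rho> 0))"
    by (intro definable_app definable_var definable_lam assms)
  then have "definable (\<lambda>\<rho>. lam (f (\<lambda>n. \<rho> (Suc n))) \<cdot> (\<rho> 0 \<cdot> \<rho> 0))"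
    by (intro definable_app definable_var definable_shift[of "\<lambda>\<rho>. lam (f \<rho>)"] definable_lam assms)
  then have "definable (\<lambda>\<rho>. f (\<lambda>n. \<rho> (Suc n)) (\<rho> 0 \<cdot> \<rho> 0))"
    unfolding definable_def using beta order_trans by meson
  then show ?thesis
    unfolding fixpt_def by (intro definable_app definable_lam)
qed

lemmas definables = definable_lam definable_app definable_pr definable_p1 definable_p2
  definable_wit definable_unwit definable_inl definable_inr definable_cases definable_fixpt
  definable_var definable_const

section \<open>Typing rules for realizers\<close>

lemma lam_le: "(\<And>u. u \<le> a \<Longrightarrow> f u \<le> b) \<Longrightarrow> lam f \<le> a \<leadsto> b"
  by (metis app_le_iff beta order_refl order_trans)

lemma app_le: "t \<le> a \<leadsto> b \<Longrightarrow> u \<le> a \<Longrightarrow> t \<cdot> u \<le> b"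
  by (meson app_le_iff app_mono order_refl order_trans)

lemma pr_le: "s \<le> a \<Longrightarrow> t \<le> b \<Longrightarrow> pr s t \<le> a \<otimes> b"
  unfolding alg_conj_def pr_def by (intro INF_greatest lam_le) (blast intro: app_le)

text \<open>The conjunction is a meet over all conclusions \<open>x\<close>, used here at
  \<open>x = a\<close>; the other eliminations choose their instance in the same way.\<close>

lemma p1_le: "t \<le> a \<otimes> b \<Longrightarrow> p1 t \<le> a"
  unfolding alg_conj_def p1_def
  by (rule app_le[of _ "a \<leadsto> b \<leadsto> a"]) (auto simp: le_INF_iff intro!: lam_le)

lemma p2_le: "t \<le> a \<otimes> b \<Longrightarrow> p2 t \<le> b"
  unfolding alg_conj_def p2_def
  by (rule app_le[of _ "a \<leadsto> b \<leadsto> b"]) (auto simp: le_INF_iff intro!: lam_le)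

lemma le_cnjE: "t \<le> a \<otimes> b \<Longrightarrow> (p1 t \<le> a \<Longrightarrow> p2 t \<le> b \<Longrightarrow> thesis) \<Longrightarrow> thesis"
  using p1_le p2_le by blast

lemma wit_le: "t \<le> f i \<Longrightarrow> i \<in> I \<Longrightarrow> wit t \<le> ex I f"
  unfolding alg_ex_def wit_def
  by (intro INF_greatest lam_le app_le[of _ "f i"]) (auto simp: le_INF_iff)

text \<open>The continuation \<open>g\<close> receives the realizer \<open>u\<close> and never the
  index \<open>i\<close>, as uniformity in the individuals demands.\<close>

lemma unwit_le:
  "t \<le> ex I f \<Longrightarrow> (\<And>i u. u \<le> f i \<Longrightarrow> i \<in> I \<Longrightarrow> g u \<le> c) \<Longrightarrow> unwit t g \<le> c"
  unfolding alg_ex_def unwit_def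
  by (rule app_le[of _ "INF i\<in>I. f i \<leadsto> c"]) (auto simp: le_INF_iff intro!: INF_greatest lam_le)

lemma inl_le: "t \<le> a \<Longrightarrow> inl t \<le> a \<oplus> b"
  unfolding dsj_def inl_def by (intro INF_greatest lam_le) (blast intro: app_le)

lemma inr_le: "t \<le> b \<Longrightarrow> inr t \<le> a \<oplus> b"
  unfolding dsj_def inr_def by (intro INF_greatest lam_le) (blast intro: app_le)

lemma cases_le:
  "t \<le> a \<oplus> b \<Longrightarrow> (\<And>u. u \<le> a \<Longrightarrow> f u \<le> c) \<Longrightarrow> (\<And>u. u \<le> b \<Longrightarrow> g u \<le> c) \<Longrightarrow> cases t f g \<le> c"
  unfolding dsj_def cases_def
  by (intro app_le[of _ "b \<leadsto> c"] app_le[of _ "a \<leadsto> c"] lam_le) (auto simp: le_INF_iff)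

text \<open>By \<open>beta\<close>, \<open>fixpt f\<close> lies below \<open>f (fixpt f)\<close>,
  and the induction hypothesis types the recursive call at every smaller point. The same element
  realizes all instances, although the well-founded relation is external to the algebra.\<close>

lemma fixpt_le:
  assumes "wf R" and "\<And>x u. x \<in> X \<Longrightarrow> (\<And>y. y \<in> X \<Longrightarrow> (y, x) \<in> R \<Longrightarrow> u \<le> p y) \<Longrightarrow> f u \<le> p x"
    and "x \<in> X"
  shows "fixpt f \<le> p x"
  using assms(1,3)
proof (induction x rule: wf_induct_rule)
  case (less x)
  have "fixpt f \<le> f (lam (\<lambda>x. f (x \<cdot> x)) \<cdot> lam (\<lambda>x. f (x \<cdot> x)))"
    unfolding fixpt_def by (rule beta)
  also have "\<dots> \<le> p x"
    using less by (intro assms(2)) (auto simp flip: fixpt_def)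
  finally show ?case .
qed

lemma le_arr_iff: "t \<le> a \<leadsto> b \<longleftrightarrow> (\<forall>u\<le>a. t \<cdot> u \<le> b)"
  using app_le app_le_iff by blast

lemma sepE:
  assumes "a \<in> \<Sigma>"
  obtains t where "t \<in> \<Sigma>" and "t \<le> a"
  using assms by blast

lemma le_INF_D: "(t::'a) \<le> (INF x\<in>X. f x) \<Longrightarrow> x \<in> X \<Longrightarrow> t \<le> f x"
  by (auto simp: le_INF_iff)

end

section \<open>Partial equivalence relations and functional relations\<close>

text \<open>The hypotheses are curried and each law is a meet lying in the separator, so that the
  meet itself can be taken as the realizer of the law. \<open>is_per_mk_iff\<close> connects this
  form with the conditions in the tripos.\<close>

locale per = impl A for A :: "'a::complete_lattice impl_alg" +
  fixes X :: "'u set" and e :: "'u \<Rightarrow> 'u \<Rightarrow> 'a"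
  assumes sym_sep: "(INF x\<in>X. INF y\<in>X. e x y \<leadsto> e y x) \<in> \<Sigma>"
    and trans_sep: "(INF x\<in>X. INF y\<in>X. INF z\<in>X. e x y \<leadsto> e y z \<leadsto> e x z) \<in> \<Sigma>"
begin

definition "rsym = (INF x\<in>X. INF y\<in>X. e x y \<leadsto> e y x)"
definition "rtrans = (INF x\<in>X. INF y\<in>X. INF z\<in>X. e x y \<leadsto> e y z \<leadsto> e x z)"
definition "rleft = lam (\<lambda>u. rtrans \<cdot> u \<cdot> (rsym \<cdot> u))"
definition "rright = lam (\<lambda>u. rtrans \<cdot> (rsym \<cdot> u) \<cdot> u)"

lemma rsym_sep: "rsym \<in> \<Sigma>" and rtrans_sep: "rtrans \<in> \<Sigma>"
  unfolding rsym_def rtrans_def using sym_sep trans_sep .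

lemma rleft_sep: "rleft \<in> \<Sigma>" and rright_sep: "rright \<in> \<Sigma>"
  unfolding rleft_def rright_def
  by (rule sepI[OF order_refl], intro definables rsym_sep rtrans_sep)+

lemmas seps = rsym_sep rtrans_sep rleft_sep rright_sep

lemma sym: "\<lbrakk>u \<le> e x y; x \<in> X; y \<in> X\<rbrakk> \<Longrightarrow> rsym \<cdot> u \<le> e y x"
  using eq_refl[OF rsym_def] unfolding le_INF_iff le_arr_iff by blast

lemma trans: "\<lbrakk>u \<le> e x y; v \<le> e y z; x \<in> X; y \<in> X; z \<in> X\<rbrakk> \<Longrightarrow> rtrans \<cdot> u \<cdot> v \<le> e x z"
  using eq_refl[OF rtrans_def] unfolding le_INF_iff le_arr_iff by blast

lemma left: "\<lbrakk>u \<le> e x y; x \<in> X; y \<in> X\<rbrakk> \<Longrightarrow> rleft \<cdot> u \<le> e x x"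
  unfolding rleft_def by (rule order_trans[OF beta]) (blast intro: trans sym)

lemma right: "\<lbrakk>u \<le> e x y; x \<in> X; y \<in> X\<rbrakk> \<Longrightarrow> rright \<cdot> u \<le> e y y"
  unfolding rright_def by (rule order_trans[OF beta]) (blast intro: trans sym)

end

locale frel = impl A + X: per A X e + Y: per A Y d
  for A :: "'a::complete_lattice impl_alg" and X :: "'u set" and e and Y :: "'u set" and d +
  fixes F :: "'u \<Rightarrow> 'u \<Rightarrow> 'a"
  assumes strict1_sep: "(INF x\<in>X. INF y\<in>Y. F x y \<leadsto> e x x) \<in> \<Sigma>"
    and strict2_sep: "(INF x\<in>X. INF y\<in>Y. F x y \<leadsto> d y y) \<in> \<Sigma>"
    and cong_sep: "(INF x\<in>X. INF x'\<in>X. INF y\<in>Y. INF y'\<in>Y. e x x' \<leadsto> F x y \<leadsto> d y y' \<leadsto> F x' y') \<in> \<Sigma>"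
    and single_sep: "(INF x\<in>X. INF y\<in>Y. INF y'\<in>Y. F x y \<leadsto> F x y' \<leadsto> d y y') \<in> \<Sigma>"
    and total_sep: "(INF x\<in>X. e x x \<leadsto> ex Y (F x)) \<in> \<Sigma>"
begin

definition "rs1 = (INF x\<in>X. INF y\<in>Y. F x y \<leadsto> e x x)"
definition "rs2 = (INF x\<in>X. INF y\<in>Y. F x y \<leadsto> d y y)"
definition "rcong = (INF x\<in>X. INF x'\<in>X. INF y\<in>Y. INF y'\<in>Y. e x x' \<leadsto> F x y \<leadsto> d y y' \<leadsto> F x' y')"
definition "rsingle = (INF x\<in>X. INF y\<in>Y. INF y'\<in>Y. F x y \<leadsto> F x y' \<leadsto> d y y')"
definition "rtotal = (INF x\<in>X. e x x \<leadsto> ex Y (F x))"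
text \<open>Congruence in one argument alone: strictness supplies the reflexive equality that
  \<open>rcong\<close> expects for the other argument.\<close>

definition "rcong1 = lam (\<lambda>u. lam (\<lambda>v. rcong \<cdot> u \<cdot> v \<cdot> (rs2 \<cdot> v)))"
definition "rcong2 = lam (\<lambda>v. lam (\<lambda>u. rcong \<cdot> (rs1 \<cdot> v) \<cdot> v \<cdot> u))"

lemma base_seps: "rs1 \<in> \<Sigma>" "rs2 \<in> \<Sigma>" "rcong \<in> \<Sigma>" "rsingle \<in> \<Sigma>" "rtotal \<in> \<Sigma>"
  unfolding rs1_def rs2_def rcong_def rsingle_def rtotal_def
  using strict1_sep strict2_sep cong_sep single_sep total_sep by -

lemma rcong1_sep: "rcong1 \<in> \<Sigma>" and rcong2_sep: "rcong2 \<in> \<Sigma>"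
  unfolding rcong1_def rcong2_def
  by (rule sepI[OF order_refl], intro definables base_seps)+

lemmas seps = base_seps rcong1_sep rcong2_sep X.seps Y.seps

lemma strict1: "\<lbrakk>u \<le> F x y; x \<in> X; y \<in> Y\<rbrakk> \<Longrightarrow> rs1 \<cdot> u \<le> e x x"
  using eq_refl[OF rs1_def] unfolding le_INF_iff le_arr_iff by blast

lemma strict2: "\<lbrakk>u \<le> F x y; x \<in> X; y \<in> Y\<rbrakk> \<Longrightarrow> rs2 \<cdot> u \<le> d y y"
  using eq_refl[OF rs2_def] unfolding le_INF_iff le_arr_iff by blast

lemma cong: "\<lbrakk>u \<le> e x x'; v \<le> F x y; w \<le> d y y'; x \<in> X; x' \<in> X; y \<in> Y; y' \<in> Y\<rbrakk> \<Longrightarrow> rcong \<cdot> u \<cdot> v \<cdot> w \<le> F x' y'"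
  using eq_refl[OF rcong_def] unfolding le_INF_iff le_arr_iff by blast

lemma single: "\<lbrakk>u \<le> F x y; v \<le> F x y'; x \<in> X; y \<in> Y; y' \<in> Y\<rbrakk> \<Longrightarrow> rsingle \<cdot> u \<cdot> v \<le> d y y'"
  using eq_refl[OF rsingle_def] unfolding le_INF_iff le_arr_iff by blast

lemma total: "u \<le> e x x \<Longrightarrow> x \<in> X \<Longrightarrow> rtotal \<cdot> u \<le> ex Y (F x)"
  using eq_refl[OF rtotal_def] unfolding le_INF_iff le_arr_iff by blast

lemma cong1: "\<lbrakk>u \<le> e x x'; v \<le> F x y; x \<in> X; x' \<in> X; y \<in> Y\<rbrakk> \<Longrightarrow> rcong1 \<cdot> u \<cdot> v \<le> F x' y"
  unfolding rcong1_def
  by (rule order_trans[OF app_mono[OF beta order_refl]], rule order_trans[OF beta])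
    (blast intro: cong strict2)

lemma cong2: "\<lbrakk>v \<le> F x y; w \<le> d y y'; x \<in> X; y \<in> Y; y' \<in> Y\<rbrakk> \<Longrightarrow> rcong2 \<cdot> v \<cdot> w \<le> F x y'"
  unfolding rcong2_def
  by (rule order_trans[OF app_mono[OF beta order_refl]], rule order_trans[OF beta])
    (blast intro: cong strict1)

end

context impl begin

text \<open>After \<open>sepI\<close> the realizer is a schematic variable, which resolution with these and the other
  typing rules instantiates; this keeps it independent of the quantified individuals.\<close>

lemmas seqI = INF_greatest lam_le

lemma entailsD:
  assumes "entails A I f g"
  shows "(INF i\<in>I. f i \<leadsto> g i) \<in> \<Sigma>" (is "?t \<in> _")
    and "u \<le> f i \<Longrightarrow> i \<in> I \<Longrightarrow> (INF i\<in>I. f i \<leadsto> g i) \<cdot> u \<le> g i"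
  using assms order_refl[of ?t] unfolding entails_def le_INF_iff[of ?t] le_arr_iff[of ?t] by simp_all

lemma entailsE:
  assumes "entails A I f g"
  obtains t where "t \<in> \<Sigma>" and "\<And>i u. u \<le> f i \<Longrightarrow> i \<in> I \<Longrightarrow> t \<cdot> u \<le> g i"
  using entailsD[OF assms] by (rule that)

definition entails2 where
  "entails2 X Y F G \<longleftrightarrow> (INF x\<in>X. INF y\<in>Y. F x y \<leadsto> G x y) \<in> \<Sigma>"

lemma entails2D:
  assumes "entails2 X Y F G"
  shows "(INF x\<in>X. INF y\<in>Y. F x y \<leadsto> G x y) \<in> \<Sigma>" (is "?t \<in> _")
    and "\<lbrakk>u \<le> F x y; x \<in> X; y \<in> Y\<rbrakk> \<Longrightarrow> (INF x\<in>X. INF y\<in>Y. F x y \<leadsto> G x y) \<cdot> u \<le> G x y"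
  using assms order_refl[of ?t] unfolding entails2_def le_INF_iff[of ?t] le_arr_iff[of ?t] by simp_all

definition rel_eq where
  "rel_eq X Y F G \<longleftrightarrow> entails2 X Y F G \<and> entails2 X Y G F"

definition rinj where
  "rinj X Y e F \<longleftrightarrow> (INF x\<in>X. INF x'\<in>X. INF y\<in>Y. F x y \<leadsto> F x' y \<leadsto> e x x') \<in> \<Sigma>"

lemma rinjD:
  assumes "rinj X Y e F"
  shows "(INF x\<in>X. INF x'\<in>X. INF y\<in>Y. F x y \<leadsto> F x' y \<leadsto> e x x') \<in> \<Sigma>" (is "?t \<in> _")
    and "\<lbrakk>u \<le> F x y; v \<le> F x' y; x \<in> X; x' \<in> X; y \<in> Y\<rbrakk>
        \<Longrightarrow> (INF x\<in>X. INF x'\<in>X. INF y\<in>Y. F x y \<leadsto> F x' y \<leadsto> e x x') \<cdot> u \<cdot> v \<le> e x x'"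
  using assms order_refl[of ?t] unfolding rinj_def le_INF_iff[of ?t] le_arr_iff by simp_all

section \<open>Composition, images and restriction of relations\<close>

definition cmp where
  "cmp Y F G x z = ex Y (\<lambda>y. F x y \<otimes> G y z)"

definition im where
  "im X F y = ex X (\<lambda>x. F x y)"

text \<open>One relation in two roles: the partial equivalence relation of the subobject cut out by
  \<open>Q\<close>, and the functional relation of its inclusion.\<close>

definition sb where
  "sb e Q x y = e x y \<otimes> Q x"

lemma frel_cmp:
  assumes "frel A X e Y d F" "frel A Y d Z r G"
  shows "frel A X e Z r (cmp Y F G)"
proof -
  interpret F: frel A X e Y d F by fact
  interpret G: frel A Y d Z r G by fact
  note seps = definables F.seps G.seps
  show ?thesis unfolding cmp_def
  proof
    show "(INF x\<in>X. INF z\<in>Z. ex Y (\<lambda>y. F x y \<otimes> G y z) \<leadsto> e x x) \<in> \<Sigma>"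
      by (rule sepI, (rule seqI)+, (erule unwit_le le_cnjE)+,
          (assumption | rule F.strict1)+, intro seps)
    show "(INF x\<in>X. INF z\<in>Z. ex Y (\<lambda>y. F x y \<otimes> G y z) \<leadsto> r z z) \<in> \<Sigma>"
      by (rule sepI, (rule seqI)+, (erule unwit_le le_cnjE)+,
          (assumption | rule G.strict2)+, intro seps)
    show "(INF x\<in>X. INF x'\<in>X. INF z\<in>Z. INF z'\<in>Z. e x x' \<leadsto> ex Y (\<lambda>y. F x y \<otimes> G y z) \<leadsto> r z z'
        \<leadsto> ex Y (\<lambda>y. F x' y \<otimes> G y z')) \<in> \<Sigma>"
      by (rule sepI, (rule seqI)+, (erule unwit_le le_cnjE)+,
          (assumption | rule wit_le pr_le F.cong1 G.cong2)+, intro seps)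
    show "(INF x\<in>X. INF z\<in>Z. INF z'\<in>Z. ex Y (\<lambda>y. F x y \<otimes> G y z) \<leadsto> ex Y (\<lambda>y. F x y \<otimes> G y z')
        \<leadsto> r z z') \<in> \<Sigma>"
      by (rule sepI, (rule seqI)+, (erule unwit_le le_cnjE)+,
          (rule G.single[OF G.cong1[OF F.single]]; assumption), intro seps)
    show "(INF x\<in>X. e x x \<leadsto> ex Z (\<lambda>z. ex Y (\<lambda>y. F x y \<otimes> G y z))) \<in> \<Sigma>"
      by (rule sepI, (rule seqI)+, rule unwit_le, rule F.total, assumption+,
          rule unwit_le, rule G.total, rule F.strict2, assumption+,
          (assumption | rule wit_le pr_le)+, intro seps)
  qed
qed

lemma cmp_assoc: "rel_eq X W (cmp Z (cmp Y F G) H) (cmp Y F (cmp Z G H))"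
  unfolding rel_eq_def entails2_def cmp_def
  apply (rule conjI)
   apply (rule sepI, (rule seqI)+, (erule unwit_le le_cnjE)+, (assumption | rule wit_le pr_le)+, intro definables)
  apply (rule sepI, (rule seqI)+, (erule unwit_le le_cnjE)+, (assumption | rule wit_le pr_le)+, intro definables)
  done

text \<open>Given \<open>G x y\<close>, totality of \<open>F\<close> yields some \<open>y'\<close>
  with \<open>F x y'\<close>, hence \<open>G x y'\<close>; single-valuedness of \<open>G\<close>
  makes \<open>y'\<close> equal to \<open>y\<close>, and \<open>F\<close> respects this equality.
  Equality of arrows therefore costs only one inclusion.\<close>

lemma rel_eq_if_entails2:
  assumes "frel A X e Y d F" "frel A X e Y d G" "entails2 X Y F G"
  shows "rel_eq X Y F G"
proof -
  interpret F: frel A X e Y d F by fact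
  interpret G: frel A X e Y d G by fact
  note t = entails2D[OF assms(3)]
  have "entails2 X Y G F"
    unfolding entails2_def
    by (rule sepI, (rule seqI)+, rule unwit_le, rule F.total, rule G.strict1, assumption+,
        (assumption | rule F.cong2 G.single t(2))+, intro definables F.seps G.seps t(1))
  then show ?thesis using assms(3) by (simp add: rel_eq_def)
qed

end

section \<open>Strict extensional predicates and factorisation through images\<close>

locale spred = per A X e for A :: "'a::complete_lattice impl_alg" and X :: "'u set" and e +
  fixes Q :: "'u \<Rightarrow> 'a"
  assumes pstrict_sep: "(INF x\<in>X. Q x \<leadsto> e x x) \<in> \<Sigma>"
    and pext_sep: "(INF x\<in>X. INF y\<in>X. e x y \<leadsto> Q x \<leadsto> Q y) \<in> \<Sigma>"
begin

definition "rpstrict = (INF x\<in>X. Q x \<leadsto> e x x)"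
definition "rpext = (INF x\<in>X. INF y\<in>X. e x y \<leadsto> Q x \<leadsto> Q y)"

lemma pseps: "rpstrict \<in> \<Sigma>" "rpext \<in> \<Sigma>"
  unfolding rpstrict_def rpext_def using pstrict_sep pext_sep .

lemma pstrict: "u \<le> Q x \<Longrightarrow> x \<in> X \<Longrightarrow> rpstrict \<cdot> u \<le> e x x"
  using eq_refl[OF rpstrict_def] unfolding le_INF_iff le_arr_iff by blast

lemma pext: "\<lbrakk>u \<le> e x y; v \<le> Q x; x \<in> X; y \<in> X\<rbrakk> \<Longrightarrow> rpext \<cdot> u \<cdot> v \<le> Q y"
  using eq_refl[OF rpext_def] unfolding le_INF_iff le_arr_iff by blast

lemma per_sb: "per A X (sb e Q)"
  unfolding sb_def
  apply unfold_locales
   apply (rule sepI, (rule seqI)+, (erule le_cnjE)+, (assumption | rule pr_le sym pext)+,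
      intro definables seps pseps)
  apply (rule sepI, (rule seqI)+, (erule le_cnjE)+, rule pr_le, rule trans, assumption+,
      intro definables seps pseps)
  done

lemma frel_sb: "frel A X (sb e Q) X e (sb e Q)"
  apply (rule frel.intro[OF impl_axioms per_sb per_axioms frel_axioms.intro]; unfold sb_def)
        apply (rule sepI, (rule seqI)+, (erule le_cnjE)+, rule pr_le, rule left, assumption+,
      intro definables seps pseps)
       apply (rule sepI, (rule seqI)+, (erule le_cnjE)+, rule right, assumption+,
      intro definables seps pseps)
      apply (rule sepI, (rule seqI)+, (erule le_cnjE)+, rule pr_le, rule trans[OF trans[OF sym]], assumption+,
           rule pext, assumption+,
      intro definables seps pseps)
     apply (rule sepI, (rule seqI)+, (erule le_cnjE)+, rule trans[OF sym], assumption+,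
      intro definables seps pseps)
    apply (rule sepI, (rule seqI)+, rule wit_le, assumption+,
      intro definables seps pseps)
    done

lemma rinj_sb: "rinj X X (sb e Q) (sb e Q)"
  unfolding rinj_def sb_def
  by (rule sepI, (rule seqI)+, (erule le_cnjE)+, rule pr_le, rule trans[OF _ sym], assumption+,
      intro definables seps pseps)

text \<open>With this, every strict extensional predicate is the image of a monomorphism;
  extensionality gives one direction and strictness the other.\<close>

lemma im_sb: "entails A X (im X (sb e Q)) Q" "entails A X Q (im X (sb e Q))"
  unfolding entails_def im_def sb_def
   apply (rule sepI, (rule seqI)+, (erule unwit_le le_cnjE)+, (assumption | rule pext)+,
      intro definables seps pseps)
  apply (rule sepI, (rule seqI)+, (assumption | rule wit_le pr_le pstrict)+,
      intro definables seps pseps)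
  done
end

context impl begin

lemma spred_im:
  assumes "frel A Y d X e M"
  shows "spred A X e (im Y M)"
proof -
  interpret M: frel A Y d X e M by fact
  show ?thesis unfolding im_def
    apply unfold_locales
     apply (rule sepI, (rule seqI)+, erule unwit_le, (assumption | rule M.strict2)+,
      intro definables M.seps)
    apply (rule sepI, (rule seqI)+, erule unwit_le, (assumption | rule wit_le M.cong2)+,
      intro definables M.seps)
    done
qed

text \<open>The relation \<open>F\<close> followed by the converse of \<open>M\<close>.\<close>

definition factor where
  "factor X F M z y = ex X (\<lambda>x. F z x \<otimes> M y x)"

text \<open>The entailment between images makes the mediating relation total, and injectivity of
  \<open>M\<close> makes it single-valued. The triangle then commutes because one inclusion of
  functional relations is enough.\<close>

lemma factor:
  assumes "frel A Z r X e F" "frel A Y d X e M" "rinj Y X d M" "entails A X (im Z F) (im Y M)"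
  shows "frel A Z r Y d (factor X F M)" "rel_eq Z X (cmp Y (factor X F M) M) F"
proof -
  interpret F: frel A Z r X e F by fact
  interpret M: frel A Y d X e M by fact
  note t = rinjD[OF assms(3)]
  note k = entailsD[OF assms(4), unfolded im_def]
  note seps = definables F.seps M.seps t(1) k(1)
  show K: "frel A Z r Y d (factor X F M)"
    unfolding factor_def
    apply unfold_locales
        apply (rule sepI, (rule seqI)+, (erule unwit_le le_cnjE)+,
          (assumption | rule F.strict1)+, intro seps)
       apply (rule sepI, (rule seqI)+, (erule unwit_le le_cnjE)+,
          (assumption | rule M.strict1)+, intro seps)
      apply (rule sepI, (rule seqI)+, (erule unwit_le le_cnjE)+,
          (assumption | rule wit_le pr_le F.cong1 M.cong1)+, intro seps)
     apply (rule sepI, (rule seqI)+, (erule unwit_le le_cnjE)+,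
          rule t(2)[OF M.cong2[OF _ F.single]], assumption+, intro seps)
    apply (rule sepI, (rule seqI)+, rule unwit_le, rule F.total, assumption+,
         rule unwit_le, rule k(2), rule wit_le, assumption+,
          (assumption | rule wit_le pr_le)+, intro seps)
    done
  have "entails2 Z X (cmp Y (factor X F M) M) F"
    unfolding entails2_def cmp_def factor_def
    by (rule sepI, (rule seqI)+, (erule unwit_le le_cnjE)+, rule F.cong2[OF _ M.single], assumption+, intro seps)
  then show "rel_eq Z X (cmp Y (factor X F M) M) F"
    using rel_eq_if_entails2 frel_cmp[OF K assms(2)] assms(1) by blast
qed

lemma im_cmp: "entails A X (im Z (cmp Y K M)) (im Y M)"
  unfolding entails_def im_def cmp_def
  by (rule sepI, (rule seqI)+, erule unwit_le, (erule unwit_le le_cnjE)+,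
      rule wit_le, assumption+, intro definables)

text \<open>From \<open>F z y\<close> follow \<open>M\<close> to some \<open>x\<close>; the
  composite with \<open>G\<close> also relates \<open>z\<close> to \<open>x\<close>, through some
  \<open>y'\<close> with \<open>G z y'\<close> and \<open>M y' x\<close>. Injectivity of
  \<open>M\<close> identifies \<open>y\<close> with \<open>y'\<close>.\<close>

lemma cancel_rinj:
  assumes "frel A Z r Y d F" "frel A Z r Y d G" "frel A Y d X e M" "rinj Y X d M"
    "entails2 Z X (cmp Y F M) (cmp Y G M)"
  shows "rel_eq Z Y F G"
proof -
  interpret F: frel A Z r Y d F by fact
  interpret G: frel A Z r Y d G by fact
  interpret M: frel A Y d X e M by fact
  note t = rinjD[OF assms(4)]
  note k = entails2D[OF assms(5), unfolded cmp_def]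
  have "entails2 Z Y F G" unfolding entails2_def
    by (rule sepI, (rule seqI)+, rule unwit_le, rule M.total, rule F.strict2, assumption+,
        rule unwit_le, rule k(2), rule wit_le, rule pr_le, assumption+, (erule le_cnjE)+,
        rule G.cong2, assumption, rule t(2), assumption+, intro definables F.seps G.seps M.seps t(1) k(1))
  then show ?thesis using rel_eq_if_entails2 assms by blast
qed

end

section \<open>The fibres of the tripos on representatives\<close>

lemma INF_Times: "(INF p\<in>X \<times> Y. f p) = (INF x\<in>X. INF y\<in>Y. (f (x, y) :: 'a::complete_lattice))"
  by (rule antisym) (force intro!: INF_greatest intro: INF_lower INF_lower2)+

context impl begin

lemma alg_ex_image: "ex (h ` J) f = ex J (\<lambda>j. f (h j))"
  unfolding alg_ex_def by (simp add: image_image)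

lemma entails_refl: "entails A I f f"
  unfolding entails_def
  by (rule sepI, (rule seqI)+, assumption, intro definables)

lemma entails_trans:
  assumes "entails A I f g" "entails A I g h"
  shows "entails A I f h"
proof -
  note s = entailsD[OF assms(1)]
  note t = entailsD[OF assms(2)]
  show ?thesis unfolding entails_def
    by (rule sepI, (rule seqI)+, (assumption | rule t(2) s(2))+, intro definables s(1) t(1))
qed

lemma entails_conj_mono:
  assumes "entails A I f f'" "entails A I g g'"
  shows "entails A I (\<lambda>i. f i \<otimes> g i) (\<lambda>i. f' i \<otimes> g' i)"
proof -
  note s = entailsD[OF assms(1)]
  note t = entailsD[OF assms(2)]
  show ?thesis unfolding entails_def
    by (rule sepI, (rule seqI | erule le_cnjE)+, rule pr_le, rule s(2), assumption+, rule t(2),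
        assumption+, intro definables s(1) t(1))
qed

lemma entails_conjI:
  assumes "entails A I f g" "entails A I f h"
  shows "entails A I f (\<lambda>i. g i \<otimes> h i)"
proof -
  note s = entailsD[OF assms(1)]
  note t = entailsD[OF assms(2)]
  show ?thesis unfolding entails_def
    by (rule sepI, (rule seqI | erule le_cnjE)+, rule pr_le, rule s(2), assumption+, rule t(2),
        assumption+, intro definables s(1) t(1))
qed

lemma entails_conj1: "entails A I (\<lambda>i. g i \<otimes> h i) g" and entails_conj2: "entails A I (\<lambda>i. g i \<otimes> h i) h"
  unfolding entails_def
  by (rule sepI, (rule seqI | erule le_cnjE)+, assumption, intro definables)+

lemma entails_conj_iff:
  "entails A I f (\<lambda>i. g i \<otimes> h i) \<longleftrightarrow> entails A I f g \<and> entails A I f h"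
  by (blast intro: entails_conjI entails_trans entails_conj1 entails_conj2)

lemma entails_curry:
  "entails A I (\<lambda>i. f i \<otimes> g i) h \<longleftrightarrow> entails A I f (\<lambda>i. g i \<leadsto> h i)"
proof
  assume "entails A I (\<lambda>i. f i \<otimes> g i) h"
  note t = entailsD[OF this]
  show "entails A I f (\<lambda>i. g i \<leadsto> h i)" unfolding entails_def
    by (rule sepI, (rule seqI)+, (assumption | rule t(2) pr_le)+, intro definables t(1))
next
  assume "entails A I f (\<lambda>i. g i \<leadsto> h i)"
  note t = entailsD[OF this]
  show "entails A I (\<lambda>i. f i \<otimes> g i) h" unfolding entails_def
    by (rule sepI, (rule seqI | erule le_cnjE)+, rule app_le, rule t(2), assumption+,
        intro definables t(1))
qed

lemma entails_restrict [simp]: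
  "entails A I (restrict f I) g = entails A I f g" "entails A I f (restrict g I) = entails A I f g"
  unfolding entails_def by (auto intro!: arg_cong[where f = "\<lambda>a. a \<in> \<Sigma>"] INF_cong)

lemma entails_cong:
  "(\<And>i. i \<in> I \<Longrightarrow> f i = f' i) \<Longrightarrow> (\<And>i. i \<in> I \<Longrightarrow> g i = g' i) \<Longrightarrow> entails A I f g = entails A I f' g'"
  unfolding entails_def by (auto intro!: arg_cong[where f = "\<lambda>a. a \<in> \<Sigma>"] INF_cong)

lemma entails_reindex:
  assumes "entails A J f g" "\<And>i. i \<in> I \<Longrightarrow> h i \<in> J"
  shows "entails A I (\<lambda>i. f (h i)) (\<lambda>i. g (h i))"
  using assms unfolding entails_def
  by (elim sep_up) (auto intro!: INF_greatest INF_lower)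

lemma entails_ex_mono:
  assumes "entails A I f g" "\<And>j. j \<in> J \<Longrightarrow> K j \<subseteq> I"
  shows "entails A J (\<lambda>j. ex (K j) f) (\<lambda>j. ex (K j) g)"
proof -
  note t = entailsD[OF assms(1)]
  show ?thesis unfolding entails_def
    by (rule sepI, (rule seqI | erule unwit_le)+, rule wit_le, rule t(2), assumption,
        erule (1) subsetD[OF assms(2)], assumption, intro definables t(1))
qed

lemma equiv_tripos_rel: "equiv (extensional I) (tripos_rel A I)"
  by (rule equivI) (auto simp: tripos_rel_def refl_on_def entails_refl intro!: symI transI intro: entails_trans)

lemma pred_class_in_tripos: "pred_class A I f \<in> tripos A I"
  unfolding pred_class_def tripos_def by (rule quotientI) simp

lemma pred_class_cong: "(\<And>i. i \<in> I \<Longrightarrow> f i = g i) \<Longrightarrow> pred_class A I f = pred_class A I g"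
  unfolding pred_class_def by (simp cong: restrict_cong)

lemma pred_class_eq_iff:
  "pred_class A I f = pred_class A I g \<longleftrightarrow> entails A I f g \<and> entails A I g f"
  unfolding pred_class_def
  by (subst eq_equiv_class_iff[OF equiv_tripos_rel]) (simp_all add: tripos_rel_def)

lemma pred_class_rep: "F \<in> tripos A I \<Longrightarrow> pred_class A I (pred_rep F) = F"
proof -
  assume F: "F \<in> tripos A I"
  then obtain f where f: "f \<in> extensional I" "F = tripos_rel A I `` {f}"
    unfolding tripos_def by (rule quotientE)
  have "pred_rep F \<in> F"
    unfolding pred_rep_def by (rule someI[of _ f]) (use f in \<open>auto simp: tripos_rel_def entails_refl\<close>)
  moreover from this f have "restrict (pred_rep F) I = pred_rep F"
    by (auto simp: tripos_rel_def extensional_restrict)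
  ultimately show ?thesis
    using f unfolding pred_class_def
    by (metis Image_singleton_iff equiv_class_eq equiv_tripos_rel)
qed

text \<open>The chosen representative agrees with \<open>f\<close> up to mutual entailment, so
  operations defined on chosen representatives can be computed on any others.\<close>

lemma rep_pred_class:
  "entails A I (pred_rep (pred_class A I f)) f" "entails A I f (pred_rep (pred_class A I f))"
  using pred_class_rep[OF pred_class_in_tripos, of I f] unfolding pred_class_eq_iff by simp_all

lemma pred_le_class: "pred_le A I (pred_class A I f) (pred_class A I g) \<longleftrightarrow> entails A I f g"
  unfolding pred_le_def using rep_pred_class entails_trans by blast

lemma pred_conj_class:
  "pred_conj A I (pred_class A I f) (pred_class A I g) = pred_class A I (\<lambda>i. f i \<otimes> g i)"
  unfolding pred_conj_def pred_class_eq_iff by (intro conjI entails_conj_mono rep_pred_class)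

lemma reindex_class:
  "(\<And>i. i \<in> I \<Longrightarrow> h i \<in> J) \<Longrightarrow> reindex A I h (pred_class A J f) = pred_class A I (\<lambda>i. f (h i))"
  unfolding reindex_def pred_class_eq_iff
  by (blast intro: entails_reindex[OF rep_pred_class(1)] entails_reindex[OF rep_pred_class(2)])

lemma pred_ex_class:
  "pred_ex A I J h (pred_class A I f) = pred_class A J (\<lambda>j. ex {i \<in> I. h i = j} f)"
  unfolding pred_ex_def pred_class_eq_iff
  by (intro conjI entails_ex_mono[OF rep_pred_class(1)] entails_ex_mono[OF rep_pred_class(2)]) auto

section \<open>Binary relations as elements of the fibres\<close>

definition mk where
  "mk X Y F = pred_class A (X \<times> Y) (\<lambda>(x, y). F x y)"

lemma mk_in_tripos: "mk X Y F \<in> tripos A (X \<times> Y)"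
  unfolding mk_def by (rule pred_class_in_tripos)

lemma mk_rep: "F \<in> tripos A (X \<times> Y) \<Longrightarrow> mk X Y (\<lambda>x y. pred_rep F (x, y)) = F"
  unfolding mk_def using pred_class_rep by auto

lemma entails_Times: "entails A (X \<times> Y) f g \<longleftrightarrow> entails2 X Y (\<lambda>x y. f (x, y)) (\<lambda>x y. g (x, y))"
  unfolding entails_def entails2_def INF_Times ..

lemma mk_eq_iff: "mk X Y F = mk X Y G \<longleftrightarrow> rel_eq X Y F G"
  unfolding mk_def pred_class_eq_iff rel_eq_def entails_Times by simp

text \<open>Currying removes the conjunctions on the left, and meets over products split into
  iterated meets.\<close>

lemma is_per_mk_iff: "is_per A X (mk X X e) \<longleftrightarrow> per A X e"
proof -
  have "is_per A X (mk X X e) \<longleftrightarrow> (INF x\<in>X. INF y\<in>X. e x y \<leadsto> e y x) \<in> \<Sigma> \<and>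
      (INF x\<in>X. INF y\<in>X. INF z\<in>X. e x y \<leadsto> e y z \<leadsto> e x z) \<in> \<Sigma>"
    unfolding is_per_def Let_def mk_def
    apply (subst reindex_class, force)+
    unfolding pred_conj_class pred_le_class entails_curry
    by (auto simp: entails_def INF_Times pred_class_in_tripos split_def)
  also have "\<dots> \<longleftrightarrow> per A X e"
    unfolding per_def per_axioms_def using impl_axioms by blast
  finally show ?thesis .
qed

lemma functional_rel_mk_iff:
  assumes "per A X e" "per A Y d"
  shows "functional_rel A (X, mk X X e) (Y, mk Y Y d) (mk X Y F) \<longleftrightarrow> frel A X e Y d F"
proof -
  have *: "ex {i \<in> X \<times> Y. fst i = x} f = ex Y (\<lambda>y. f (x, y))" if "x \<in> X" for x f
  proof -
    have "{i \<in> X \<times> Y. fst i = x} = Pair x ` Y" using that by auto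
    then show ?thesis by (simp add: alg_ex_image)
  qed
  have "functional_rel A (X, mk X X e) (Y, mk Y Y d) (mk X Y F) \<longleftrightarrow> frel_axioms A X e Y d F"
    unfolding functional_rel_def Let_def mk_def prod.case
    apply (subst reindex_class, force)+
    unfolding pred_conj_class pred_ex_class pred_le_class entails_curry entails_conj_iff frel_axioms_def
    by (auto simp: entails_def INF_Times pred_class_in_tripos split_def * cong: INF_cong)
  then show ?thesis
    unfolding frel_def using assms impl_axioms by blast
qed

lemma rel_comp_mk: "rel_comp A X Y Z (mk Y Z G) (mk X Y F) = mk X Z (cmp Y F G)"
proof -
  have *: "ex {i \<in> X \<times> Y \<times> Z. (case i of (x, y, z) \<Rightarrow> (x, z)) = (x', z')} f = ex Y (\<lambda>y. f (x', y, z'))"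
    if "x' \<in> X" "z' \<in> Z" for x' z' f
  proof -
    have "{i \<in> X \<times> Y \<times> Z. (case i of (x, y, z) \<Rightarrow> (x, z)) = (x', z')} = (\<lambda>y. (x', y, z')) ` Y"
      using that by auto
    then show ?thesis by (simp add: alg_ex_image)
  qed
  show ?thesis
    unfolding rel_comp_def Let_def mk_def
    apply (subst reindex_class, force)+
    unfolding pred_conj_class pred_ex_class by (rule pred_class_cong) (auto simp: * cmp_def)
qed

end

section \<open>Subobjects in the topos\<close>

context impl begin

text \<open>A set-theoretic function \<open>c\<close> induces an arrow once it respects the two
  equalities up to a realizer. The factor \<open>e x x\<close> provides strictness, and
  \<open>d (c x) y\<close> admits every \<open>y\<close> equal to the value.\<close>

definition graph where
  "graph e d c x y = e x x \<otimes> d (c x) y"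

lemma frel_graph:
  assumes "per A X e" "per A Y d" "\<And>x. x \<in> X \<Longrightarrow> c x \<in> Y" "entails2 X X e (\<lambda>x x'. d (c x) (c x'))"
  shows "frel A X e Y d (graph e d c)"
proof -
  interpret X: per A X e by fact
  interpret Y: per A Y d by fact
  note t = entails2D[OF assms(4)]
  note seps = definables X.seps Y.seps t(1)
  show ?thesis
    unfolding graph_def
    apply unfold_locales
        apply (rule sepI, (rule seqI | erule le_cnjE)+, assumption, intro seps)
       apply (rule sepI, (rule seqI | erule le_cnjE)+, rule Y.right, (assumption | rule assms(3))+, intro seps)
      apply (rule sepI, (rule seqI | erule le_cnjE)+, rule pr_le, rule X.right, assumption+,
        rule Y.trans[OF Y.trans[OF t(2)[OF X.sym]]], (assumption | rule assms(3))+, intro seps)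
     apply (rule sepI, (rule seqI | erule le_cnjE)+, rule Y.trans[OF Y.sym],
        (assumption | rule assms(3))+, intro seps)
    apply (rule sepI, (rule seqI)+, rule wit_le, rule pr_le, assumption, rule t(2),
        (assumption | rule assms(3))+, intro seps)
    done
qed

lemma cmp_graph_graph:
  fixes X Y Z :: "'u set"
  assumes "per A X e" "per A Y d" "per A Z r"
    and c: "\<And>x. x \<in> X \<Longrightarrow> c x \<in> Y" "entails2 X X e (\<lambda>x x'. d (c x) (c x'))"
    and c': "\<And>y. y \<in> Y \<Longrightarrow> c' y \<in> Z" "entails2 Y Y d (\<lambda>y y'. r (c' y) (c' y'))"
  shows "rel_eq X Z (cmp Y (graph e d c) (graph d r c')) (graph e r (\<lambda>x. c' (c x)))"
proof -
  interpret X: per A X e by fact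
  interpret Y: per A Y d by fact
  interpret Z: per A Z r by fact
  note s = entails2D[OF c(2)]
  note t = entails2D[OF c'(2)]
  note seps = definables X.seps Y.seps Z.seps s(1) t(1)
  have "frel A X e Z r (graph e r (\<lambda>x. c' (c x)))"
    by (rule frel_graph[OF assms(1,3)], erule c'(1)[OF c(1)], unfold entails2_def,
        rule sepI, (rule seqI)+, rule t(2)[OF s(2)], (assumption | rule c(1))+, intro seps)
  moreover have "entails2 X Z (cmp Y (graph e d c) (graph d r c')) (graph e r (\<lambda>x. c' (c x)))"
    unfolding entails2_def cmp_def graph_def
    by (rule sepI, (rule seqI | erule unwit_le le_cnjE)+, rule pr_le, assumption, rule Z.trans[OF t(2)],
        (assumption | rule c(1) c'(1))+, intro seps)
  ultimately show ?thesis
    using rel_eq_if_entails2 frel_cmp[OF frel_graph[OF assms(1,2) c] frel_graph[OF assms(2,3) c']] by blast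
qed

text \<open>The kernel pair of \<open>F\<close> is built on codes \<open>p\<close> of pairs:
  \<open>k p q\<close> says that the components of \<open>p\<close> and \<open>q\<close> are equal
  and that the two components of \<open>p\<close> have a common value under \<open>F\<close>. Its
  projections become equal after composition with \<open>F\<close>. If they are already equal, and
  every pair has a code, then any two points with a common value are equal.\<close>

lemma rinj_if_kernel:
  assumes F: "frel A X e Y d F" and a: "\<And>p. p \<in> K \<Longrightarrow> a p \<in> X" and b: "\<And>p. p \<in> K \<Longrightarrow> b p \<in> X"
    and k: "k = (\<lambda>p q. (e (a p) (a q) \<otimes> e (b p) (b q)) \<otimes> ex Y (\<lambda>y. F (a p) y \<otimes> F (b p) y))"
  shows "frel A K k X e (graph k e a)" "frel A K k X e (graph k e b)"
    "rel_eq K Y (cmp X (graph k e a) F) (cmp X (graph k e b) F)"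
    "(\<And>x x'. x \<in> X \<Longrightarrow> x' \<in> X \<Longrightarrow> \<exists>p\<in>K. a p = x \<and> b p = x') \<Longrightarrow> rel_eq K X (graph k e a) (graph k e b)
      \<Longrightarrow> rinj X Y e F"
proof -
  interpret F: frel A X e Y d F by fact
  note seps = definables F.seps
  interpret K: per A K k unfolding k
    apply unfold_locales
     apply (rule sepI, (rule seqI | erule unwit_le le_cnjE)+,
        (assumption | rule pr_le F.X.sym wit_le a b F.cong1)+, intro seps)
    apply (rule sepI, (rule seqI | erule unwit_le le_cnjE)+,
        rule pr_le, rule pr_le, rule F.X.trans, assumption+, (erule a)+,
        rule F.X.trans, assumption+, (erule b)+, rule wit_le, rule pr_le, assumption+, intro seps)
    done
  have ke: "entails2 K K k (\<lambda>p q. e (a p) (a q))" "entails2 K K k (\<lambda>p q. e (b p) (b q))"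
    unfolding k entails2_def
    by (rule sepI, (rule seqI | erule le_cnjE)+, assumption, intro seps)+
  then show a': "frel A K k X e (graph k e a)" and b': "frel A K k X e (graph k e b)"
    by (simp_all add: frel_graph[OF K.per_axioms F.X.per_axioms] a b)
  note s = entails2D[OF ke(2)]
  have "entails A K (\<lambda>p. k p p) (\<lambda>p. ex Y (\<lambda>y. F (a p) y \<otimes> F (b p) y))"
    unfolding k by (rule entails_conj2)
  note m = entailsD[OF this]
  have "entails2 K Y (cmp X (graph k e a) F) (cmp X (graph k e b) F)"
    unfolding entails2_def cmp_def graph_def
    by (rule sepI, (rule seqI | erule unwit_le le_cnjE)+, rule unwit_le, rule m(2), assumption+,
        erule le_cnjE, rule wit_le, (rule pr_le)+, assumption, rule s(2), assumption+,
        rule F.cong2[OF _ F.single[OF _ F.cong1[OF F.X.sym]]],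
        (assumption | rule a b)+, intro seps s(1) m(1))
  then show "rel_eq K Y (cmp X (graph k e a) F) (cmp X (graph k e b) F)"
    using rel_eq_if_entails2 frel_cmp[OF a' F] frel_cmp[OF b' F] by blast
  assume surj: "\<And>x x'. x \<in> X \<Longrightarrow> x' \<in> X \<Longrightarrow> \<exists>p\<in>K. a p = x \<and> b p = x'"
    and ab: "rel_eq K X (graph k e a) (graph k e b)"
  have "entails2 K X (graph k e a) (graph k e b)" using ab by (simp add: rel_eq_def)
  from entails2D[OF this] obtain t where t: "t \<in> \<Sigma>" "\<And>p x u. \<lbrakk>u \<le> graph k e a p x; p \<in> K; x \<in> X\<rbrakk>
      \<Longrightarrow> t \<cdot> u \<le> graph k e b p x" by (rule that)
  \<comment> \<open>The code \<open>p\<close> no longer occurs in this statement, so the realizer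
    built from \<open>t\<close> is uniform in \<open>x\<close> and \<open>x'\<close>.\<close>
  have t': "p2 (t \<cdot> u) \<le> e x' x"
    if u: "u \<le> ((e x x \<otimes> e x' x') \<otimes> ex Y (\<lambda>y. F x y \<otimes> F x' y)) \<otimes> e x x" and x: "x \<in> X" "x' \<in> X" for u x x'
  proof -
    obtain p where p: "p \<in> K" "a p = x" "b p = x'" using surj[OF x] by blast
    have "t \<cdot> u \<le> graph k e b p x" using u p x by (intro t(2)) (simp_all add: graph_def k)
    then show ?thesis unfolding graph_def p by (rule p2_le)
  qed
  show "rinj X Y e F"
    unfolding rinj_def
    by (rule sepI, (rule seqI)+, rule F.X.sym, rule t', (rule pr_le)+, rule F.strict1, assumption+,
        rule F.strict1, assumption+, rule wit_le, rule pr_le, assumption+, rule F.strict1, assumption+, intro seps t(1))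
qed

definition pb where
  "pb Y F R x = ex Y (\<lambda>y. F x y \<otimes> R y)"

lemma spred_pb:
  assumes "frel A X e Y d F"
  shows "spred A X e (pb Y F R)"
proof -
  interpret F: frel A X e Y d F by fact
  show ?thesis unfolding pb_def
    apply unfold_locales
     apply (rule sepI, (rule seqI | erule unwit_le le_cnjE)+, (assumption | rule F.strict1)+,
      intro definables F.seps)
    apply (rule sepI, (rule seqI | erule unwit_le le_cnjE)+, (assumption | rule wit_le pr_le F.cong1)+,
      intro definables F.seps)
    done
qed

text \<open>Some value of \<open>F\<close> at \<open>x\<close> satisfies \<open>R\<close>, and
  single-valuedness carries \<open>R\<close> to every other value at \<open>x\<close>.\<close>

lemma pb_counit:
  assumes "frel A X e Y d F" "spred A Y d R"
  shows "entails A Y (im X (cmp X (sb e (pb Y F R)) F)) R"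
proof -
  interpret F: frel A X e Y d F by fact
  interpret R: spred A Y d R by fact
  show ?thesis unfolding entails_def im_def cmp_def sb_def pb_def
    by (rule sepI, (rule seqI | erule unwit_le le_cnjE)+,
        rule R.pext, rule F.single, assumption, rule F.cong1[OF F.X.sym], assumption+,
        intro definables F.seps R.pseps)
qed

text \<open>For \<open>x\<close> in the image of \<open>H\<close>, totality of \<open>F\<close>
  gives a value \<open>y\<close>; the square turns \<open>y\<close> into a value of
  \<open>M\<close>, hence into a point of \<open>R\<close>.\<close>

lemma pb_universal:
  assumes "frel A Z r X e H" "frel A X e Y d F" "entails2 Z Y (cmp X H F) (cmp W K M)"
    "entails A Y (im W M) R"
  shows "entails A X (im Z H) (pb Y F R)"
proof -
  interpret H: frel A Z r X e H by fact
  interpret F: frel A X e Y d F by fact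
  note s = entails2D[OF assms(3), unfolded cmp_def]
  note t = entailsD[OF assms(4), unfolded im_def]
  show ?thesis
    unfolding entails_def pb_def im_def
    by (rule sepI, (rule seqI | erule unwit_le)+, rule unwit_le, rule F.total, rule H.strict2,
        assumption+, rule unwit_le, rule s(2), rule wit_le, rule pr_le, assumption+,
        erule le_cnjE, rule wit_le, rule pr_le, assumption, rule t(2), rule wit_le, assumption+,
        intro definables F.seps H.seps s(1) t(1))
qed

end

section \<open>Objects, arrows and monomorphisms by representatives\<close>

locale topos = impl A for A :: "'a::complete_lattice impl_alg" +
  fixes U :: "'u set set"
  assumes U: "set_universe U"
begin

abbreviation "C \<equiv> tripos_topos U A"

definition ob :: "'u set \<Rightarrow> ('u \<Rightarrow> 'u \<Rightarrow> 'a) \<Rightarrow> ('u, 'a) per_obj" where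
  "ob X e = (X, mk X X e)"

definition ar :: "'u set \<Rightarrow> ('u \<Rightarrow> 'u \<Rightarrow> 'a) \<Rightarrow> 'u set \<Rightarrow> ('u \<Rightarrow> 'u \<Rightarrow> 'a) \<Rightarrow> ('u \<Rightarrow> 'u \<Rightarrow> 'a)
    \<Rightarrow> ('u, 'a) per_arr" where
  "ar X e Y d F = (ob X e, ob Y d, mk X Y F)"

lemma subset_U: "X \<in> U \<Longrightarrow> |Y| \<le>o |X| \<Longrightarrow> Y \<in> U"
  using U unfolding set_universe_def by blast

lemma Obj_iff: "ob X e \<in> Obj C \<longleftrightarrow> X \<in> U \<and> per A X e"
  by (simp add: tripos_topos_def ob_def is_per_mk_iff)

lemma ObjE:
  assumes "S \<in> Obj C"
  obtains X e where "S = ob X e" and "X \<in> U" and "per A X e"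
proof -
  obtain X E where S: "S = (X, E)" by (cases S)
  then have E: "X \<in> U" "is_per A X E" using assms by (simp_all add: tripos_topos_def)
  then have "mk X X (\<lambda>x y. pred_rep E (x, y)) = E" by (intro mk_rep) (simp add: is_per_def)
  then show thesis
    using that[of X "\<lambda>x y. pred_rep E (x, y)"] S E by (simp add: ob_def flip: is_per_mk_iff)
qed

lemma Dom_ar [simp]: "Dom C (ar X e Y d F) = ob X e" and Cod_ar [simp]: "Cod C (ar X e Y d F) = ob Y d"
  by (simp_all add: tripos_topos_def ar_def)

lemma Comp_ar [simp]: "Comp C (ar Y d Z r G) (ar X e Y d F) = ar X e Z r (cmp Y F G)"
  by (simp add: tripos_topos_def ar_def ob_def rel_comp_mk)

lemma ar_eq_iff [simp]: "ar X e Y d F = ar X e Y d G \<longleftrightarrow> rel_eq X Y F G"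
  by (simp add: ar_def mk_eq_iff)

lemma ar_in_hom_iff:
  "ar X e Y d F \<in> hom C (ob X e) (ob Y d) \<longleftrightarrow> X \<in> U \<and> Y \<in> U \<and> frel A X e Y d F"
proof
  assume "ar X e Y d F \<in> hom C (ob X e) (ob Y d)"
  then show "X \<in> U \<and> Y \<in> U \<and> frel A X e Y d F"
    using functional_rel_mk_iff[of X e Y d F]
    by (simp add: hom_def tripos_topos_def ar_def ob_def is_per_mk_iff)
next
  assume *: "X \<in> U \<and> Y \<in> U \<and> frel A X e Y d F"
  then interpret frel A X e Y d F by simp
  show "ar X e Y d F \<in> hom C (ob X e) (ob Y d)"
    using * by (simp add: hom_def tripos_topos_def ar_def ob_def is_per_mk_iff functional_rel_mk_iff
        X.per_axioms Y.per_axioms)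
qed

lemma homE:
  assumes "f \<in> hom C (ob X e) (ob Y d)"
  obtains F where "f = ar X e Y d F" and "X \<in> U" and "Y \<in> U" and "frel A X e Y d F"
proof -
  obtain F where f: "f = (ob X e, ob Y d, F)" and "functional_rel A (ob X e) (ob Y d) F"
    using assms by (cases f) (auto simp: hom_def tripos_topos_def)
  then have "mk X Y (\<lambda>x y. pred_rep F (x, y)) = F"
    by (intro mk_rep) (simp add: functional_rel_def ob_def)
  then have "f = ar X e Y d (\<lambda>x y. pred_rep F (x, y))" using f by (simp add: ar_def)
  then show thesis using that assms ar_in_hom_iff by blast
qed

lemma hom_Arr: "f \<in> hom C S T \<Longrightarrow> f \<in> Arr C"
  by (simp add: hom_def)

lemma Comp_hom: "f \<in> hom C (ob X e) (ob Y d) \<Longrightarrow> g \<in> hom C (ob Y d) (ob Z r) \<Longrightarrow> Comp C g f \<in> hom C (ob X e) (ob Z r)"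
  by (auto elim!: homE simp: ar_in_hom_iff frel_cmp)

lemma Comp_assoc:
  "\<lbrakk>f \<in> hom C (ob X e) (ob Y d); g \<in> hom C (ob Y d) (ob Z r); h \<in> hom C (ob Z r) (ob W s)\<rbrakk>
      \<Longrightarrow> Comp C h (Comp C g f) = Comp C (Comp C h g) f"
  by (auto elim!: homE simp: cmp_assoc)

text \<open>Products of members of \<open>U\<close> live in another type, while the kernel pair
  needs a carrier in \<open>U\<close>. The product is injected into an infinite member at least as
  large as \<open>X\<close>: \<open>X\<close> itself, or any infinite member when \<open>X\<close>
  is finite.\<close>

lemma Times_code:
  assumes "X \<in> U"
  obtains K a b where "K \<in> U" and "\<And>p. p \<in> K \<Longrightarrow> a p \<in> X" and "\<And>p. p \<in> K \<Longrightarrow> b p \<in> X"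
    and "\<And>x y. x \<in> X \<Longrightarrow> y \<in> X \<Longrightarrow> \<exists>p\<in>K. a p = x \<and> b p = y"
proof -
  obtain I where I: "I \<in> U" "infinite I" using U unfolding set_universe_def by blast
  obtain Z where Z: "Z \<in> U" "infinite Z" "|X| \<le>o |Z|"
  proof (cases "finite X")
    case True
    then have "|X| \<le>o |I|"
      by (intro ordLess_imp_ordLeq finite_ordLess_infinite card_of_Well_order) (simp_all add: I(2) Field_card_of)
    then show ?thesis using that I by blast
  qed (use that assms card_of_mono1 in blast)
  have "|X \<times> X| \<le>o |Z|"
    by (meson Z(2,3) card_of_Sigma_ordLeq_infinite)
  then obtain f where f: "inj_on f (X \<times> X)" "f ` (X \<times> X) \<subseteq> Z"
    by (metis card_of_ordLeq)
  let ?g = "inv_into (X \<times> X) f"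
  show thesis
  proof (rule that[of "f ` (X \<times> X)" "\<lambda>p. fst (?g p)" "\<lambda>p. snd (?g p)"])
    show "f ` (X \<times> X) \<in> U" using f(2) Z(1) subset_U card_of_mono1 by blast
    show "fst (?g p) \<in> X" "snd (?g p) \<in> X" if "p \<in> f ` (X \<times> X)" for p
      using inv_into_into[OF that] by auto
    show "\<exists>p\<in>f ` (X \<times> X). fst (?g p) = x \<and> snd (?g p) = y" if "x \<in> X" "y \<in> X" for x y
      using that f(1) by (intro bexI[of _ "f (x, y)"]) auto
  qed
qed

lemma monic_ar_iff:
  assumes "X \<in> U" "Y \<in> U" and F: "frel A X e Y d F"
  shows "monic C (ar X e Y d F) \<longleftrightarrow> rinj X Y e F"
proof
  assume inj: "rinj X Y e F"
  show "monic C (ar X e Y d F)"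
    unfolding monic_def Dom_ar
  proof (intro conjI ballI impI)
    show "ar X e Y d F \<in> Arr C" using assms ar_in_hom_iff hom_Arr by blast
    fix S f g assume S: "S \<in> Obj C" and f: "f \<in> hom C S (ob X e)" and g: "g \<in> hom C S (ob X e)"
      and *: "Comp C (ar X e Y d F) f = Comp C (ar X e Y d F) g"
    obtain Z r where Z: "S = ob Z r" using S by (rule ObjE)
    obtain G where G: "f = ar Z r X e G" "frel A Z r X e G" using f unfolding Z by (rule homE)
    obtain H where H: "g = ar Z r X e H" "frel A Z r X e H" using g unfolding Z by (rule homE)
    show "f = g"
      using * cancel_rinj[OF G(2) H(2) F inj] by (simp add: G(1) H(1) rel_eq_def)
  qed
next
  assume m: "monic C (ar X e Y d F)"
  obtain K a b where K: "K \<in> U" "\<And>p. p \<in> K \<Longrightarrow> a p \<in> X" "\<And>p. p \<in> K \<Longrightarrow> b p \<in> X"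
    "\<And>x y. x \<in> X \<Longrightarrow> y \<in> X \<Longrightarrow> \<exists>p\<in>K. a p = x \<and> b p = y"
    using Times_code[OF assms(1)] by blast
  define k where "k = (\<lambda>p q. (e (a p) (a q) \<otimes> e (b p) (b q)) \<otimes> ex Y (\<lambda>y. F (a p) y \<otimes> F (b p) y))"
  note ker = rinj_if_kernel[OF F, of K a b k, OF K(2,3) k_def]
  let ?a = "ar K k X e (graph k e a)" and ?b = "ar K k X e (graph k e b)"
  have "?a \<in> hom C (ob K k) (ob X e)" "?b \<in> hom C (ob K k) (ob X e)"
    using K(1) assms(1) ker(1,2) by (simp_all add: ar_in_hom_iff)
  moreover have "ob K k \<in> Obj C"
    using K(1) ker(1) by (simp add: Obj_iff frel_def)
  moreover have "Comp C (ar X e Y d F) ?a = Comp C (ar X e Y d F) ?b"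
    using ker(3) by simp
  ultimately have "?a = ?b" using m unfolding monic_def Dom_ar by blast
  then show "rinj X Y e F" using ker(4) K(4) by simp
qed

text \<open>Formed from the representative chosen by \<open>pred_rep\<close>, so that it depends on
  the arrow alone; any other presentation gives the same predicate up to mutual entailment, by
  \<open>Im_ar\<close>.\<close>

definition Im :: "('u, 'a) per_arr \<Rightarrow> 'u \<Rightarrow> 'a" where
  "Im t = im (fst (fst t)) (\<lambda>y x. pred_rep (snd (snd t)) (y, x))"

definition sub :: "'u set \<Rightarrow> ('u \<Rightarrow> 'u \<Rightarrow> 'a) \<Rightarrow> ('u \<Rightarrow> 'a) \<Rightarrow> ('u, 'a) per_arr" where
  "sub X e Q = ar X (sb e Q) X e (sb e Q)"

text \<open>The relation \<open>M\<close> is the chosen representative, which makes the last clause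
  an equation.\<close>

lemma SubE:
  assumes "t \<in> Sub C (ob X e)"
  obtains Y d M where "t = ar Y d X e M" and "Y \<in> U" and "X \<in> U" and "frel A Y d X e M" and "rinj Y X d M"
    and "Im t = im Y M"
proof -
  have t: "t \<in> Arr C" "Cod C t = ob X e" "monic C t" using assms by (simp_all add: Sub_def monic_def)
  then have "Dom C t \<in> Obj C" by (auto simp: tripos_topos_def)
  then obtain Y d where Y: "Dom C t = ob Y d" "Y \<in> U" by (rule ObjE)
  then have h: "t \<in> hom C (ob Y d) (ob X e)" using t by (simp add: hom_def)
  then obtain M where M: "t = ar Y d X e M" "X \<in> U" by (rule homE)
  let ?M = "\<lambda>y x. pred_rep (snd (snd t)) (y, x)"
  have "mk Y X ?M = mk Y X M"
    unfolding M by (simp add: ar_def mk_rep mk_in_tripos)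
  then have t': "t = ar Y d X e ?M" using M by (simp add: ar_def)
  then have "frel A Y d X e ?M" using h ar_in_hom_iff by metis
  moreover from this have "rinj Y X d ?M"
    using monic_ar_iff[OF Y(2) M(2)] t(3) t' by metis
  moreover have "Im t = im Y ?M"
    unfolding Im_def using arg_cong[OF M(1), of "\<lambda>t. fst (fst t)"] by (simp add: ar_def ob_def)
  ultimately show thesis using that[OF t' Y(2) M(2)] by blast
qed

text \<open>Factorisation through a monomorphism is a condition on images alone. The order on
  subobjects and the mediating arrows of pullbacks are reduced to entailments by this fact.\<close>

lemma Comp_factor_iff:
  assumes "X \<in> U" "Y \<in> U" "Z \<in> U" "frel A Z r X e F" "frel A Y d X e M" "rinj Y X d M"
  shows "(\<exists>k\<in>hom C (ob Z r) (ob Y d). Comp C (ar Y d X e M) k = ar Z r X e F)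
    \<longleftrightarrow> entails A X (im Z F) (im Y M)"
proof
  assume "\<exists>k\<in>hom C (ob Z r) (ob Y d). Comp C (ar Y d X e M) k = ar Z r X e F"
  then obtain K where "frel A Z r Y d K" "rel_eq Z X (cmp Y K M) F"
    by (auto elim!: homE)
  then have "entails2 Z X F (cmp Y K M)" by (simp add: rel_eq_def)
  note t = entails2D[OF this]
  have "entails A X (im Z F) (im Z (cmp Y K M))"
    unfolding entails_def im_def
    by (rule sepI, (rule seqI | erule unwit_le)+, rule wit_le, rule t(2), assumption+,
        intro definables t(1))
  then show "entails A X (im Z F) (im Y M)" using im_cmp entails_trans by blast
next
  assume "entails A X (im Z F) (im Y M)"
  from factor[OF assms(4-6) this]
  show "\<exists>k\<in>hom C (ob Z r) (ob Y d). Comp C (ar Y d X e M) k = ar Z r X e F"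
    using assms(2,3) by (intro bexI[of _ "ar Z r Y d (factor X F M)"]) (simp_all add: ar_in_hom_iff)
qed

lemma sub_le_iff:
  assumes "s \<in> Sub C (ob X e)" "t \<in> Sub C (ob X e)"
  shows "sub_le C s t \<longleftrightarrow> entails A X (Im s) (Im t)"
proof -
  obtain Z r F where s: "s = ar Z r X e F" "Z \<in> U" "X \<in> U" "frel A Z r X e F" "Im s = im Z F"
    using SubE[OF assms(1)] by metis
  obtain Y d M where t: "t = ar Y d X e M" "Y \<in> U" "frel A Y d X e M" "rinj Y X d M" "Im t = im Y M"
    using SubE[OF assms(2)] by metis
  show ?thesis
    unfolding sub_le_def s(5) t(5) using Comp_factor_iff[OF s(3) t(2) s(2,4) t(3,4)] by (simp add: s(1) t(1))
qed

lemma spred_Im: "t \<in> Sub C (ob X e) \<Longrightarrow> spred A X e (Im t)"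
  by (elim SubE) (simp add: spred_im)

lemma sub_in_Sub: "X \<in> U \<Longrightarrow> spred A X e Q \<Longrightarrow> sub X e Q \<in> Sub C (ob X e)"
  using monic_ar_iff[OF _ _ spred.frel_sb] spred.rinj_sb[of A X e Q] by (simp add: Sub_def sub_def)

lemma Im_ar:
  assumes "X \<in> U" "Y \<in> U" "frel A Y d X e M"
  shows "entails A X (Im (ar Y d X e M)) (im Y M)" "entails A X (im Y M) (Im (ar Y d X e M))"
proof -
  have "mk Y X (\<lambda>y x. pred_rep (snd (snd (ar Y d X e M))) (y, x)) = mk Y X M"
    by (simp add: ar_def mk_rep mk_in_tripos)
  then have "rel_eq Y X (\<lambda>y x. pred_rep (snd (snd (ar Y d X e M))) (y, x)) M"
    by (simp add: mk_eq_iff)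
  moreover have "entails A X (im Y F) (im Y G)" if "entails2 Y X F G" for F G
  proof -
    note t = entails2D[OF \<open>entails2 Y X F G\<close>]
    show ?thesis
      unfolding entails_def im_def
      by (rule sepI, (rule seqI | erule unwit_le)+, rule wit_le, rule t(2), assumption+,
          intro definables t(1))
  qed
  ultimately show "entails A X (Im (ar Y d X e M)) (im Y M)" "entails A X (im Y M) (Im (ar Y d X e M))"
    unfolding Im_def rel_eq_def by (simp_all add: ar_def ob_def)
qed

lemma Im_sub:
  assumes "X \<in> U" "spred A X e Q"
  shows "entails A X (Im (sub X e Q)) Q" "entails A X Q (Im (sub X e Q))"
  using Im_ar[OF assms(1,1) spred.frel_sb[OF assms(2)]] spred.im_sb[OF assms(2)] entails_trans
  unfolding sub_def by blast+

lemma sub_le_sub_iff: "\<lbrakk>X \<in> U; spred A X e Q; t \<in> Sub C (ob X e)\<rbrakk>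
    \<Longrightarrow> sub_le C t (sub X e Q) \<longleftrightarrow> entails A X (Im t) Q"
  using sub_le_iff sub_in_Sub Im_sub entails_trans by meson

lemma sub_sub_le_iff: "\<lbrakk>X \<in> U; spred A X e Q; t \<in> Sub C (ob X e)\<rbrakk>
    \<Longrightarrow> sub_le C (sub X e Q) t \<longleftrightarrow> entails A X Q (Im t)"
  using sub_le_iff sub_in_Sub Im_sub entails_trans by meson

text \<open>The mediating arrow \<open>u\<close> comes from a comparison of images. Its equation
  with \<open>k\<close> is obtained by cancelling the monomorphism \<open>m\<close>, and its
  uniqueness by cancelling the inclusion.\<close>

lemma is_pullback_sub:
  assumes "X \<in> U" "Y \<in> U" "frel A X e Y d F" "m \<in> Sub C (ob Y d)"
  shows "is_pullback C (ar X e Y d F) m (sub X e (pb Y F (Im m)))"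
proof -
  let ?Q = "pb Y F (Im m)"
  obtain Z r M where m: "m = ar Z r Y d M" "Z \<in> U" "frel A Z r Y d M" "rinj Z Y r M" "Im m = im Z M"
    using SubE[OF assms(4)] by metis
  have Q: "spred A X e ?Q" using assms(3) by (rule spred_pb)
  note fQ = spred.frel_sb[OF Q]
  have SS: "sub X e ?Q \<in> Sub C (ob X e)" using assms(1) Q by (rule sub_in_Sub)
  have "entails A Y (im X (cmp X (sb e ?Q) F)) (im Z M)"
    using pb_counit[OF assms(3) spred_Im[OF assms(4)]] m(5) by simp
  then obtain g where g: "g \<in> hom C (ob X (sb e ?Q)) (ob Z r)" "Comp C m g = Comp C (ar X e Y d F) (sub X e ?Q)"
    using Comp_factor_iff[OF assms(2) m(2) assms(1) frel_cmp[OF fQ assms(3)] m(3,4)]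
    by (auto simp: m(1) sub_def)
  have univ: "\<exists>!u. u \<in> hom C S (ob X (sb e ?Q)) \<and> Comp C (sub X e ?Q) u = h \<and> Comp C g u = k"
    if S: "S \<in> Obj C" and h: "h \<in> hom C S (ob X e)" and k: "k \<in> hom C S (ob Z r)" and *: "Comp C m k = Comp C (ar X e Y d F) h"
    for S h k
  proof -
    obtain T t where T: "S = ob T t" "T \<in> U" using S by (rule ObjE)
    obtain H where H: "h = ar T t X e H" "frel A T t X e H" using h unfolding T by (rule homE)
    obtain K where K: "k = ar T t Z r K" "frel A T t Z r K" using k unfolding T by (rule homE)
    have "entails2 T Y (cmp X H F) (cmp Z K M)"
      using * by (simp add: m(1) H(1) K(1) rel_eq_def)
    then have "entails A X (im T H) ?Q"
      using pb_universal[OF H(2) assms(3)] entails_refl m(5) by metis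
    then have "entails A X (im T H) (im X (sb e ?Q))"
      using spred.im_sb[OF Q] entails_trans by blast
    then obtain u where u: "u \<in> hom C S (ob X (sb e ?Q))" "Comp C (sub X e ?Q) u = h"
      using Comp_factor_iff[OF assms(1,1) T(2) H(2) fQ spred.rinj_sb[OF Q]] unfolding T H(1) sub_def by blast
    have sub: "sub X e ?Q \<in> hom C (ob X (sb e ?Q)) (ob X e)"
      unfolding sub_def using fQ assms(1) by (simp add: ar_in_hom_iff)
    have F: "ar X e Y d F \<in> hom C (ob X e) (ob Y d)" and M: "m \<in> hom C (ob Z r) (ob Y d)"
      using assms m by (simp_all add: ar_in_hom_iff)
    have "Comp C m (Comp C g u) = Comp C (Comp C m g) u"
      using Comp_assoc u(1) g(1) M unfolding T by blast
    also have "\<dots> = Comp C (ar X e Y d F) (Comp C (sub X e ?Q) u)"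
      using Comp_assoc u(1) sub F unfolding T g(2) by simp
    also have "\<dots> = Comp C m k" using u * by simp
    finally have "Comp C m (Comp C g u) = Comp C m k" .
    moreover have "Comp C g u \<in> hom C S (ob Z r)" using Comp_hom u(1) g(1) unfolding T by blast
    moreover have "monic C m" using assms(4) by (simp add: Sub_def)
    ultimately have "Comp C g u = k"
      using S k unfolding monic_def m(1) Dom_ar by blast
    moreover have "monic C (sub X e ?Q)" using SS by (simp add: Sub_def)
    then have "u' = u" if "u' \<in> hom C S (ob X (sb e ?Q))" "Comp C (sub X e ?Q) u' = h" for u'
      using that u S unfolding monic_def sub_def Dom_ar by blast
    ultimately show ?thesis using u by blast
  qed
  have D: "Dom C (sub X e ?Q) = ob X (sb e ?Q)" "Dom C m = ob Z r"
    by (simp_all add: sub_def m(1))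
  show ?thesis
    unfolding is_pullback_def D Dom_ar by (intro conjI bexI[OF _ g(1)] ballI impI SS g(2) univ)
qed

text \<open>The definitions of the quantifiers speak of some pullback, not of the canonical one. The
  square of \<open>p\<close> bounds its image by the inverse image, and the universal property of
  \<open>p\<close>, applied to the canonical pullback, gives the converse.\<close>

lemma Im_pullback:
  assumes "X \<in> U" "Y \<in> U" "frel A X e Y d F" "m \<in> Sub C (ob Y d)" "is_pullback C (ar X e Y d F) m p"
  shows "p \<in> Sub C (ob X e)" "entails A X (Im p) (pb Y F (Im m))" "entails A X (pb Y F (Im m)) (Im p)"
proof -
  let ?Q = "pb Y F (Im m)"
  show p: "p \<in> Sub C (ob X e)" using assms(5) by (simp add: is_pullback_def)
  obtain Z r M where m: "m = ar Z r Y d M" "Z \<in> U" "frel A Z r Y d M" "rinj Z Y r M" "Im m = im Z M"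
    using SubE[OF assms(4)] by metis
  obtain W s P where P: "p = ar W s X e P" "W \<in> U" "frel A W s X e P" "Im p = im W P"
    using SubE[OF p] by metis
  have Q: "spred A X e ?Q" using assms(3) by (rule spred_pb)
  have "is_pullback C (ar X e Y d F) m (sub X e ?Q)"
    using assms(1-4) by (rule is_pullback_sub)
  then obtain k where k: "k \<in> hom C (ob X (sb e ?Q)) (ob Z r)" "Comp C m k = Comp C (ar X e Y d F) (sub X e ?Q)"
    unfolding is_pullback_def by (auto simp: sub_def m(1))
  obtain g where g: "g \<in> hom C (ob W s) (ob Z r)" "Comp C m g = Comp C (ar X e Y d F) p"
    and univ: "\<And>S h k. \<lbrakk>S \<in> Obj C; h \<in> hom C S (ob X e); k \<in> hom C S (ob Z r); Comp C m k = Comp C (ar X e Y d F) h\<rbrakk>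
        \<Longrightarrow> \<exists>u\<in>hom C S (ob W s). Comp C p u = h"
    using assms(5) unfolding is_pullback_def by (simp add: m(1) P(1)) (metis (no_types, lifting))
  obtain G where G: "g = ar W s Z r G" "frel A W s Z r G" using g(1) by (rule homE)
  have "entails2 W Y (cmp X P F) (cmp Z G M)"
    using g(2) by (simp add: m(1) P(1) G(1) rel_eq_def)
  then show "entails A X (Im p) ?Q"
    using pb_universal[OF P(3) assms(3)] entails_refl m(5) P(4) by metis
  have "\<exists>u\<in>hom C (ob X (sb e ?Q)) (ob W s). Comp C p u = sub X e ?Q"
    using univ[OF _ _ k] assms(1) spred.frel_sb[OF Q] spred.per_sb[OF Q] by (simp add: sub_def ar_in_hom_iff Obj_iff)
  then have "sub_le C (sub X e ?Q) p"
    unfolding sub_le_def by (simp add: sub_def P(1))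
  then show "entails A X ?Q (Im p)"
    using sub_sub_le_iff[OF assms(1) Q p] by simp
qed

end

section \<open>Connectives and quantifiers\<close>

context impl begin

definition pred_eq where
  "pred_eq I f g \<longleftrightarrow> entails A I f g \<and> entails A I g f"

lemma entails_pred_eq:
  "pred_eq I f f' \<Longrightarrow> pred_eq I g g' \<Longrightarrow> entails A I f g \<longleftrightarrow> entails A I f' g'"
  unfolding pred_eq_def using entails_trans by blast

lemma pred_eq_refl: "pred_eq I f f"
  by (simp add: pred_eq_def entails_refl)

lemma pred_eq_sym: "pred_eq I f g \<Longrightarrow> pred_eq I g f"
  by (simp add: pred_eq_def)

lemma pred_eq_trans: "pred_eq I f g \<Longrightarrow> pred_eq I g h \<Longrightarrow> pred_eq I f h"
  unfolding pred_eq_def using entails_trans by blast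

lemma entails_disj_iff:
  "entails A I (\<lambda>i. f i \<oplus> g i) h \<longleftrightarrow> entails A I f h \<and> entails A I g h"
proof (intro iffI conjI)
  have "entails A I f (\<lambda>i. f i \<oplus> g i)" "entails A I g (\<lambda>i. f i \<oplus> g i)"
    unfolding entails_def
    by (rule sepI, (rule seqI)+, rule inl_le inr_le, assumption, intro definables)+
  then show "entails A I f h" "entails A I g h" if "entails A I (\<lambda>i. f i \<oplus> g i) h"
    using that entails_trans by blast+
  assume "entails A I f h \<and> entails A I g h"
  then obtain s t where s: "s \<in> \<Sigma>" "\<And>i u. u \<le> f i \<Longrightarrow> i \<in> I \<Longrightarrow> s \<cdot> u \<le> h i"
    and t: "t \<in> \<Sigma>" "\<And>i u. u \<le> g i \<Longrightarrow> i \<in> I \<Longrightarrow> t \<cdot> u \<le> h i"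
    using entailsE by metis
  show "entails A I (\<lambda>i. f i \<oplus> g i) h" unfolding entails_def
    by (rule sepI, (rule seqI)+, erule cases_le, rule s(2), assumption+, rule t(2), assumption+,
        intro definables s(1) t(1))
qed

lemma entails_bot: "entails A I (\<lambda>i. bot) f"
  unfolding entails_def
  by (rule sepI, (rule seqI)+, erule order_trans[OF _ bot_least], intro definables)

text \<open>Every element realizes \<open>top\<close>; \<open>cK\<close> is passed as a dummy
  argument to recover a realizer of all the values \<open>f i\<close>.\<close>

lemma sep_iff_entails: "(INF i\<in>I. f i) \<in> \<Sigma> \<longleftrightarrow> entails A I (\<lambda>i. top) f"
proof
  assume f: "(INF i\<in>I. f i) \<in> \<Sigma>"
  show "entails A I (\<lambda>i. top) f"
    unfolding entails_def
    by (rule sepI, (rule seqI)+, erule INF_lower, intro definables f)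
next
  assume "entails A I (\<lambda>i. top) f"
  note t = entailsD[OF this]
  show "(INF i\<in>I. f i) \<in> \<Sigma>"
    by (rule sepI, rule INF_greatest, rule t(2), rule top_greatest[of cK], assumption,
        intro definables t(1) cK_sep)
qed

lemma entails_if_sep: "(INF i\<in>I. f i) \<in> \<Sigma> \<Longrightarrow> entails A I g f"
proof -
  have "entails A I g (\<lambda>i. top)"
    unfolding entails_def
    by (rule sepI, (rule seqI)+, rule top_greatest[of cK], intro definables cK_sep)
  then show "(INF i\<in>I. f i) \<in> \<Sigma> \<Longrightarrow> entails A I g f"
    unfolding sep_iff_entails using entails_trans by blast
qed

end

context topos begin

lemma Im_sub_eq: "X \<in> U \<Longrightarrow> spred A X e Q \<Longrightarrow> pred_eq X (Im (sub X e Q)) Q"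
  using Im_sub by (simp add: pred_eq_def)

lemma is_bot_sub:
  assumes "X \<in> U" "spred A X e (\<lambda>x. bot)"
  shows "is_bot C (ob X e) (sub X e (\<lambda>x. bot))"
  unfolding is_bot_def using assms by (simp add: sub_in_Sub sub_sub_le_iff entails_bot)

lemma is_meet_sub:
  assumes "X \<in> U" "a \<in> Sub C (ob X e)" "b \<in> Sub C (ob X e)"
    and "pred_eq X (Im a) f" "pred_eq X (Im b) g" "spred A X e (\<lambda>x. f x \<otimes> g x)"
  shows "is_meet C (ob X e) a b (sub X e (\<lambda>x. f x \<otimes> g x))"
  unfolding is_meet_def using assms
  by (simp add: sub_in_Sub sub_le_sub_iff sub_le_iff[OF _ assms(2)] sub_le_iff[OF _ assms(3)] entails_conj_iff
      entails_pred_eq[OF pred_eq_refl assms(4)] entails_pred_eq[OF pred_eq_refl assms(5)])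

lemma is_join_sub:
  assumes "X \<in> U" "a \<in> Sub C (ob X e)" "b \<in> Sub C (ob X e)"
    and "pred_eq X (Im a) f" "pred_eq X (Im b) g" "spred A X e (\<lambda>x. f x \<oplus> g x)"
  shows "is_join C (ob X e) a b (sub X e (\<lambda>x. f x \<oplus> g x))"
  unfolding is_join_def using assms
  by (simp add: sub_in_Sub sub_sub_le_iff sub_le_iff[OF assms(2)] sub_le_iff[OF assms(3)] entails_disj_iff
      entails_pred_eq[OF assms(4) pred_eq_refl] entails_pred_eq[OF assms(5) pred_eq_refl])

lemma spred_conj: "spred A X e f \<Longrightarrow> spred A X e g \<Longrightarrow> spred A X e (\<lambda>x. f x \<otimes> g x)"
proof -
  assume "spred A X e f" "spred A X e g"
  then interpret f: spred A X e f + g: spred A X e g .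
  show ?thesis
    apply unfold_locales
     apply (rule sepI, (rule seqI | erule le_cnjE)+, rule f.pstrict, assumption+,
        intro definables f.pseps)
    apply (rule sepI, (rule seqI | erule le_cnjE)+, rule pr_le, rule f.pext, assumption+,
        rule g.pext, assumption+, intro definables f.pseps g.pseps)
    done
qed

lemma is_implication_sub:
  assumes X: "X \<in> U" and a: "a \<in> Sub C (ob X e)" and b: "b \<in> Sub C (ob X e)"
    and f: "pred_eq X (Im a) f" and g: "pred_eq X (Im b) g" and s: "spred A X e (\<lambda>x. f x \<leadsto> g x)"
  shows "is_implication C (ob X e) a b (sub X e (\<lambda>x. f x \<leadsto> g x))"
  unfolding is_implication_def
proof (intro conjI ballI)
  show "sub X e (\<lambda>x. f x \<leadsto> g x) \<in> Sub C (ob X e)" using X s by (rule sub_in_Sub)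
  fix t assume t: "t \<in> Sub C (ob X e)"
  let ?m = "sub X e (\<lambda>x. Im t x \<otimes> Im a x)"
  have m: "spred A X e (\<lambda>x. Im t x \<otimes> Im a x)"
    by (intro spred_conj spred_Im t a)
  then have meet: "is_meet C (ob X e) t a ?m"
    by (intro is_meet_sub X t a pred_eq_refl)
  have "sub_le C t (sub X e (\<lambda>x. f x \<leadsto> g x)) \<longleftrightarrow> entails A X (\<lambda>x. Im t x \<otimes> f x) g"
    using X s t by (simp add: sub_le_sub_iff entails_curry)
  also have "\<dots> \<longleftrightarrow> entails A X (\<lambda>x. Im t x \<otimes> Im a x) (Im b)"
    using f by (intro entails_pred_eq pred_eq_sym[OF g]) (simp add: pred_eq_def entails_conj_mono entails_refl)
  also have "\<dots> \<longleftrightarrow> sub_le C ?m b" using X m b by (simp add: sub_sub_le_iff)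
  \<comment> \<open>Meets are determined only up to equivalence, so an arbitrary one is compared
    with the canonical \<open>?m\<close>.\<close>
  also have "\<dots> \<longleftrightarrow> (\<exists>m. is_meet C (ob X e) t a m \<and> sub_le C m b)"
  proof
    assume "\<exists>m. is_meet C (ob X e) t a m \<and> sub_le C m b"
    then obtain m' where m': "is_meet C (ob X e) t a m'" "sub_le C m' b" by blast
    then have "m' \<in> Sub C (ob X e)" by (simp add: is_meet_def)
    moreover from this m' meet have "sub_le C ?m m'"
      using sub_le_iff entails_refl unfolding is_meet_def by blast
    ultimately show "sub_le C ?m b"
      using m'(2) sub_le_iff sub_in_Sub[OF X m] b entails_trans by blast
  qed (use meet in blast)
  finally show "sub_le C t (sub X e (\<lambda>x. f x \<leadsto> g x)) \<longleftrightarrow> (\<exists>m. is_meet C (ob X e) t a m \<and> sub_le C m b)" .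
qed

text \<open>A subobject \<open>t\<close> of the codomain enters only through \<open>Im t\<close>, so
  the adjunction is tested on strict extensional predicates.\<close>

lemma is_forall_sub:
  assumes X: "X \<in> U" "Y \<in> U" and F: "frel A X e Y d F" and a: "a \<in> Sub C (ob X e)" and s: "spred A Y d g"
    and adj: "\<And>R. spred A Y d R \<Longrightarrow> entails A Y R g \<longleftrightarrow> entails A X (pb Y F R) (Im a)"
  shows "is_forall C (ar X e Y d F) a (sub Y d g)"
  unfolding is_forall_def Cod_ar
proof (intro conjI ballI)
  show "sub Y d g \<in> Sub C (ob Y d)" using X(2) s by (rule sub_in_Sub)
  fix t assume t: "t \<in> Sub C (ob Y d)"
  have "sub_le C t (sub Y d g) \<longleftrightarrow> entails A X (pb Y F (Im t)) (Im a)"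
    using X s t by (simp add: sub_le_sub_iff adj spred_Im)
  also have "\<dots> \<longleftrightarrow> (\<exists>p. is_pullback C (ar X e Y d F) t p \<and> sub_le C p a)"
    using is_pullback_sub[OF X F t] Im_pullback[OF X F t] entails_trans sub_le_iff[OF _ a]
      sub_sub_le_iff[OF X(1) spred_pb[OF F] a] by meson
  finally show "sub_le C t (sub Y d g) \<longleftrightarrow> (\<exists>p. is_pullback C (ar X e Y d F) t p \<and> sub_le C p a)" .
qed

lemma is_exists_sub:
  assumes X: "X \<in> U" "Y \<in> U" and F: "frel A X e Y d F" and a: "a \<in> Sub C (ob X e)" and s: "spred A Y d g"
    and adj: "\<And>R. spred A Y d R \<Longrightarrow> entails A Y g R \<longleftrightarrow> entails A X (Im a) (pb Y F R)"
  shows "is_exists C (ar X e Y d F) a (sub Y d g)"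
  unfolding is_exists_def Cod_ar
proof (intro conjI ballI)
  show "sub Y d g \<in> Sub C (ob Y d)" using X(2) s by (rule sub_in_Sub)
  fix t assume t: "t \<in> Sub C (ob Y d)"
  have "sub_le C (sub Y d g) t \<longleftrightarrow> entails A X (Im a) (pb Y F (Im t))"
    using X s t by (simp add: sub_sub_le_iff adj spred_Im)
  also have "\<dots> \<longleftrightarrow> (\<exists>p. is_pullback C (ar X e Y d F) t p \<and> sub_le C a p)"
    using is_pullback_sub[OF X F t] Im_pullback[OF X F t] entails_trans sub_le_iff[OF a]
      sub_le_sub_iff[OF X(1) spred_pb[OF F] a] by meson
  finally show "sub_le C (sub Y d g) t \<longleftrightarrow> (\<exists>p. is_pullback C (ar X e Y d F) t p \<and> sub_le C a p)" .
qed

text \<open>Inverse image along the graph of \<open>c\<close> is substitution of \<open>c\<close>;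
  the uniform realizers of reflexivity supply the existence parts of the graph.\<close>

lemma pb_graph:
  assumes "spred A Y d R" "\<And>x. x \<in> X \<Longrightarrow> c x \<in> Y" "(INF x\<in>X. e x x) \<in> \<Sigma>" "(INF y\<in>Y. d y y) \<in> \<Sigma>"
  shows "pred_eq X (pb Y (graph e d c) R) (\<lambda>x. R (c x))"
proof -
  interpret R: spred A Y d R by fact
  let ?s = "INF x\<in>X. e x x" and ?t = "INF y\<in>Y. d y y"
  have s: "x \<in> X \<Longrightarrow> ?s \<le> e x x" and t: "y \<in> Y \<Longrightarrow> ?t \<le> d y y" for x y
    by (rule INF_lower; assumption)+
  show ?thesis
    unfolding pred_eq_def entails_def pb_def graph_def
    apply (rule conjI)
     apply (rule sepI, (rule seqI | erule unwit_le le_cnjE)+, rule R.pext[OF R.sym],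
        (assumption | rule assms(2))+, intro definables R.seps R.pseps)
    apply (rule sepI, (rule seqI | erule unwit_le le_cnjE)+, rule wit_le, (rule pr_le)+, erule s,
        rule t, (assumption | rule assms(2))+, intro definables assms(3,4))
    done
qed

end

section \<open>Powers of a total object\<close>

context impl begin

primrec cj :: "nat \<Rightarrow> (nat \<Rightarrow> 'a) \<Rightarrow> 'a" where
  "cj 0 f = top"
| "cj (Suc n) f = cj n f \<otimes> f n"

lemma cj_cong: "(\<And>k. k < n \<Longrightarrow> f k = g k) \<Longrightarrow> cj n f = cj n g"
  by (induction n) auto

lemma entails_cjI: "(\<And>k. k < n \<Longrightarrow> entails A I g (\<lambda>i. f i k)) \<Longrightarrow> entails A I g (\<lambda>i. cj n (f i))"
proof (induction n)
  case 0
  show ?case unfolding cj.simps entails_def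
    by (rule sepI, (rule seqI)+, rule top_greatest[of cK], intro definables cK_sep)
next
  case (Suc n)
  then show ?case by (simp add: entails_conj_iff)
qed

lemma entails_cjD: "k < n \<Longrightarrow> entails A I (\<lambda>i. cj n (f i)) (\<lambda>i. f i k)"
proof (induction n)
  case (Suc n)
  show ?case
  proof (cases "k = n")
    case True
    then show ?thesis by (simp add: entails_conj2)
  next
    case False
    then have "entails A I (\<lambda>i. cj n (f i)) (\<lambda>i. f i k)" using Suc by simp
    then show ?thesis unfolding cj.simps by (rule entails_trans[OF entails_conj1])
  qed
qed simp

lemma entails_image: "entails A (h ` J) f g \<longleftrightarrow> entails A J (\<lambda>j. f (h j)) (\<lambda>j. g (h j))"
  unfolding entails_def by (simp add: image_image)

lemma entails_all_iff:
  "entails A I f (\<lambda>i. INF w\<in>W. g i w) \<longleftrightarrow> entails A (I \<times> W) (\<lambda>p. f (fst p)) (\<lambda>p. g (fst p) (snd p))"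
  unfolding entails_def INF_Times by (simp add: arr_Inf image_image)

lemma entails_ex_iff:
  "entails A I (\<lambda>i. ex W (g i)) f \<longleftrightarrow> entails A (I \<times> W) (\<lambda>p. g (fst p) (snd p)) (\<lambda>p. f (fst p))"
proof
  assume "entails A I (\<lambda>i. ex W (g i)) f"
  note t = entailsD[OF this]
  show "entails A (I \<times> W) (\<lambda>p. g (fst p) (snd p)) (\<lambda>p. f (fst p))"
    unfolding entails_def INF_Times fst_conv snd_conv
    by (rule sepI, (rule seqI)+, rule t(2), rule wit_le, assumption+, intro definables t(1))
next
  assume "entails A (I \<times> W) (\<lambda>p. g (fst p) (snd p)) (\<lambda>p. f (fst p))"
  then have "entails2 I W g (\<lambda>i w. f i)" by (simp add: entails_Times)
  note t = entails2D[OF this]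
  show "entails A I (\<lambda>i. ex W (g i)) f"
    unfolding entails_def
    by (rule sepI, (rule seqI | erule unwit_le)+, rule t(2), assumption+, intro definables t(1))
qed

section \<open>Tuples and finite choice\<close>

definition tup :: "'u set \<Rightarrow> nat \<Rightarrow> 'u list set" where
  "tup W n = {l. length l = n \<and> set l \<subseteq> W}"

lemma tup_0: "tup W 0 = {[]}"
  by (auto simp: tup_def)

lemma tup_Suc: "tup W (Suc n) = (\<lambda>p. snd p # fst p) ` (tup W n \<times> W)"
  by (auto simp: tup_def length_Suc_conv image_iff)

lemma tup_nth: "l \<in> tup W n \<Longrightarrow> k < n \<Longrightarrow> l ! k \<in> W"
  by (auto simp: tup_def)

text \<open>Induction on \<open>n\<close> collects the witnesses of finitely many existential
  statements into one tuple, with a realizer independent of \<open>i\<close>.\<close>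

lemma cj_choice:
  "entails A I (\<lambda>i. cj n (\<lambda>k. ex W (f i k))) (\<lambda>i. ex (tup W n) (\<lambda>l. cj n (\<lambda>k. f i k (l ! k))))"
proof (induction n)
  case 0
  show ?case
    unfolding entails_def tup_0
    by (rule sepI, (rule seqI)+, rule wit_le[of _ _ "[]"], unfold cj.simps, assumption, rule singletonI,
        intro definables)
next
  case (Suc n)
  note t = entailsD[OF this]
  \<comment> \<open>The new witness goes to the end of the list, so the positions of the earlier
    ones do not change.\<close>
  have snoc: "wit (pr u v) \<le> ex (tup W (Suc n)) (\<lambda>l. cj (Suc n) (\<lambda>k. f i k (l ! k)))"
    if "u \<le> cj n (\<lambda>k. f i k (l ! k))" "l \<in> tup W n" "v \<le> f i n w" "w \<in> W" for u v i l w
  proof (rule wit_le)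
    have "cj n (\<lambda>k. f i k (l ! k)) = cj n (\<lambda>k. f i k ((l @ [w]) ! k))"
      using that by (intro cj_cong) (simp add: tup_def nth_append)
    moreover have "(l @ [w]) ! n = w" using that by (simp add: tup_def nth_append)
    ultimately show "pr u v \<le> cj (Suc n) (\<lambda>k. f i k ((l @ [w]) ! k))"
      using that by (simp add: pr_le)
    show "l @ [w] \<in> tup W (Suc n)" using that by (simp add: tup_def)
  qed
  show ?case
    unfolding entails_def cj.simps(2)[of n "\<lambda>k. ex W (f _ k)"]
    by (rule sepI, (rule seqI | erule le_cnjE)+, rule unwit_le, rule t(2), assumption+,
        erule unwit_le, rule snoc, assumption+, intro definables t(1))
qed

lemma rel_eq_cong:
  "(\<And>x z. x \<in> X \<Longrightarrow> z \<in> Z \<Longrightarrow> F x z = G x z) \<Longrightarrow> rel_eq X Z H F \<Longrightarrow> rel_eq X Z H G"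
  unfolding rel_eq_def entails2_def by (simp cong: INF_cong)

end

locale total_object = topos A U + W: per A W E
  for A :: "'a::complete_lattice impl_alg" and U :: "'u set set" and W :: "'u set" and E +
  assumes W_in_U: "W \<in> U" and W_infinite: "infinite W"
    and refl_sep: "(INF x\<in>W. E x x) \<in> \<Sigma>"
begin

text \<open>The set \<open>W\<close> is infinite, so \<open>W \<times> W\<close> injects into it.
  Iteration codes tuples of every length inside \<open>W\<close>, and each power thereby has its
  carrier in \<open>U\<close>. Codes of tuples of different lengths may coincide, which is why
  decoding takes the length as an argument.\<close>

definition pair_code :: "'u \<times> 'u \<Rightarrow> 'u" where
  "pair_code = (SOME f. inj_on f (W \<times> W) \<and> f ` (W \<times> W) \<subseteq> W)"

lemma pair_code: "inj_on pair_code (W \<times> W)" "pair_code ` (W \<times> W) \<subseteq> W"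
proof -
  have "|W \<times> W| \<le>o |W|"
    using card_of_Times_same_infinite[OF W_infinite] ordIso_iff_ordLeq by blast
  then have "\<exists>f. inj_on f (W \<times> W) \<and> f ` (W \<times> W) \<subseteq> W" by (simp flip: card_of_ordLeq)
  from someI_ex[OF this] show "inj_on pair_code (W \<times> W)" "pair_code ` (W \<times> W) \<subseteq> W"
    unfolding pair_code_def by blast+
qed

primrec enc :: "'u list \<Rightarrow> 'u" where
  "enc [] = (SOME w. w \<in> W)"
| "enc (x # l) = pair_code (x, enc l)"

lemma enc_in: "set l \<subseteq> W \<Longrightarrow> enc l \<in> W"
proof (induction l)
  case Nil
  have "W \<noteq> {}" using W_infinite by auto
  then show ?case by (simp add: some_in_eq)
next
  case (Cons x l)
  then show ?case using pair_code(2) by auto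
qed

lemma enc_inj: "inj_on enc (tup W n)"
proof (induction n)
  case (Suc n)
  show ?case
  proof (rule inj_onI)
    fix l l' assume *: "l \<in> tup W (Suc n)" "l' \<in> tup W (Suc n)" "enc l = enc l'"
    then obtain x k x' k' where l: "l = x # k" "l' = x' # k'" "x \<in> W" "x' \<in> W" "k \<in> tup W n" "k' \<in> tup W n"
      unfolding tup_Suc by auto
    then have "(x, enc k) = (x', enc k')"
      using * pair_code(1) enc_in by (intro inj_onD[OF pair_code(1)]) (auto simp: tup_def)
    then show "l = l'" using l Suc by (auto dest: inj_onD)
  qed
qed (simp add: tup_0)

definition carrier :: "nat \<Rightarrow> 'u set" where "carrier n = enc ` tup W n"
definition dec :: "nat \<Rightarrow> 'u \<Rightarrow> 'u list" where "dec n = inv_into (tup W n) enc"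
definition el :: "nat \<Rightarrow> 'u list \<Rightarrow> 'u list \<Rightarrow> 'a" where "el n l l' = cj n (\<lambda>i. E (l ! i) (l' ! i))"
definition en :: "nat \<Rightarrow> 'u \<Rightarrow> 'u \<Rightarrow> 'a" where "en n x y = el n (dec n x) (dec n y)"

lemma dec_enc: "l \<in> tup W n \<Longrightarrow> dec n (enc l) = l"
  unfolding dec_def by (rule inv_into_f_f[OF enc_inj])

lemma dec_in: "x \<in> carrier n \<Longrightarrow> dec n x \<in> tup W n"
  unfolding carrier_def dec_def by (rule inv_into_into)

lemma enc_carrier: "l \<in> tup W n \<Longrightarrow> enc l \<in> carrier n"
  by (simp add: carrier_def)

lemma carrier_in_U: "carrier n \<in> U"
  by (rule subset_U[OF W_in_U], rule card_of_mono1) (auto simp: carrier_def tup_def enc_in)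

text \<open>As \<open>dec n\<close> inverts \<open>enc\<close> on tuples, meets over codes become
  meets over lists, and the coding drops out of later computations.\<close>

lemma INF_carrier: "(INF x\<in>carrier n. f (dec n x)) = (INF l\<in>tup W n. (f l :: 'a))"
  unfolding carrier_def image_image by (rule INF_cong) (simp_all add: dec_enc)

lemma ex_carrier: "ex (carrier n) (\<lambda>x. f (dec n x)) = ex (tup W n) f"
  unfolding alg_ex_def INF_carrier[of "\<lambda>l. f l \<leadsto> _"] ..

lemma entails_carrier: "entails A (carrier n) (\<lambda>x. f (dec n x)) (\<lambda>x. g (dec n x)) \<longleftrightarrow> entails A (tup W n) f g"
  unfolding entails_def INF_carrier[of "\<lambda>l. f l \<leadsto> g l"] ..

lemma el_nth:
  assumes "k < n"
  obtains t where "t \<in> \<Sigma>" and "\<And>l l' u. u \<le> el n l l' \<Longrightarrow> t \<cdot> u \<le> E (l ! k) (l' ! k)"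
proof -
  have "entails A UNIV (\<lambda>p. el n (fst p) (snd p)) (\<lambda>p. E (fst p ! k) (snd p ! k))"
    unfolding el_def using assms by (rule entails_cjD)
  then obtain t where "t \<in> \<Sigma>" "\<And>p u. u \<le> el n (fst p) (snd p) \<Longrightarrow> p \<in> UNIV \<Longrightarrow> t \<cdot> u \<le> E (fst p ! k) (snd p ! k)"
    using entailsE by blast
  from this(1) this(2)[of _ "(_, _)"] show thesis by (intro that) simp_all
qed

lemma per_el: "per A (tup W n) (el n)"
proof
  have "entails A (tup W n \<times> tup W n) (\<lambda>p. el n (fst p) (snd p)) (\<lambda>p. el n (snd p) (fst p))"
    unfolding el_def[of _ "snd _"]
  proof (rule entails_cjI)
    fix k assume k: "k < n"
    obtain t where t: "t \<in> \<Sigma>" "\<And>l l' u. u \<le> el n l l' \<Longrightarrow> t \<cdot> u \<le> E (l ! k) (l' ! k)"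
      using el_nth[OF k] by blast
    show "entails A (tup W n \<times> tup W n) (\<lambda>p. el n (fst p) (snd p)) (\<lambda>p. E (snd p ! k) (fst p ! k))"
      unfolding entails_def INF_Times fst_conv snd_conv
      by (rule sepI, (rule seqI)+, rule W.sym, rule t(2), assumption, (erule tup_nth[OF _ k])+,
          intro definables t(1) W.seps)
  qed
  then show "(INF x\<in>tup W n. INF y\<in>tup W n. el n x y \<leadsto> el n y x) \<in> \<Sigma>"
    by (simp add: entails_def INF_Times)
  have "entails A (tup W n \<times> tup W n \<times> tup W n) (\<lambda>p. el n (fst p) (fst (snd p)) \<otimes> el n (fst (snd p)) (snd (snd p)))
      (\<lambda>p. cj n (\<lambda>k. E (fst p ! k) (snd (snd p) ! k)))"
  proof (rule entails_cjI)
    fix k assume k: "k < n"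
    obtain t where t: "t \<in> \<Sigma>" "\<And>l l' u. u \<le> el n l l' \<Longrightarrow> t \<cdot> u \<le> E (l ! k) (l' ! k)"
      using el_nth[OF k] by blast
    show "entails A (tup W n \<times> tup W n \<times> tup W n) (\<lambda>p. el n (fst p) (fst (snd p)) \<otimes> el n (fst (snd p)) (snd (snd p)))
      (\<lambda>p. E (fst p ! k) (snd (snd p) ! k))"
      unfolding entails_def INF_Times fst_conv snd_conv
      by (rule sepI, (rule seqI | erule le_cnjE)+, rule W.trans, rule t(2), assumption, rule t(2), assumption,
          (erule tup_nth[OF _ k])+, intro definables t(1) W.seps)
  qed
  then show "(INF x\<in>tup W n. INF y\<in>tup W n. INF z\<in>tup W n. el n x y \<leadsto> el n y z \<leadsto> el n x z) \<in> \<Sigma>"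
    unfolding entails_curry el_def[symmetric] by (simp add: entails_def INF_Times)
qed

lemma per_en: "per A (carrier n) (en n)"
proof
  interpret L: per A "tup W n" "el n" by (rule per_el)
  show "(INF x\<in>carrier n. INF y\<in>carrier n. en n x y \<leadsto> en n y x) \<in> \<Sigma>"
    using L.sym_sep unfolding en_def
    by (subst INF_carrier, subst INF_carrier)
  show "(INF x\<in>carrier n. INF y\<in>carrier n. INF z\<in>carrier n. en n x y \<leadsto> en n y z \<leadsto> en n x z) \<in> \<Sigma>"
    using L.trans_sep unfolding en_def
    by (subst INF_carrier, subst INF_carrier, subst INF_carrier)
qed

lemma el_refl_sep: "(INF l\<in>tup W n. el n l l) \<in> \<Sigma>"
  unfolding sep_iff_entails el_def
proof (rule entails_cjI)
  fix k assume k: "k < n"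
  have "entails A W (\<lambda>_. top) (\<lambda>x. E x x)" using refl_sep by (simp add: sep_iff_entails)
  then show "entails A (tup W n) (\<lambda>_. top) (\<lambda>l. E (l ! k) (l ! k))"
    by (rule entails_reindex) (rule tup_nth[OF _ k])
qed

lemma en_refl_sep: "(INF x\<in>carrier n. en n x x) \<in> \<Sigma>"
  using el_refl_sep unfolding en_def by (subst INF_carrier)

section \<open>The universal property of the powers\<close>

abbreviation "proj_rel n i \<equiv> graph (en n) E (\<lambda>x. dec n x ! i)"

definition proj :: "nat \<Rightarrow> nat \<Rightarrow> ('u, 'a) per_arr" where
  "proj n i = ar (carrier n) (en n) W E (proj_rel n i)"

lemma en_nth: "k < n \<Longrightarrow> entails2 (carrier n) (carrier n) (en n) (\<lambda>x x'. E (dec n x ! k) (dec n x' ! k))"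
  using entails_cjD[of k n "carrier n \<times> carrier n" "\<lambda>p i. E (dec n (fst p) ! i) (dec n (snd p) ! i)"]
  by (simp add: entails_Times en_def[abs_def] el_def)

lemma frel_proj: "i < n \<Longrightarrow> frel A (carrier n) (en n) W E (proj_rel n i)"
  by (intro frel_graph per_en W.per_axioms en_nth tup_nth[OF dec_in])

text \<open>The factor \<open>r z z\<close> keeps the relation strict for \<open>n = 0\<close>, when
  the finite conjunction is \<open>top\<close>.\<close>

definition tuple where
  "tuple n r F z x = r z z \<otimes> cj n (\<lambda>i. F i z (dec n x ! i))"

lemma tuple_nth:
  assumes "k < n"
  obtains t where "t \<in> \<Sigma>" and "\<And>z x u. u \<le> tuple n r F z x \<Longrightarrow> t \<cdot> u \<le> F k z (dec n x ! k)"
proof -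
  have "entails A UNIV (\<lambda>p. tuple n r F (fst p) (snd p)) (\<lambda>p. F k (fst p) (dec n (snd p) ! k))"
    unfolding tuple_def by (rule entails_trans[OF entails_conj2 entails_cjD[OF assms]])
  then obtain t where "t \<in> \<Sigma>" "\<And>p u. u \<le> tuple n r F (fst p) (snd p) \<Longrightarrow> p \<in> UNIV \<Longrightarrow> t \<cdot> u \<le> F k (fst p) (dec n (snd p) ! k)"
    using entailsE by blast
  from this(1) this(2)[of _ "(_, _)"] show thesis by (intro that) simp_all
qed

lemma frel_tuple:
  assumes r: "per A Z r" and F: "\<And>i. i < n \<Longrightarrow> frel A Z r W E (F i)"
  shows "frel A Z r (carrier n) (en n) (tuple n r F)"
proof -
  interpret Z: per A Z r by fact
  interpret N: per A "carrier n" "en n" by (rule per_en)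
  let ?X = "carrier n"
  let ?c = "INF x\<in>?X. en n x x"
  show ?thesis
  proof
    show "(INF z\<in>Z. INF x\<in>?X. tuple n r F z x \<leadsto> r z z) \<in> \<Sigma>"
      unfolding tuple_def
      by (rule sepI, (rule seqI | erule le_cnjE)+, assumption, intro definables)
    have c: "x \<in> ?X \<Longrightarrow> ?c \<le> en n x x" for x by (rule INF_lower)
    show "(INF z\<in>Z. INF x\<in>?X. tuple n r F z x \<leadsto> en n x x) \<in> \<Sigma>"
      by (rule sepI, (rule seqI)+, erule c, intro definables en_refl_sep)
    have "entails A (Z \<times> Z \<times> ?X \<times> ?X) (\<lambda>(z, z', x, x'). (r z z' \<otimes> tuple n r F z x) \<otimes> en n x x')
        (\<lambda>p. case p of (z, z', x, x') \<Rightarrow> cj n (\<lambda>i. F i z' (dec n x' ! i)))"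
      unfolding split_def
    proof (rule entails_cjI)
      fix k assume k: "k < n"
      interpret Fk: frel A Z r W E "F k" using k by (rule F)
      obtain t where t: "t \<in> \<Sigma>" "\<And>z x u. u \<le> tuple n r F z x \<Longrightarrow> t \<cdot> u \<le> F k z (dec n x ! k)"
        using tuple_nth[OF k] by blast
      note s = entails2D[OF en_nth[OF k]]
      show "entails A (Z \<times> Z \<times> ?X \<times> ?X)
          (\<lambda>p. (r (fst p) (fst (snd p)) \<otimes> tuple n r F (fst p) (fst (snd (snd p)))) \<otimes> en n (fst (snd (snd p))) (snd (snd (snd p))))
          (\<lambda>p. F k (fst (snd p)) (dec n (snd (snd (snd p))) ! k))"
        unfolding entails_def INF_Times fst_conv snd_conv
        by (rule sepI, (rule seqI | erule le_cnjE)+, rule Fk.cong, assumption, rule t(2), assumption,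
            rule s(2), (assumption | rule tup_nth[OF dec_in] k)+, intro definables Fk.seps s(1) t(1))
    qed
    then have "entails A (Z \<times> Z \<times> ?X \<times> ?X) (\<lambda>(z, z', x, x'). (r z z' \<otimes> tuple n r F z x) \<otimes> en n x x')
        (\<lambda>(z, z', x, x'). cj n (\<lambda>i. F i z' (dec n x' ! i)))" .
    from entailsD[OF this] obtain t where t: "t \<in> \<Sigma>" "\<And>p u. u \<le> (case p of (z, z', x, x') \<Rightarrow> (r z z' \<otimes> tuple n r F z x) \<otimes> en n x x')
        \<Longrightarrow> p \<in> Z \<times> Z \<times> ?X \<times> ?X \<Longrightarrow> t \<cdot> u \<le> (case p of (z, z', x, x') \<Rightarrow> cj n (\<lambda>i. F i z' (dec n x' ! i)))" by (rule that)
    have t': "t \<cdot> pr (pr u v) w \<le> cj n (\<lambda>i. F i z' (dec n x' ! i))"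
      if "u \<le> r z z'" "v \<le> tuple n r F z x" "w \<le> en n x x'" "z \<in> Z" "z' \<in> Z" "x \<in> ?X" "x' \<in> ?X" for u v w z z' x x'
      using t(2)[of "pr (pr u v) w" "(z, z', x, x')"] that by (simp add: pr_le)
    show "(INF z\<in>Z. INF z'\<in>Z. INF x\<in>?X. INF x'\<in>?X. r z z' \<leadsto> tuple n r F z x \<leadsto> en n x x' \<leadsto> tuple n r F z' x') \<in> \<Sigma>"
      unfolding tuple_def[of _ _ _ _ "_ :: 'u", abs_def]
      apply (rule sepI, (rule seqI)+, rule pr_le, rule Z.right, assumption+, rule t', assumption)
         apply (unfold tuple_def, assumption+)
      apply (intro definables Z.seps t(1))
      done
    have "entails A (Z \<times> ?X \<times> ?X) (\<lambda>(z, x, x'). tuple n r F z x \<otimes> tuple n r F z x') (\<lambda>(z, x, x'). en n x x')"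
      unfolding split_def en_def el_def
    proof (rule entails_cjI)
      fix k assume k: "k < n"
      interpret Fk: frel A Z r W E "F k" using k by (rule F)
      obtain t where t: "t \<in> \<Sigma>" "\<And>z x u. u \<le> tuple n r F z x \<Longrightarrow> t \<cdot> u \<le> F k z (dec n x ! k)"
        using tuple_nth[OF k] by blast
      show "entails A (Z \<times> ?X \<times> ?X)
          (\<lambda>p. tuple n r F (fst p) (fst (snd p)) \<otimes> tuple n r F (fst p) (snd (snd p)))
          (\<lambda>p. E (dec n (fst (snd p)) ! k) (dec n (snd (snd p)) ! k))"
        unfolding entails_def INF_Times fst_conv snd_conv
        by (rule sepI, (rule seqI | erule le_cnjE)+, rule Fk.single, rule t(2), assumption, rule t(2),
            (assumption | rule tup_nth[OF dec_in] k)+, intro definables Fk.seps t(1))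
    qed
    then show "(INF z\<in>Z. INF x\<in>?X. INF x'\<in>?X. tuple n r F z x \<leadsto> tuple n r F z x' \<leadsto> en n x x') \<in> \<Sigma>"
      unfolding split_def entails_curry by (simp add: entails_def INF_Times)
    \<comment> \<open>Totality requires one tuple of values, whereas each \<open>F k\<close> yields
      its own value; finite choice combines them.\<close>
    have "entails A Z (\<lambda>z. r z z) (\<lambda>z. cj n (\<lambda>k. ex W (F k z)))"
      using frel.total_sep[OF F] by (intro entails_cjI) (simp add: entails_def)
    then have "entails A Z (\<lambda>z. r z z) (\<lambda>z. ex (tup W n) (\<lambda>l. cj n (\<lambda>k. F k z (l ! k))))"
      using cj_choice[of Z n W "\<lambda>z k. F k z"] by (rule entails_trans)
    then have "entails A Z (\<lambda>z. r z z) (\<lambda>z. ex ?X (\<lambda>x. cj n (\<lambda>k. F k z (dec n x ! k))))"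
      by (simp add: ex_carrier[of n "\<lambda>l. cj n (\<lambda>k. F k _ (l ! k))"])
    note k = entailsD[OF this]
    show "(INF z\<in>Z. r z z \<leadsto> ex ?X (tuple n r F z)) \<in> \<Sigma>"
      unfolding tuple_def
      by (rule sepI, (rule seqI)+, rule unwit_le, rule k(2), assumption+, rule wit_le, rule pr_le, assumption+,
          intro definables k(1))
  qed
qed

lemma tuple_proj:
  assumes "per A Z r" "\<And>i. i < n \<Longrightarrow> frel A Z r W E (F i)" "k < n"
  shows "rel_eq Z W (cmp (carrier n) (tuple n r F) (proj_rel n k)) (F k)"
proof -
  interpret Fk: frel A Z r W E "F k" by (rule assms(2)[OF assms(3)])
  obtain t where t: "t \<in> \<Sigma>" "\<And>z x u. u \<le> tuple n r F z x \<Longrightarrow> t \<cdot> u \<le> F k z (dec n x ! k)"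
    using tuple_nth[OF assms(3)] by blast
  have "entails2 Z W (cmp (carrier n) (tuple n r F) (proj_rel n k)) (F k)"
    unfolding entails2_def cmp_def graph_def
    by (rule sepI, (rule seqI | erule unwit_le le_cnjE)+, rule Fk.cong2, rule t(2), assumption+,
        rule tup_nth[OF dec_in assms(3)], assumption+, intro definables Fk.seps t(1))
  moreover have "frel A Z r (carrier n) (en n) (tuple n r F)" using assms(1,2) by (rule frel_tuple)
  ultimately show ?thesis
    using rel_eq_if_entails2 frel_cmp[OF _ frel_proj[OF assms(3)]] Fk.frel_axioms by blast
qed

text \<open>If \<open>T\<close> relates \<open>z\<close> to \<open>x\<close>, then composing with
  the \<open>k\<close>-th projection relates \<open>z\<close> to entry \<open>k\<close> of
  \<open>x\<close>. This gives one inclusion, and functional relations need no more.\<close>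

lemma tuple_unique:
  assumes "per A Z r" "\<And>i. i < n \<Longrightarrow> frel A Z r W E (F i)" "frel A Z r (carrier n) (en n) T"
    and "\<And>i. i < n \<Longrightarrow> rel_eq Z W (cmp (carrier n) T (proj_rel n i)) (F i)"
  shows "rel_eq Z (carrier n) T (tuple n r F)"
proof -
  interpret T: frel A Z r "carrier n" "en n" T by fact
  have "entails2 Z (carrier n) T (\<lambda>z x. F k z (dec n x ! k))" if k: "k < n" for k
  proof -
    have "entails2 Z W (cmp (carrier n) T (proj_rel n k)) (F k)"
      using assms(4)[OF k] by (simp add: rel_eq_def)
    note t = entails2D[OF this, unfolded cmp_def graph_def]
    have c: "w \<in> W \<Longrightarrow> (INF x\<in>W. E x x) \<le> E w w" for w by (rule INF_lower)
    show ?thesis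
      unfolding entails2_def
      by (rule sepI, (rule seqI)+, rule t(2), rule wit_le, (rule pr_le)+, assumption,
          rule pr_le, rule T.strict2, assumption+, rule c, (assumption | rule tup_nth[OF dec_in k])+,
          intro definables T.seps t(1) refl_sep)
  qed
  then have "entails A (Z \<times> carrier n) (\<lambda>p. T (fst p) (snd p)) (\<lambda>p. cj n (\<lambda>k. F k (fst p) (dec n (snd p) ! k)))"
    by (intro entails_cjI) (simp add: entails_Times)
  then have "entails2 Z (carrier n) T (\<lambda>z x. cj n (\<lambda>k. F k z (dec n x ! k)))"
    by (simp add: entails_Times)
  note t = entails2D[OF this]
  have "entails2 Z (carrier n) T (tuple n r F)"
    unfolding entails2_def tuple_def
    by (rule sepI, (rule seqI)+, rule pr_le, rule T.strict1, assumption+, rule t(2), assumption+,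
        intro definables T.seps t(1))
  moreover have "frel A Z r (carrier n) (en n) (tuple n r F)" using assms(1,2) by (rule frel_tuple)
  ultimately show ?thesis using rel_eq_if_entails2 assms(3) by blast
qed

lemma is_power: "is_power C (ob W E) n (ob (carrier n) (en n)) (proj n)"
  unfolding is_power_def
proof (intro conjI ballI allI impI)
  show "ob (carrier n) (en n) \<in> Obj C" by (simp add: Obj_iff carrier_in_U per_en)
  show "proj n i \<in> hom C (ob (carrier n) (en n)) (ob W E)" if "i < n" for i
    using that by (simp add: proj_def ar_in_hom_iff carrier_in_U W_in_U frel_proj)
  fix S and f :: "nat \<Rightarrow> ('u, 'a) per_arr"
  assume "S \<in> Obj C" and f: "\<forall>i<n. f i \<in> hom C S (ob W E)"
  then obtain Z r where S: "S = ob Z r" "Z \<in> U" "per A Z r" by (elim ObjE)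
  have "\<forall>i. \<exists>F. i < n \<longrightarrow> f i = ar Z r W E F \<and> frel A Z r W E F"
    using f unfolding S by (metis homE)
  then obtain F where "\<forall>i<n. f i = ar Z r W E (F i) \<and> frel A Z r W E (F i)" by metis
  then have F: "\<And>i. i < n \<Longrightarrow> f i = ar Z r W E (F i)" "\<And>i. i < n \<Longrightarrow> frel A Z r W E (F i)" by auto
  show "\<exists>!u. u \<in> hom C S (ob (carrier n) (en n)) \<and> (\<forall>i<n. Comp C (proj n i) u = f i)"
  proof (rule ex1I[of _ "ar Z r (carrier n) (en n) (tuple n r F)"])
    show "ar Z r (carrier n) (en n) (tuple n r F) \<in> hom C S (ob (carrier n) (en n)) \<and>
        (\<forall>i<n. Comp C (proj n i) (ar Z r (carrier n) (en n) (tuple n r F)) = f i)"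
      using S F by (simp add: ar_in_hom_iff carrier_in_U frel_tuple proj_def tuple_proj)
  next
    fix u assume u: "u \<in> hom C S (ob (carrier n) (en n)) \<and> (\<forall>i<n. Comp C (proj n i) u = f i)"
    then obtain T where T: "u = ar Z r (carrier n) (en n) T" "frel A Z r (carrier n) (en n) T"
      unfolding S by (blast elim: homE)
    with u F(1) show "u = ar Z r (carrier n) (en n) (tuple n r F)"
      using tuple_unique[OF S(3) F(2) T(2)] by (simp add: proj_def)
  qed
qed

end

section \<open>The interpretation of formulas\<close>

locale set_structure = total_object A U W E
  for A :: "'a::complete_lattice impl_alg" and U :: "'u set set" and W :: "'u set" and E +
  fixes mem :: "'u \<Rightarrow> 'u \<Rightarrow> 'a"
  assumes mem_cong_sep: "(INF x\<in>W. INF x'\<in>W. INF y\<in>W. INF y'\<in>W. E x x' \<leadsto> E y y' \<leadsto> mem x y \<leadsto> mem x' y') \<in> \<Sigma>"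
begin

declare enc.simps [simp del]

definition "rmem = (INF x\<in>W. INF x'\<in>W. INF y\<in>W. INF y'\<in>W. E x x' \<leadsto> E y y' \<leadsto> mem x y \<leadsto> mem x' y')"

lemma rmem_sep: "rmem \<in> \<Sigma>"
  unfolding rmem_def by (rule mem_cong_sep)

lemma mem_cong: "\<lbrakk>u \<le> E x x'; v \<le> E y y'; w \<le> mem x y; x \<in> W; x' \<in> W; y \<in> W; y' \<in> W\<rbrakk>
    \<Longrightarrow> rmem \<cdot> u \<cdot> v \<cdot> w \<le> mem x' y'"
  using eq_refl[OF rmem_def] unfolding le_INF_iff le_arr_iff by blast

definition "rrefl = (INF x\<in>W. E x x)"

lemma rrefl_sep: "rrefl \<in> \<Sigma>"
  unfolding rrefl_def by (rule refl_sep)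

lemma E_refl: "x \<in> W \<Longrightarrow> rrefl \<le> E x x"
  unfolding rrefl_def by (rule INF_lower)

section \<open>Formulas as algebra-valued functions of tuples\<close>

primrec sem :: "fm \<Rightarrow> 'u list \<Rightarrow> 'a" where
  "sem (Mem i j) l = mem (l ! i) (l ! j)"
| "sem (Eq i j) l = E (l ! i) (l ! j)"
| "sem Falsum l = bot"
| "sem (And \<phi> \<psi>) l = sem \<phi> l \<otimes> sem \<psi> l"
| "sem (Or \<phi> \<psi>) l = sem \<phi> l \<oplus> sem \<psi> l"
| "sem (Imp \<phi> \<psi>) l = sem \<phi> l \<leadsto> sem \<psi> l"
| "sem (Forall \<phi>) l = (INF w\<in>W. sem \<phi> (w # l))"
| "sem (Exists \<phi>) l = ex W (\<lambda>w. sem \<phi> (w # l))"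

definition ext :: "nat \<Rightarrow> ('u list \<Rightarrow> 'a) \<Rightarrow> bool" where
  "ext n f \<longleftrightarrow> (INF l\<in>tup W n. INF l'\<in>tup W n. el n l l' \<leadsto> f l \<leadsto> f l') \<in> \<Sigma>"

lemma extD:
  assumes "ext n f"
  shows "(INF l\<in>tup W n. INF l'\<in>tup W n. el n l l' \<leadsto> f l \<leadsto> f l') \<in> \<Sigma>" (is "?t \<in> _")
    and "\<lbrakk>u \<le> el n l l'; v \<le> f l; l \<in> tup W n; l' \<in> tup W n\<rbrakk>
        \<Longrightarrow> (INF l\<in>tup W n. INF l'\<in>tup W n. el n l l' \<leadsto> f l \<leadsto> f l') \<cdot> u \<cdot> v \<le> f l'"
  using assms order_refl[of ?t] unfolding ext_def le_INF_iff[of ?t] le_arr_iff by simp_all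

lemma Cons_tup: "w \<in> W \<Longrightarrow> l \<in> tup W n \<Longrightarrow> w # l \<in> tup W (Suc n)"
  by (simp add: tup_def)

text \<open>The added entry is compared with itself, for which the uniform realizer of reflexivity
  is available. This carries extensionality through the quantifiers.\<close>

lemma el_Cons:
  obtains t where "t \<in> \<Sigma>" and "\<And>l l' w u. \<lbrakk>u \<le> el n l l'; l \<in> tup W n; l' \<in> tup W n; w \<in> W\<rbrakk>
      \<Longrightarrow> t \<cdot> u \<le> el (Suc n) (w # l) (w # l')"
proof -
  have "entails A (tup W n \<times> tup W n \<times> W) (\<lambda>p. el n (fst p) (fst (snd p)))
      (\<lambda>p. cj (Suc n) (\<lambda>k. E ((snd (snd p) # fst p) ! k) ((snd (snd p) # fst (snd p)) ! k)))"
  proof (rule entails_cjI)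
    fix k assume k: "k < Suc n"
    show "entails A (tup W n \<times> tup W n \<times> W) (\<lambda>p. el n (fst p) (fst (snd p)))
      (\<lambda>p. E ((snd (snd p) # fst p) ! k) ((snd (snd p) # fst (snd p)) ! k))"
    proof (cases k)
      case 0
      show ?thesis
        unfolding 0 entails_def INF_Times fst_conv snd_conv nth_Cons_0
        by (rule sepI, (rule seqI)+, erule E_refl, intro definables rrefl_sep)
    next
      case (Suc m)
      then have "m < n" using k by simp
      then obtain t where t: "t \<in> \<Sigma>" "\<And>l l' u. u \<le> el n l l' \<Longrightarrow> t \<cdot> u \<le> E (l ! m) (l' ! m)"
        using el_nth by blast
      show ?thesis
        unfolding Suc entails_def INF_Times fst_conv snd_conv nth_Cons_Suc
        by (rule sepI, (rule seqI)+, erule t(2), intro definables t(1))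
    qed
  qed
  then obtain t where t: "t \<in> \<Sigma>" "\<And>p u. u \<le> el n (fst p) (fst (snd p)) \<Longrightarrow> p \<in> tup W n \<times> tup W n \<times> W
      \<Longrightarrow> t \<cdot> u \<le> el (Suc n) (snd (snd p) # fst p) (snd (snd p) # fst (snd p))"
    unfolding el_def using entailsE by blast
  have "t \<cdot> u \<le> el (Suc n) (w # l) (w # l')" if "u \<le> el n l l'" "l \<in> tup W n" "l' \<in> tup W n" "w \<in> W" for l l' w u
    using t(2)[of u "(l, l', w)"] that by simp
  then show thesis using that t(1) by blast
qed

lemma ext_sem: "in_context \<phi> n \<Longrightarrow> ext n (sem \<phi>)"
proof (induction \<phi> arbitrary: n)
  case (Mem i j)
  then have ij: "i < n" "j < n" by auto
  obtain s where s: "s \<in> \<Sigma>" "\<And>l l' u. u \<le> el n l l' \<Longrightarrow> s \<cdot> u \<le> E (l ! i) (l' ! i)"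
    using el_nth[OF ij(1)] by blast
  obtain t where t: "t \<in> \<Sigma>" "\<And>l l' u. u \<le> el n l l' \<Longrightarrow> t \<cdot> u \<le> E (l ! j) (l' ! j)"
    using el_nth[OF ij(2)] by blast
  show ?case
    unfolding ext_def sem.simps
    by (rule sepI, (rule seqI)+, rule mem_cong, erule s(2), erule t(2), assumption,
        (erule tup_nth, rule ij)+, intro definables s(1) t(1) rmem_sep)
next
  case (Eq i j)
  then have ij: "i < n" "j < n" by auto
  obtain s where s: "s \<in> \<Sigma>" "\<And>l l' u. u \<le> el n l l' \<Longrightarrow> s \<cdot> u \<le> E (l ! i) (l' ! i)"
    using el_nth[OF ij(1)] by blast
  obtain t where t: "t \<in> \<Sigma>" "\<And>l l' u. u \<le> el n l l' \<Longrightarrow> t \<cdot> u \<le> E (l ! j) (l' ! j)"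
    using el_nth[OF ij(2)] by blast
  show ?case
    unfolding ext_def sem.simps
    by (rule sepI, (rule seqI)+, rule W.trans[OF W.trans[OF W.sym[OF s(2)] _] t(2)], assumption+,
        ((erule tup_nth, rule ij) | rule tup_nth ij | assumption)+, intro definables s(1) t(1) W.seps)
next
  case Falsum
  show ?case
    unfolding ext_def sem.simps
    by (rule sepI, (rule seqI)+, assumption, intro definables)
next
  case (And \<phi> \<psi>)
  then have ext: "ext n (sem \<phi>)" "ext n (sem \<psi>)" by auto
  note s = extD[OF ext(1)]
  note t = extD[OF ext(2)]
  show ?case
    unfolding ext_def sem.simps
    by (rule sepI, (rule seqI | erule le_cnjE)+, rule pr_le, rule s(2), assumption+, rule t(2), assumption+,
        intro definables s(1) t(1))
next
  case (Or \<phi> \<psi>)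
  then have ext: "ext n (sem \<phi>)" "ext n (sem \<psi>)" by auto
  note s = extD[OF ext(1)]
  note t = extD[OF ext(2)]
  show ?case
    unfolding ext_def sem.simps
    by (rule sepI, (rule seqI)+, erule cases_le, rule inl_le, rule s(2), assumption+,
        rule inr_le, rule t(2), assumption+, intro definables s(1) t(1))
next
  case (Imp \<phi> \<psi>)
  interpret L: per A "tup W n" "el n" by (rule per_el)
  from Imp have ext: "ext n (sem \<phi>)" "ext n (sem \<psi>)" by auto
  note s = extD[OF ext(1)]
  note t = extD[OF ext(2)]
  show ?case
    unfolding ext_def sem.simps
    by (rule sepI, (rule seqI)+, rule t(2), assumption, rule app_le, assumption, rule s(2), rule L.sym,
        assumption+, intro definables s(1) t(1) L.seps)
next
  case (Forall \<phi>)
  then have "ext (Suc n) (sem \<phi>)" by auto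
  note s = extD[OF this]
  obtain t where t: "t \<in> \<Sigma>" "\<And>l l' w u. \<lbrakk>u \<le> el n l l'; l \<in> tup W n; l' \<in> tup W n; w \<in> W\<rbrakk>
      \<Longrightarrow> t \<cdot> u \<le> el (Suc n) (w # l) (w # l')"
    using el_Cons by blast
  show ?case
    unfolding ext_def sem.simps
    by (rule sepI, (rule seqI)+, rule s(2), rule t(2), assumption+, erule le_INF_D, assumption,
        (rule Cons_tup, assumption+)+, intro definables s(1) t(1))
next
  case (Exists \<phi>)
  then have "ext (Suc n) (sem \<phi>)" by auto
  note s = extD[OF this]
  obtain t where t: "t \<in> \<Sigma>" "\<And>l l' w u. \<lbrakk>u \<le> el n l l'; l \<in> tup W n; l' \<in> tup W n; w \<in> W\<rbrakk>
      \<Longrightarrow> t \<cdot> u \<le> el (Suc n) (w # l) (w # l')"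
    using el_Cons by blast
  show ?case
    unfolding ext_def sem.simps
    by (rule sepI, (rule seqI | erule unwit_le)+, rule wit_le, rule s(2), rule t(2), assumption+,
        (rule Cons_tup, assumption+)+, intro definables s(1) t(1))
qed

lemma spred_dec:
  assumes "ext n f"
  shows "spred A (carrier n) (en n) (\<lambda>x. f (dec n x))"
proof -
  interpret N: per A "carrier n" "en n" by (rule per_en)
  have c: "x \<in> carrier n \<Longrightarrow> (INF x\<in>carrier n. en n x x) \<le> en n x x" for x by (rule INF_lower)
  show ?thesis
  proof
    show "(INF x\<in>carrier n. f (dec n x) \<leadsto> en n x x) \<in> \<Sigma>"
      by (rule sepI, (rule seqI)+, erule c, intro definables en_refl_sep)
    show "(INF x\<in>carrier n. INF y\<in>carrier n. en n x y \<leadsto> f (dec n x) \<leadsto> f (dec n y)) \<in> \<Sigma>"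
      using assms unfolding ext_def en_def by (subst INF_carrier, subst INF_carrier)
  qed
qed

lemmas spred_sem = spred_dec[OF ext_sem]

text \<open>Renaming of variables on tuples. The pairs of variables in atomic formulas and the
  weakenings of the quantifiers are both of this form.\<close>

definition reix :: "nat \<Rightarrow> (nat \<Rightarrow> nat) \<Rightarrow> 'u list \<Rightarrow> 'u list" where
  "reix m \<pi> l = map (\<lambda>k. l ! \<pi> k) [0..<m]"

lemma reix_tup: "(\<And>k. k < m \<Longrightarrow> \<pi> k < n) \<Longrightarrow> l \<in> tup W n \<Longrightarrow> reix m \<pi> l \<in> tup W m"
  by (auto simp: tup_def reix_def)

definition reix_fun :: "nat \<Rightarrow> nat \<Rightarrow> (nat \<Rightarrow> nat) \<Rightarrow> 'u \<Rightarrow> 'u" where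
  "reix_fun n m \<pi> x = enc (reix m \<pi> (dec n x))"

abbreviation "reix_rel n m \<pi> \<equiv> graph (en n) (en m) (reix_fun n m \<pi>)"

definition reix_ar :: "nat \<Rightarrow> nat \<Rightarrow> (nat \<Rightarrow> nat) \<Rightarrow> ('u, 'a) per_arr" where
  "reix_ar n m \<pi> = ar (carrier n) (en n) (carrier m) (en m) (reix_rel n m \<pi>)"

context
  fixes n m :: nat and \<pi> :: "nat \<Rightarrow> nat"
  assumes \<pi>: "\<And>k. k < m \<Longrightarrow> \<pi> k < n"
begin

lemma reix_fun_carrier: "x \<in> carrier n \<Longrightarrow> reix_fun n m \<pi> x \<in> carrier m"
  unfolding reix_fun_def by (intro enc_carrier reix_tup[where n = n] \<pi> dec_in)

lemma dec_reix_fun: "x \<in> carrier n \<Longrightarrow> dec m (reix_fun n m \<pi> x) = reix m \<pi> (dec n x)"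
  unfolding reix_fun_def by (intro dec_enc reix_tup[where n = n] \<pi> dec_in)

lemma en_reix: "entails2 (carrier n) (carrier n) (en n) (\<lambda>x x'. en m (reix_fun n m \<pi> x) (reix_fun n m \<pi> x'))"
proof -
  have "entails A (carrier n \<times> carrier n) (\<lambda>p. en n (fst p) (snd p))
      (\<lambda>p. cj m (\<lambda>k. E (dec n (fst p) ! \<pi> k) (dec n (snd p) ! \<pi> k)))"
    using en_nth[OF \<pi>] by (intro entails_cjI) (simp add: entails_Times)
  moreover have "cj m (\<lambda>k. E (dec n x ! \<pi> k) (dec n y ! \<pi> k)) = en m (reix_fun n m \<pi> x) (reix_fun n m \<pi> y)"
    if "x \<in> carrier n" "y \<in> carrier n" for x y
    unfolding en_def dec_reix_fun[OF that(1)] dec_reix_fun[OF that(2)] el_def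
    by (rule cj_cong) (simp add: reix_def)
  ultimately show ?thesis
    by (simp add: entails_Times entails2_def cong: INF_cong)
qed

lemma frel_reix: "frel A (carrier n) (en n) (carrier m) (en m) (reix_rel n m \<pi>)"
  by (intro frel_graph per_en en_reix reix_fun_carrier)

lemma reix_ar_hom: "reix_ar n m \<pi> \<in> hom C (ob (carrier n) (en n)) (ob (carrier m) (en m))"
  unfolding reix_ar_def by (simp add: ar_in_hom_iff carrier_in_U frel_reix)

lemma proj_reix: "k < m \<Longrightarrow> Comp C (proj m k) (reix_ar n m \<pi>) = proj n (\<pi> k)"
proof -
  assume k: "k < m"
  have "rel_eq (carrier n) W (cmp (carrier m) (reix_rel n m \<pi>) (proj_rel m k))
      (graph (en n) E (\<lambda>x. dec m (reix_fun n m \<pi> x) ! k))"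
    by (intro cmp_graph_graph per_en W.per_axioms reix_fun_carrier en_reix en_nth tup_nth[OF dec_in] k)
  then have "rel_eq (carrier n) W (cmp (carrier m) (reix_rel n m \<pi>) (proj_rel m k))
      (proj_rel n (\<pi> k))"
    by (rule rel_eq_cong[rotated]) (use k in \<open>simp add: graph_def dec_reix_fun reix_def\<close>)
  then show ?thesis by (simp add: proj_def reix_ar_def)
qed

lemma pullback_reix:
  assumes "a \<in> Sub C (ob (carrier m) (en m))" "pred_eq (carrier m) (Im a) (\<lambda>x. f (dec m x))"
  shows "\<exists>s. is_pullback C (reix_ar n m \<pi>) a s \<and> s \<in> Sub C (ob (carrier n) (en n)) \<and>
    pred_eq (carrier n) (Im s) (\<lambda>x. f (reix m \<pi> (dec n x)))"
proof (intro exI conjI)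
  let ?Q = "pb (carrier m) (reix_rel n m \<pi>) (Im a)"
  let ?s = "sub (carrier n) (en n) ?Q"
  show "is_pullback C (reix_ar n m \<pi>) a ?s"
    unfolding reix_ar_def by (intro is_pullback_sub carrier_in_U frel_reix assms(1))
  have Q: "spred A (carrier n) (en n) ?Q" by (rule spred_pb[OF frel_reix])
  then show "?s \<in> Sub C (ob (carrier n) (en n))"
    by (intro sub_in_Sub carrier_in_U)
  have "pred_eq (carrier n) (Im ?s) ?Q" using carrier_in_U Q by (rule Im_sub_eq)
  moreover have "pred_eq (carrier n) ?Q (\<lambda>x. Im a (reix_fun n m \<pi> x))"
    by (intro pb_graph spred_Im assms(1) reix_fun_carrier en_refl_sep)
  moreover have "pred_eq (carrier n) (\<lambda>x. Im a (reix_fun n m \<pi> x)) (\<lambda>x. f (dec m (reix_fun n m \<pi> x)))"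
    using assms(2) reix_fun_carrier unfolding pred_eq_def
    by (auto intro: entails_reindex[where f = "Im a"] entails_reindex[where g = "Im a"])
  moreover have "pred_eq (carrier n) (\<lambda>x. f (dec m (reix_fun n m \<pi> x))) (\<lambda>x. f (reix m \<pi> (dec n x)))"
    using entails_refl[of "carrier n"] by (simp add: pred_eq_def dec_reix_fun cong: entails_cong)
  ultimately show "pred_eq (carrier n) (Im ?s) (\<lambda>x. f (reix m \<pi> (dec n x)))"
    using pred_eq_trans by blast
qed

end

definition mem_sub :: "('u, 'a) per_arr" where
  "mem_sub = sub (carrier 2) (en 2) (\<lambda>x. sem (Mem 0 1) (dec 2 x))"

lemma mem_sub: "mem_sub \<in> Sub C (ob (carrier 2) (en 2))" "pred_eq (carrier 2) (Im mem_sub) (\<lambda>x. sem (Mem 0 1) (dec 2 x))"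
proof -
  have "spred A (carrier 2) (en 2) (\<lambda>x. sem (Mem 0 1) (dec 2 x))" by (rule spred_sem) simp
  then show "mem_sub \<in> Sub C (ob (carrier 2) (en 2))" "pred_eq (carrier 2) (Im mem_sub) (\<lambda>x. sem (Mem 0 1) (dec 2 x))"
    unfolding mem_sub_def by (intro sub_in_Sub Im_sub_eq carrier_in_U; assumption)+
qed

abbreviation "diag_rel \<equiv> graph E (en 2) (\<lambda>w. enc [w, w])"

definition diag :: "('u, 'a) per_arr" where
  "diag = ar W E (carrier 2) (en 2) diag_rel"

text \<open>The diagonal is the graph of the map sending \<open>w\<close> to the code of
  \<open>[w, w]\<close>. A pair lies in its image when some \<open>w\<close> equals both entries,
  that is, when the entries are equal; conversely the first entry serves as
  \<open>w\<close>.\<close>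

lemma diag:
  "diag \<in> hom C (ob W E) (ob (carrier 2) (en 2))"
  "k < 2 \<Longrightarrow> Comp C (proj 2 k) diag = Ide C (ob W E)"
  "diag \<in> Sub C (ob (carrier 2) (en 2))"
  "pred_eq (carrier 2) (Im diag) (\<lambda>x. sem (Eq 0 1) (dec 2 x))"
proof -
  have tup: "w \<in> W \<Longrightarrow> [w, w] \<in> tup W 2" for w by (simp add: tup_def)
  have dd: "w \<in> W \<Longrightarrow> dec 2 (enc [w, w]) = [w, w]" for w by (rule dec_enc[OF tup])
  have car: "w \<in> W \<Longrightarrow> enc [w, w] \<in> carrier 2" for w by (rule enc_carrier[OF tup])
  \<comment> \<open>The \<open>top\<close> is the empty conjunction from which \<open>cj\<close>
    starts.\<close>
  have en2: "en 2 (enc [w, w]) x = (top \<otimes> E w (dec 2 x ! 0)) \<otimes> E w (dec 2 x ! 1)" if "w \<in> W" for w x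
    unfolding en_def dd[OF that] el_def by (simp add: numeral_2_eq_2)
  have e: "entails2 W W E (\<lambda>w w'. en 2 (enc [w, w]) (enc [w', w']))"
  proof -
    have "entails2 W W E (\<lambda>w w'. (top \<otimes> E w w') \<otimes> E w w')"
      unfolding entails2_def
      by (rule sepI, (rule seqI)+, (rule pr_le)+, rule top_greatest[of cK], assumption+,
          intro definables cK_sep)
    then show ?thesis by (simp add: entails2_def en2 dd cong: INF_cong)
  qed
  have fr: "frel A W E (carrier 2) (en 2) diag_rel"
    by (intro frel_graph per_en W.per_axioms car e)
  show "diag \<in> hom C (ob W E) (ob (carrier 2) (en 2))"
    unfolding diag_def by (simp add: ar_in_hom_iff fr carrier_in_U W_in_U)
  show "Comp C (proj 2 k) diag = Ide C (ob W E)" if k: "k < 2"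
  proof -
    have "rel_eq W W (cmp (carrier 2) diag_rel (proj_rel 2 k))
        (graph E E (\<lambda>w. dec 2 (enc [w, w]) ! k))"
      by (intro cmp_graph_graph per_en W.per_axioms car e en_nth tup_nth[OF dec_in] k)
    then have "rel_eq W W (cmp (carrier 2) diag_rel (proj_rel 2 k))
        (graph E E (\<lambda>w. w))"
      by (rule rel_eq_cong[rotated]) (use k in \<open>auto simp: graph_def dd less_2_cases_iff\<close>)
    then have "ar W E W E (cmp (carrier 2) diag_rel (proj_rel 2 k))
        = ar W E W E (graph E E (\<lambda>w. w))" by (simp only: ar_eq_iff)
    \<comment> \<open>The identity arrow is the relation \<open>E\<close> itself, whereas composing
      graphs produces the graph of the identity function, which carries an extra factor
      \<open>E w w\<close>.\<close>
    also have "ar W E W E (graph E E (\<lambda>w. w)) = ar W E W E E"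
      unfolding ar_eq_iff rel_eq_def entails2_def graph_def
      apply (rule conjI)
       apply (rule sepI, (rule seqI | erule le_cnjE)+, assumption, intro definables)
      apply (rule sepI, (rule seqI)+, rule pr_le, erule E_refl, assumption, intro definables rrefl_sep)
      done
    finally show ?thesis unfolding proj_def diag_def Comp_ar
      by (simp add: tripos_topos_def ar_def ob_def)
  qed
  have "rinj W (carrier 2) E (\<lambda>w x. E w w \<otimes> ((top \<otimes> E w (dec 2 x ! 0)) \<otimes> E w (dec 2 x ! 1)))"
    unfolding rinj_def
    by (rule sepI, (rule seqI | erule le_cnjE)+, rule W.trans[of _ _ "dec 2 _ ! 0", OF _ W.sym], assumption+,
        (assumption | (rule tup_nth[OF dec_in], assumption, simp))+, intro definables W.seps)
  then have inj: "rinj W (carrier 2) E diag_rel"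
    by (simp add: rinj_def graph_def en2 cong: INF_cong)
  then show "diag \<in> Sub C (ob (carrier 2) (en 2))"
    unfolding Sub_def diag_def by (simp add: monic_ar_iff[OF W_in_U carrier_in_U fr])
  have "pred_eq (carrier 2) (im W (\<lambda>w x. E w w \<otimes> ((top \<otimes> E w (dec 2 x ! 0)) \<otimes> E w (dec 2 x ! 1)))) (\<lambda>x. E (dec 2 x ! 0) (dec 2 x ! 1))"
    unfolding pred_eq_def entails_def im_def
    apply (rule conjI)
     apply (rule sepI, (rule seqI | erule unwit_le le_cnjE)+, rule W.trans[OF W.sym], assumption+,
        (assumption | (rule tup_nth[OF dec_in], assumption, simp))+, intro definables W.seps)
    apply (rule sepI, (rule seqI)+, rule wit_le, rule pr_le, rule E_refl, rule tup_nth[OF dec_in, of _ 2 0], assumption, simp,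
        (rule pr_le)+, rule top_greatest[of cK], rule E_refl, rule tup_nth[OF dec_in], assumption, simp, assumption,
        rule tup_nth[OF dec_in], assumption, simp, intro definables rrefl_sep cK_sep)
    done
  moreover have "im W (\<lambda>w x. E w w \<otimes> ((top \<otimes> E w (dec 2 x ! 0)) \<otimes> E w (dec 2 x ! 1))) = im W diag_rel"
    by (simp add: im_def alg_ex_def graph_def en2 fun_eq_iff cong: INF_cong)
  ultimately have "pred_eq (carrier 2) (im W diag_rel) (\<lambda>x. sem (Eq 0 1) (dec 2 x))"
    by simp
  moreover have "pred_eq (carrier 2) (Im diag) (im W diag_rel)"
    unfolding diag_def pred_eq_def using Im_ar[OF carrier_in_U W_in_U fr] by blast
  ultimately show "pred_eq (carrier 2) (Im diag) (\<lambda>x. sem (Eq 0 1) (dec 2 x))"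
    using pred_eq_trans by blast
qed

abbreviation "Pw \<equiv> \<lambda>n. ob (carrier n) (en n)"

abbreviation "itp \<equiv> interp C (ob W E) Pw proj mem_sub"

lemma reix_Suc: "l \<in> tup W (Suc n) \<Longrightarrow> reix n Suc l = tl l"
  by (auto simp: tup_def reix_def intro!: nth_equalityI simp: nth_tl)

abbreviation "wk n R \<equiv> pb (carrier n) (reix_rel (Suc n) n Suc) R"

lemma pb_weakening:
  assumes "spred A (carrier n) (en n) R"
  shows "pred_eq (carrier (Suc n)) (wk n R)
    (\<lambda>x. R (enc (tl (dec (Suc n) x))))"
proof -
  have "pred_eq (carrier (Suc n)) (wk n R)
    (\<lambda>x. R (reix_fun (Suc n) n Suc x))"
    by (intro pb_graph assms reix_fun_carrier en_refl_sep) simp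
  then show ?thesis
    by (simp add: reix_fun_def reix_Suc[OF dec_in] pred_eq_def cong: entails_cong)
qed

lemma entails_carrier_left:
  "entails A (carrier n) R (\<lambda>x. g (dec n x)) \<longleftrightarrow> entails A (tup W n) (\<lambda>l. R (enc l)) g"
  "entails A (carrier n) (\<lambda>x. g (dec n x)) R \<longleftrightarrow> entails A (tup W n) g (\<lambda>l. R (enc l))"
  unfolding carrier_def entails_image by (simp_all add: dec_enc cong: entails_cong)

text \<open>Since \<open>interp\<close> is a relation, existence of an interpreting subobject is
  proved together with its value, up to mutual entailment. For a quantifier, a tuple and a new entry
  are regrouped as a longer tuple; weakening drops its head, and the adjunctions become those of
  meets and existentials over \<open>W\<close>.\<close>

lemma interp_exists:
  assumes "in_context \<phi> n"
  shows "\<exists>s. itp \<phi> n s \<and> s \<in> Sub C (Pw n) \<and>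
    pred_eq (carrier n) (Im s) (\<lambda>x. sem \<phi> (dec n x))"
  using assms
proof (induction \<phi> arbitrary: n)
  case (Mem i j)
  let ?\<pi> = "\<lambda>k. if k = 0 then i else j"
  have \<pi>: "k < 2 \<Longrightarrow> ?\<pi> k < n" for k :: nat using Mem by auto
  have "is_var_pair C Pw proj n i j (reix_ar n 2 ?\<pi>)"
    unfolding is_var_pair_def using reix_ar_hom[of 2 ?\<pi> n] proj_reix[of 2 ?\<pi> n] \<pi> by simp
  moreover obtain s where "is_pullback C (reix_ar n 2 ?\<pi>) mem_sub s" "s \<in> Sub C (Pw n)"
    "pred_eq (carrier n) (Im s) (\<lambda>x. sem (Mem 0 1) (reix 2 ?\<pi> (dec n x)))"
    using pullback_reix[of 2 ?\<pi> n, OF \<pi> mem_sub] by blast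
  moreover have "sem (Mem 0 1) (reix 2 ?\<pi> l) = sem (Mem i j) l" for l
    by (simp add: reix_def numeral_2_eq_2)
  ultimately show ?case unfolding interp.simps by (simp only:) blast
next
  case (Eq i j)
  let ?\<pi> = "\<lambda>k. if k = 0 then i else j"
  have \<pi>: "k < 2 \<Longrightarrow> ?\<pi> k < n" for k :: nat using Eq by auto
  have "is_var_pair C Pw proj n i j (reix_ar n 2 ?\<pi>)"
    unfolding is_var_pair_def using reix_ar_hom[of 2 ?\<pi> n] proj_reix[of 2 ?\<pi> n] \<pi> by simp
  moreover have "is_diagonal C (ob W E) Pw proj diag"
    unfolding is_diagonal_def by (simp add: diag(1,2))
  moreover obtain s where "is_pullback C (reix_ar n 2 ?\<pi>) diag s" "s \<in> Sub C (Pw n)"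
    "pred_eq (carrier n) (Im s) (\<lambda>x. sem (Eq 0 1) (reix 2 ?\<pi> (dec n x)))"
    using pullback_reix[of 2 ?\<pi> n, OF \<pi> diag(3,4)] by blast
  moreover have "sem (Eq 0 1) (reix 2 ?\<pi> l) = sem (Eq i j) l" for l
    by (simp add: reix_def numeral_2_eq_2)
  ultimately show ?case unfolding interp.simps by (simp only:) blast
next
  case Falsum
  have g: "spred A (carrier n) (en n) (\<lambda>x. sem Falsum (dec n x))" by (rule spred_sem) simp
  show ?case
    using is_bot_sub[OF carrier_in_U g[unfolded sem.simps]] sub_in_Sub[OF carrier_in_U g] Im_sub_eq[OF carrier_in_U g]
    unfolding interp.simps sem.simps by blast
next
  case (And \<phi> \<psi>)
  have \<phi>: "in_context \<phi> n" and \<psi>: "in_context \<psi> n" using And.prems by simp_all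
  obtain a b where ab: "itp \<phi> n a" "itp \<psi> n b"
    and *: "a \<in> Sub C (Pw n)" "b \<in> Sub C (Pw n)" "pred_eq (carrier n) (Im a) (\<lambda>x. sem \<phi> (dec n x))"
      "pred_eq (carrier n) (Im b) (\<lambda>x. sem \<psi> (dec n x))"
    using And.IH(1)[OF \<phi>] And.IH(2)[OF \<psi>] by blast
  note g = spred_sem[OF And.prems]
  show ?case
    using ab is_meet_sub[OF carrier_in_U * g[unfolded sem.simps]] sub_in_Sub[OF carrier_in_U g] Im_sub_eq[OF carrier_in_U g]
    unfolding interp.simps sem.simps by blast
next
  case (Or \<phi> \<psi>)
  have \<phi>: "in_context \<phi> n" and \<psi>: "in_context \<psi> n" using Or.prems by simp_all
  obtain a b where ab: "itp \<phi> n a" "itp \<psi> n b"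
    and *: "a \<in> Sub C (Pw n)" "b \<in> Sub C (Pw n)" "pred_eq (carrier n) (Im a) (\<lambda>x. sem \<phi> (dec n x))"
      "pred_eq (carrier n) (Im b) (\<lambda>x. sem \<psi> (dec n x))"
    using Or.IH(1)[OF \<phi>] Or.IH(2)[OF \<psi>] by blast
  note g = spred_sem[OF Or.prems]
  show ?case
    using ab is_join_sub[OF carrier_in_U * g[unfolded sem.simps]] sub_in_Sub[OF carrier_in_U g] Im_sub_eq[OF carrier_in_U g]
    unfolding interp.simps sem.simps by blast
next
  case (Imp \<phi> \<psi>)
  have \<phi>: "in_context \<phi> n" and \<psi>: "in_context \<psi> n" using Imp.prems by simp_all
  obtain a b where ab: "itp \<phi> n a" "itp \<psi> n b"
    and *: "a \<in> Sub C (Pw n)" "b \<in> Sub C (Pw n)" "pred_eq (carrier n) (Im a) (\<lambda>x. sem \<phi> (dec n x))"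
      "pred_eq (carrier n) (Im b) (\<lambda>x. sem \<psi> (dec n x))"
    using Imp.IH(1)[OF \<phi>] Imp.IH(2)[OF \<psi>] by blast
  note g = spred_sem[OF Imp.prems]
  show ?case
    using ab is_implication_sub[OF carrier_in_U * g[unfolded sem.simps]] sub_in_Sub[OF carrier_in_U g] Im_sub_eq[OF carrier_in_U g]
    unfolding interp.simps sem.simps by blast
next
  case (Forall \<phi>)
  have "in_context \<phi> (Suc n)" using Forall.prems by simp
  then obtain a where a: "itp \<phi> (Suc n) a" "a \<in> Sub C (Pw (Suc n))"
    "pred_eq (carrier (Suc n)) (Im a) (\<lambda>x. sem \<phi> (dec (Suc n) x))"
    using Forall.IH by blast
  let ?q = "reix_ar (Suc n) n Suc" and ?g = "\<lambda>x. sem (Forall \<phi>) (dec n x)"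
  have g: "spred A (carrier n) (en n) ?g" by (rule spred_sem[OF Forall.prems])
  have "is_weakening C Pw proj n ?q"
    unfolding is_weakening_def using reix_ar_hom[of n Suc "Suc n"] proj_reix[of n Suc "Suc n"] by simp
  moreover have "is_forall C ?q a (sub (carrier n) (en n) ?g)"
    unfolding reix_ar_def
  proof (rule is_forall_sub[OF carrier_in_U carrier_in_U _ a(2) g])
    show "frel A (carrier (Suc n)) (en (Suc n)) (carrier n) (en n) (reix_rel (Suc n) n Suc)"
      by (rule frel_reix) simp
    fix R assume R: "spred A (carrier n) (en n) R"
    have "entails A (carrier n) R ?g \<longleftrightarrow> entails A (tup W n) (\<lambda>l. R (enc l)) (\<lambda>l. INF w\<in>W. sem \<phi> (w # l))"
      unfolding entails_carrier_left by (simp add: entails_def)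
    also have "\<dots> \<longleftrightarrow> entails A (tup W (Suc n)) (\<lambda>l. R (enc (tl l))) (sem \<phi>)"
      unfolding entails_all_iff tup_Suc entails_image by simp
    also have "\<dots> \<longleftrightarrow> entails A (carrier (Suc n)) (\<lambda>x. R (enc (tl (dec (Suc n) x)))) (\<lambda>x. sem \<phi> (dec (Suc n) x))"
      by (rule entails_carrier[symmetric])
    also have "\<dots> \<longleftrightarrow> entails A (carrier (Suc n)) (wk n R) (Im a)"
      by (intro entails_pred_eq pred_eq_sym[OF a(3)] pred_eq_sym[OF pb_weakening[OF R]])
    finally show "entails A (carrier n) R ?g \<longleftrightarrow> \<dots>" .
  qed
  ultimately show ?case
    using a(1) sub_in_Sub[OF carrier_in_U g] Im_sub_eq[OF carrier_in_U g] unfolding interp.simps by blast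
next
  case (Exists \<phi>)
  have "in_context \<phi> (Suc n)" using Exists.prems by simp
  then obtain a where a: "itp \<phi> (Suc n) a" "a \<in> Sub C (Pw (Suc n))"
    "pred_eq (carrier (Suc n)) (Im a) (\<lambda>x. sem \<phi> (dec (Suc n) x))"
    using Exists.IH by blast
  let ?q = "reix_ar (Suc n) n Suc" and ?g = "\<lambda>x. sem (Exists \<phi>) (dec n x)"
  have g: "spred A (carrier n) (en n) ?g" by (rule spred_sem[OF Exists.prems])
  have "is_weakening C Pw proj n ?q"
    unfolding is_weakening_def using reix_ar_hom[of n Suc "Suc n"] proj_reix[of n Suc "Suc n"] by simp
  moreover have "is_exists C ?q a (sub (carrier n) (en n) ?g)"
    unfolding reix_ar_def
  proof (rule is_exists_sub[OF carrier_in_U carrier_in_U _ a(2) g])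
    show "frel A (carrier (Suc n)) (en (Suc n)) (carrier n) (en n) (reix_rel (Suc n) n Suc)"
      by (rule frel_reix) simp
    fix R assume R: "spred A (carrier n) (en n) R"
    have "entails A (carrier n) ?g R \<longleftrightarrow> entails A (tup W n) (\<lambda>l. ex W (\<lambda>w. sem \<phi> (w # l))) (\<lambda>l. R (enc l))"
      unfolding entails_carrier_left by (simp add: entails_def)
    also have "\<dots> \<longleftrightarrow> entails A (tup W (Suc n)) (sem \<phi>) (\<lambda>l. R (enc (tl l)))"
      unfolding entails_ex_iff tup_Suc entails_image by simp
    also have "\<dots> \<longleftrightarrow> entails A (carrier (Suc n)) (\<lambda>x. sem \<phi> (dec (Suc n) x)) (\<lambda>x. R (enc (tl (dec (Suc n) x))))"
      by (rule entails_carrier[symmetric])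
    also have "\<dots> \<longleftrightarrow> entails A (carrier (Suc n)) (Im a) (wk n R)"
      by (intro entails_pred_eq pred_eq_sym[OF a(3)] pred_eq_sym[OF pb_weakening[OF R]])
    finally show "entails A (carrier n) ?g R \<longleftrightarrow> \<dots>" .
  qed
  ultimately show ?case
    using a(1) sub_in_Sub[OF carrier_in_U g] Im_sub_eq[OF carrier_in_U g] unfolding interp.simps by blast
qed

theorem hosts_model_if_sem:
  assumes "\<And>\<phi>. \<phi> \<in> T \<Longrightarrow> in_context \<phi> 0" "\<And>\<phi>. \<phi> \<in> T \<Longrightarrow> sem \<phi> [] \<in> \<Sigma>"
  shows "hosts_model C T"
  unfolding hosts_model_def
proof (rule bexI[of _ "ob W E"], rule exI[of _ Pw], rule exI[of _ proj], rule exI[of _ mem_sub],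
    intro conjI allI ballI)
  show "ob W E \<in> Obj C" by (simp add: Obj_iff W_in_U W.per_axioms)
  show "is_power C (ob W E) n (Pw n) (proj n)" for n by (rule is_power)
  show "mem_sub \<in> Sub C (Pw 2)" by (rule mem_sub)
  fix \<phi> assume \<phi>: "\<phi> \<in> T"
  obtain s where s: "itp \<phi> 0 s" "s \<in> Sub C (Pw 0)"
    "pred_eq (carrier 0) (Im s) (\<lambda>x. sem \<phi> (dec 0 x))"
    using interp_exists[OF assms(1)[OF \<phi>]] by blast
  \<comment> \<open>The carrier of the zeroth power consists of the code of the empty tuple, so this
    meet is the value of the sentence.\<close>
  have "(INF x\<in>carrier 0. sem \<phi> (dec 0 x)) \<in> \<Sigma>"
    using assms(2)[OF \<phi>] by (subst INF_carrier) (simp add: tup_0)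
  then have "entails A (carrier 0) f (\<lambda>x. sem \<phi> (dec 0 x))" for f by (rule entails_if_sep)
  then have "entails A (carrier 0) f (Im s)" for f
    using s(3) entails_trans unfolding pred_eq_def by blast
  then have "is_top C (Pw 0) s"
    unfolding is_top_def using s(2) by (simp add: sub_le_iff)
  then show "\<exists>s. itp \<phi> 0 s \<and> is_top C (Pw 0) s" using s(1) by blast
qed

end

section \<open>A universe of names\<close>

text \<open>An element \<open>x\<close> of \<open>W\<close> is a name: its potential elements are the names in \<open>S x\<close>, and \<open>d x z\<close> is
  the extent to which \<open>z\<close> belongs to \<open>x\<close>. The axioms only use that \<open>small\<close> sets of names, with arbitrary
  weights, are again named.\<close>

lemma alg_ex_cong: "I = J \<Longrightarrow> (\<And>i. i \<in> J \<Longrightarrow> f i = g i) \<Longrightarrow> alg_ex A I f = alg_ex A J g"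
  unfolding alg_ex_def by (simp cong: INF_cong)

locale names = topos A U for A :: "'a::complete_lattice impl_alg" and U :: "'u set set" +
  fixes W :: "'u set" and S :: "'u \<Rightarrow> 'u set" and d :: "'u \<Rightarrow> 'u \<Rightarrow> 'a" and small :: "'u set \<Rightarrow> bool"
  assumes W_U: "W \<in> U" and W_inf: "infinite W"
    and S_subset: "x \<in> W \<Longrightarrow> S x \<subseteq> W"
    and S_small: "x \<in> W \<Longrightarrow> small (S x)"
    and S_wf: "wf {(z, x). x \<in> W \<and> z \<in> S x}"
    and name_exists: "X \<subseteq> W \<Longrightarrow> small X \<Longrightarrow> \<exists>y\<in>W. S y = X \<and> (\<forall>z\<in>X. d y z = f z)"
    and small_empty: "small {}"
    and small_insert: "small X \<Longrightarrow> small (insert x X)"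
    and small_UN: "small X \<Longrightarrow> (\<And>x. x \<in> X \<Longrightarrow> small (G x)) \<Longrightarrow> small (\<Union>x\<in>X. G x)"
    and small_nat: "small (range (h :: nat \<Rightarrow> 'u))"
    and small_values: "small (range (k :: 'a \<Rightarrow> 'u))"
    and small_weights: "small X \<Longrightarrow> small (F ` (X \<rightarrow>\<^sub>E (UNIV :: 'a set)))"
begin

lemma S_in: "z \<in> S x \<Longrightarrow> x \<in> W \<Longrightarrow> z \<in> W"
  using S_subset by blast

text \<open>Both clauses call \<open>E\<close> with a potential element of \<open>x\<close> on the
  left, so recursion on the left argument alone is well-founded and no recursion on pairs arises.
  The price is that the second clause has \<open>E z u\<close> where membership of \<open>u\<close>
  in \<open>x\<close> would have \<open>E u z\<close>.\<close>

definition E :: "'u \<Rightarrow> 'u \<Rightarrow> 'a" where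
  "E = wfrec {(z, x). x \<in> W \<and> z \<in> S x} (\<lambda>E x y.
     (INF z\<in>S x. d x z \<leadsto> ex (S y) (\<lambda>u. d y u \<otimes> E z u)) \<otimes>
     (INF u\<in>S y. d y u \<leadsto> ex (S x) (\<lambda>z. d x z \<otimes> E z u)))"

definition mem :: "'u \<Rightarrow> 'u \<Rightarrow> 'a" where
  "mem x y = ex (S y) (\<lambda>z. d y z \<otimes> E x z)"

lemma E_eq:
  assumes "x \<in> W"
  shows "E x y = (INF z\<in>S x. d x z \<leadsto> mem z y) \<otimes> (INF u\<in>S y. d y u \<leadsto> ex (S x) (\<lambda>z. d x z \<otimes> E z u))"
  unfolding mem_def
  by (subst E_def, subst wfrec[OF S_wf], fold E_def)
    (simp add: cut_apply assms cong: alg_ex_cong INF_cong)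

lemma le_E: "\<lbrakk>s \<le> (INF z\<in>S x. d x z \<leadsto> mem z y); t \<le> (INF u\<in>S y. d y u \<leadsto> ex (S x) (\<lambda>z. d x z \<otimes> E z u)); x \<in> W\<rbrakk>
    \<Longrightarrow> pr s t \<le> E x y"
  by (simp add: E_eq pr_le)

lemma E_left: "\<lbrakk>u \<le> E x y; v \<le> d x z; z \<in> S x; x \<in> W\<rbrakk> \<Longrightarrow> p1 u \<cdot> v \<le> ex (S y) (\<lambda>w. d y w \<otimes> E z w)"
  by (rule app_le, rule le_INF_D[of _ "\<lambda>z. d x z \<leadsto> ex (S y) (\<lambda>w. d y w \<otimes> E z w)"], rule p1_le)
    (simp_all add: E_eq mem_def)

lemma E_right: "\<lbrakk>u \<le> E x y; v \<le> d y w; w \<in> S y; x \<in> W\<rbrakk> \<Longrightarrow> p2 u \<cdot> v \<le> ex (S x) (\<lambda>z. d x z \<otimes> E z w)"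
  by (rule app_le, rule le_INF_D[of _ "\<lambda>w. d y w \<leadsto> ex (S x) (\<lambda>z. d x z \<otimes> E z w)"], rule p2_le)
    (simp_all add: E_eq)

lemma names_induct:
  assumes "\<And>x u. u \<le> (INF z\<in>S x. p z) \<Longrightarrow> x \<in> W \<Longrightarrow> f u \<le> p x" and "x \<in> W"
  shows "fixpt f \<le> p x"
  by (rule fixpt_le[OF S_wf _ assms(2)], rule assms(1)) (auto intro!: INF_greatest dest: S_in)

lemma E_refl_sep: "(INF x\<in>W. E x x) \<in> \<Sigma>"
  by (rule sepI, rule INF_greatest, rule names_induct[of "\<lambda>x. E x x"], rule le_E, unfold mem_def,
      (rule seqI)+, rule wit_le, rule pr_le, assumption, erule le_INF_D, assumption+,
      (rule seqI)+, rule wit_le, rule pr_le, assumption, erule le_INF_D, assumption+, intro definables)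

text \<open>Induction on the left name, for all right names at once. A witness in \<open>S x\<close>
  for an element of \<open>y\<close> comes from the right-hand clause, and the induction hypothesis
  at that witness turns its equality around.\<close>

lemma E_sym_sep: "(INF x\<in>W. INF y\<in>W. E x y \<leadsto> E y x) \<in> \<Sigma>"
proof -
  have IH: "u \<cdot> v \<le> E y z" if "u \<le> (INF z\<in>S x. INF y\<in>W. E z y \<leadsto> E y z)" "v \<le> E z y" "z \<in> S x" "y \<in> W" for u v x y z
    using that unfolding le_INF_iff le_arr_iff by blast
  show ?thesis
    by (rule sepI, rule INF_greatest, rule names_induct[of "\<lambda>x. INF y\<in>W. E x y \<leadsto> E y x"], (rule seqI)+,
        rule le_E, unfold mem_def, (rule seqI)+, rule unwit_le, rule E_right, assumption+, erule le_cnjE, rule wit_le,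
        rule pr_le, assumption, rule IH, assumption+, erule S_in, assumption+,
        (rule seqI)+, rule unwit_le, rule E_left, assumption+, erule le_cnjE, rule wit_le,
        rule pr_le, assumption, rule IH, assumption+, erule S_in, assumption+, intro definables)
qed

lemma E_trans_sep: "(INF x\<in>W. INF y\<in>W. INF w\<in>W. E x y \<leadsto> E y w \<leadsto> E x w) \<in> \<Sigma>"
proof -
  have IH: "u \<cdot> v \<cdot> v' \<le> E z w" if "u \<le> (INF z\<in>S x. INF y\<in>W. INF w\<in>W. E z y \<leadsto> E y w \<leadsto> E z w)" "v \<le> E z y" "v' \<le> E y w"
    "z \<in> S x" "y \<in> W" "w \<in> W" for u v v' x y z w
    using that unfolding le_INF_iff le_arr_iff by blast
  show ?thesis
    by (rule sepI, rule INF_greatest, rule names_induct[of "\<lambda>x. INF y\<in>W. INF w\<in>W. E x y \<leadsto> E y w \<leadsto> E x w"],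
        (rule seqI)+, rule le_E, unfold mem_def,
        (rule seqI)+, rule unwit_le, rule E_left, assumption, assumption+, erule le_cnjE,
        rule unwit_le, rule E_left, assumption+, erule le_cnjE, rule wit_le,
        rule pr_le, assumption, rule IH, assumption+, erule S_in, assumption, erule S_in, assumption+,
        (rule seqI)+, rule unwit_le, rule E_right, assumption+, erule le_cnjE,
        rule unwit_le, rule E_right, assumption+, erule le_cnjE, rule wit_le,
        rule pr_le, assumption, rule IH, assumption+, erule S_in, assumption, erule S_in, assumption+,
        intro definables)
qed

sublocale WE: per A W E
  by unfold_locales (rule E_sym_sep E_trans_sep)+

lemma E_mem_cong_sep: "(INF x\<in>W. INF x'\<in>W. INF y\<in>W. INF y'\<in>W. E x x' \<leadsto> E y y' \<leadsto> mem x y \<leadsto> mem x' y') \<in> \<Sigma>"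
  unfolding mem_def
  by (rule sepI, (rule seqI | erule unwit_le le_cnjE)+, rule unwit_le, rule E_left, assumption+, erule le_cnjE,
      rule wit_le, rule pr_le, assumption, rule WE.trans[OF WE.trans[OF WE.sym]], (assumption | erule S_in)+, intro definables WE.seps)

sublocale set_structure A U W E mem
  by unfold_locales (rule W_U W_inf E_refl_sep E_mem_cong_sep)+

end

section \<open>The axioms hold in the universe of names\<close>

context set_structure begin

text \<open>The prefix \<open>k\<close> holds the entries of the variables bound so far and grows
  when the induction enters a quantifier.\<close>

lemma sem_insert_var: "sem (insert_var (length k) \<phi>) (k @ w # l) = sem \<phi> (k @ l)"
proof (induction \<phi> arbitrary: k)
  case (Forall \<phi>)
  from Forall[of "_ # k"] show ?case by simp
next
  case (Exists \<phi>)
  from Exists[of "_ # k"] show ?case by simp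
qed (auto simp: nth_append Suc_diff_le)

lemma sem_closure: "l \<in> tup W m \<Longrightarrow> (INF k\<in>tup W (n + m). sem \<phi> k) \<le> sem ((Forall ^^ n) \<phi>) l"
proof (induction n arbitrary: l m)
  case (Suc n)
  from Suc.IH[OF Cons_tup[OF _ Suc.prems]] show ?case by (auto intro!: INF_greatest)
qed (auto intro: INF_lower)

lemma closure_sep: "(INF l\<in>tup W n. sem \<phi> l) \<in> \<Sigma> \<Longrightarrow> sem (closure n \<phi>) [] \<in> \<Sigma>"
  unfolding closure_def using sem_closure[where l = "[]" and m = 0 and n = n and \<phi> = \<phi>] by (auto simp: tup_0 elim: sep_up)

lemma in_context_closure: "in_context \<phi> n \<Longrightarrow> in_context (closure n \<phi>) 0"
proof -
  have "in_context \<phi> (n + m) \<Longrightarrow> in_context ((Forall ^^ n) \<phi>) m" for m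
    by (induction n arbitrary: m) auto
  then show "in_context \<phi> n \<Longrightarrow> in_context (closure n \<phi>) 0" by (simp add: closure_def)
qed

lemma in_context_insert_var: "in_context \<phi> n \<Longrightarrow> in_context (insert_var k \<phi>) (Suc n)"
  by (induction \<phi> arbitrary: n k) auto

lemma el_update:
  assumes "k < n"
  obtains t where "t \<in> \<Sigma>" and "\<And>l x x' u. u \<le> E x x' \<Longrightarrow> l \<in> tup W n \<Longrightarrow> t \<cdot> u \<le> el n (l[k := x]) (l[k := x'])"
proof -
  have "entails A (UNIV \<times> UNIV \<times> tup W n) (\<lambda>p. E (fst p) (fst (snd p)))
      (\<lambda>p. cj n (\<lambda>j. E ((snd (snd p))[k := fst p] ! j) ((snd (snd p))[k := fst (snd p)] ! j)))"
  proof (rule entails_cjI)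
    fix j assume j: "j < n"
    show "entails A (UNIV \<times> UNIV \<times> tup W n) (\<lambda>p. E (fst p) (fst (snd p)))
      (\<lambda>p. E ((snd (snd p))[k := fst p] ! j) ((snd (snd p))[k := fst (snd p)] ! j))"
    proof (cases "j = k")
      case True
      show ?thesis
        by (rule iffD1[OF entails_cong entails_refl]) (use True j in \<open>auto simp: tup_def\<close>)
    next
      case False
      have "entails A (UNIV \<times> UNIV \<times> tup W n) (\<lambda>p. E (fst p) (fst (snd p))) (\<lambda>p. E (snd (snd p) ! j) (snd (snd p) ! j))"
        unfolding entails_def INF_Times fst_conv snd_conv
        by (rule sepI, (rule seqI)+, rule E_refl, erule tup_nth[OF _ j], intro definables rrefl_sep)
      then show ?thesis using False by (simp cong: entails_cong)
    qed
  qed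
  then obtain t where t: "t \<in> \<Sigma>" "\<And>p u. u \<le> E (fst p) (fst (snd p)) \<Longrightarrow> p \<in> UNIV \<times> UNIV \<times> tup W n
      \<Longrightarrow> t \<cdot> u \<le> el n ((snd (snd p))[k := fst p]) ((snd (snd p))[k := fst (snd p)])"
    unfolding el_def using entailsE by blast
  have "t \<cdot> u \<le> el n (l[k := x]) (l[k := x'])" if "u \<le> E x x'" "l \<in> tup W n" for l x x' u
    using t(2)[of u "(x, x', l)"] that by simp
  then show thesis using that t(1) by blast
qed

text \<open>Extensionality of formulas in the form that the schemas use: one entry changes, and the
  realizer \<open>c\<close> is independent of all the parameters.\<close>

lemma sem_update:
  assumes "in_context \<phi> n" "k < n"
  obtains c where "c \<in> \<Sigma>" and "\<And>l x x' u v. \<lbrakk>u \<le> E x x'; v \<le> sem \<phi> (l[k := x]); l \<in> tup W n; x \<in> W; x' \<in> W\<rbrakk>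
      \<Longrightarrow> c \<cdot> u \<cdot> v \<le> sem \<phi> (l[k := x'])"
proof -
  obtain s where s: "s \<in> \<Sigma>" "\<And>l l' u v. \<lbrakk>u \<le> el n l l'; v \<le> sem \<phi> l; l \<in> tup W n; l' \<in> tup W n\<rbrakk>
      \<Longrightarrow> s \<cdot> u \<cdot> v \<le> sem \<phi> l'"
    using extD[OF ext_sem[OF assms(1)]] by (rule that)
  obtain t where t: "t \<in> \<Sigma>" "\<And>l x x' u. u \<le> E x x' \<Longrightarrow> l \<in> tup W n \<Longrightarrow> t \<cdot> u \<le> el n (l[k := x]) (l[k := x'])"
    using el_update[OF assms(2)] by blast
  have upd: "l \<in> tup W n \<Longrightarrow> x \<in> W \<Longrightarrow> l[k := x] \<in> tup W n" for l x
    using set_update_subset_insert[of l k x] by (auto simp: tup_def)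
  let ?c = "lam (\<lambda>u. lam (\<lambda>v. s \<cdot> (t \<cdot> u) \<cdot> v))"
  show thesis
  proof (rule that[of ?c])
    show "?c \<in> \<Sigma>" by (rule sepI[OF order_refl], intro definables s(1) t(1))
    fix l x x' u v assume *: "u \<le> E x x'" "v \<le> sem \<phi> (l[k := x])" "l \<in> tup W n" "x \<in> W" "x' \<in> W"
    have "?c \<cdot> u \<cdot> v \<le> s \<cdot> (t \<cdot> u) \<cdot> v"
      by (rule order_trans[OF app_mono[OF beta order_refl]]) (rule beta)
    also have "\<dots> \<le> sem \<phi> (l[k := x'])" by (intro s(2)[OF t(2) *(2)] * upd)
    finally show "?c \<cdot> u \<cdot> v \<le> sem \<phi> (l[k := x'])" .
  qed
qed

end

section \<open>Comprehension for classes covered by a small set\<close>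

context names begin

definition nm :: "'u set \<Rightarrow> ('u \<Rightarrow> 'a) \<Rightarrow> 'u" where
  "nm X f = (SOME y. y \<in> W \<and> S y = X \<and> (\<forall>z\<in>X. d y z = f z))"

lemma nm:
  assumes "X \<subseteq> W" "small X"
  shows nm_in: "nm X f \<in> W" and S_nm: "S (nm X f) = X" and d_nm: "z \<in> X \<Longrightarrow> d (nm X f) z = f z"
  using someI_ex[of "\<lambda>y. y \<in> W \<and> S y = X \<and> (\<forall>z\<in>X. d y z = f z)"] name_exists[OF assms, of f]
  unfolding nm_def by blast+

lemma mem_nm:
  assumes "X \<subseteq> W" "small X"
  shows "mem x (nm X f) = ex X (\<lambda>z. f z \<otimes> E x z)"
  unfolding mem_def S_nm[OF assms] by (rule alg_ex_cong) (simp_all add: d_nm[OF assms])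

text \<open>The candidate set \<open>X i\<close> may overshoot, since the weights \<open>f i\<close>
  cut it down. If \<open>z\<close> belongs to the class, it equals a candidate by the bound, and
  extensionality moves the weight from \<open>z\<close> to that candidate. The index
  \<open>i\<close> gathers the parameters, so one realizer serves them all.\<close>

lemma comprehension:
  assumes X: "\<And>i. i \<in> I \<Longrightarrow> X i \<subseteq> W" "\<And>i. i \<in> I \<Longrightarrow> small (X i)"
    and ext: "(INF i\<in>I. INF z\<in>W. INF z'\<in>W. E z z' \<leadsto> f i z \<leadsto> f i z') \<in> \<Sigma>" (is "?c \<in> _")
    and bound: "(INF i\<in>I. INF z\<in>W. f i z \<leadsto> ex (X i) (E z)) \<in> \<Sigma>" (is "?b \<in> _")
  shows "(INF i\<in>I. INF z\<in>W. (mem z (nm (X i) (f i)) \<leadsto> f i z) \<otimes> (f i z \<leadsto> mem z (nm (X i) (f i)))) \<in> \<Sigma>"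
    and "(INF i\<in>I. ex W (\<lambda>b. INF z\<in>W. (mem z b \<leadsto> f i z) \<otimes> (f i z \<leadsto> mem z b))) \<in> \<Sigma>"
proof -
  have c: "?c \<cdot> u \<cdot> v \<le> f i z'" if "u \<le> E z z'" "v \<le> f i z" "i \<in> I" "z \<in> W" "z' \<in> W" for i u v z z'
    using order_refl[of ?c] that unfolding le_INF_iff le_arr_iff by blast
  have b: "?b \<cdot> u \<le> ex (X i) (E z)" if "u \<le> f i z" "i \<in> I" "z \<in> W" for i u z
    using order_refl[of ?b] that unfolding le_INF_iff le_arr_iff by blast
  have XW: "z \<in> X i \<Longrightarrow> i \<in> I \<Longrightarrow> z \<in> W" for z i using X(1) by blast
  have "(INF i\<in>I. INF z\<in>W. (ex (X i) (\<lambda>v. f i v \<otimes> E z v) \<leadsto> f i z) \<otimes> (f i z \<leadsto> ex (X i) (\<lambda>v. f i v \<otimes> E z v))) \<in> \<Sigma>"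
    by (rule sepI, (rule seqI pr_le)+, (erule unwit_le le_cnjE)+, rule c, rule WE.sym, assumption+, erule XW, assumption+,
        erule XW, assumption+, rule seqI, rule unwit_le, erule b, assumption+, rule wit_le, rule pr_le, rule c, assumption+,
        erule XW, assumption+, intro definables WE.seps ext bound)
  then show *: "(INF i\<in>I. INF z\<in>W. (mem z (nm (X i) (f i)) \<leadsto> f i z) \<otimes> (f i z \<leadsto> mem z (nm (X i) (f i)))) \<in> \<Sigma>"
    (is "?t \<in> _") by (simp add: mem_nm[OF X] cong: INF_cong)
  show "(INF i\<in>I. ex W (\<lambda>b. INF z\<in>W. (mem z b \<leadsto> f i z) \<otimes> (f i z \<leadsto> mem z b))) \<in> \<Sigma>"
  proof (rule sepI[of "wit ?t"], rule INF_greatest)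
    fix i assume i: "i \<in> I"
    have "?t \<le> (INF z\<in>W. (mem z (nm (X i) (f i)) \<leadsto> f i z) \<otimes> (f i z \<leadsto> mem z (nm (X i) (f i))))"
      using i by (rule INF_lower)
    then show "wit ?t \<le> ex W (\<lambda>b. INF z\<in>W. (mem z b \<leadsto> f i z) \<otimes> (f i z \<leadsto> mem z b))"
      by (rule wit_le[where i = "nm (X i) (f i)"]) (intro nm_in X i)
  qed (intro definables *)
qed

lemma memD: "u \<le> mem x y \<Longrightarrow> u \<le> ex (S y) (\<lambda>z. d y z \<otimes> E x z)"
  by (simp add: mem_def)

lemma mem_if_d: "\<lbrakk>v \<le> d y z; z \<in> S y; y \<in> W\<rbrakk> \<Longrightarrow> wit (pr v rrefl) \<le> mem z y"
  unfolding mem_def by (rule wit_le, rule pr_le, assumption, rule E_refl, erule S_in)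

text \<open>Membership in \<open>x\<close> provides \<open>E z t\<close> for a potential element
  \<open>t\<close>, whereas the second clause of \<open>E\<close> asks for \<open>E t z\<close>; the
  symmetry realizer is applied to the second component of each witness.\<close>

definition mkE where "mkE u v = pr u (lam (\<lambda>w. unwit (v \<cdot> w) (\<lambda>q. wit (pr (p1 q) (WE.rsym \<cdot> p2 q)))))"

lemma definable_mkE:
  assumes "definable f" "definable g"
  shows "definable (\<lambda>\<rho>. mkE (f \<rho>) (g \<rho>))"
  unfolding mkE_def using definable_shift[OF assms(2)] assms(1)
  by (intro definable_pr definable_lam definable_unwit definable_wit definable_app definable_p1 definable_p2 definable_var
      definable_const WE.seps)

lemma mkE_le:
  assumes "u \<le> (INF z\<in>S x. d x z \<leadsto> mem z y)" "v \<le> (INF z\<in>S y. d y z \<leadsto> mem z x)" "x \<in> W" "y \<in> W"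
  shows "mkE u v \<le> E x y"
proof -
  have v: "v \<cdot> w \<le> ex (S x) (\<lambda>t. d x t \<otimes> E z t)" if "w \<le> d y z" "z \<in> S y" for w z
    using assms(2) that unfolding mem_def le_INF_iff le_arr_iff by blast
  show ?thesis unfolding mkE_def
    by (rule le_E[OF assms(1) _ assms(3)], (rule seqI)+, rule unwit_le, rule v, assumption+, erule le_cnjE,
        rule wit_le, rule pr_le, assumption, rule WE.sym, assumption, (erule S_in, rule assms)+, assumption)
qed

lemma le_iffD:
  assumes "u \<le> (INF z\<in>Z. (f z \<leadsto> g z) \<otimes> (g z \<leadsto> f z))" "z \<in> Z"
  shows "v \<le> f z \<Longrightarrow> p1 u \<cdot> v \<le> g z" "v \<le> g z \<Longrightarrow> p2 u \<cdot> v \<le> f z"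
  using le_INF_D[OF assms] by (blast intro: app_le p1_le p2_le)+

section \<open>The axioms obtained from comprehension and induction on names\<close>

lemma Extensionality: "sem Extensionality_Axiom [] \<in> \<Sigma>"
proof -
  have "(INF x\<in>W. INF y\<in>W. (INF z\<in>W. (mem z x \<leadsto> mem z y) \<otimes> (mem z y \<leadsto> mem z x)) \<leadsto> E x y) \<in> \<Sigma>"
    by (rule sepI, (rule seqI)+, rule mkE_le,
        (rule seqI)+, rule le_iffD(1)[of _ "\<lambda>z. mem z _" "\<lambda>z. mem z _" W], assumption, erule S_in, assumption, rule mem_if_d,
        assumption+,
        (rule seqI)+, rule le_iffD(2)[of _ "\<lambda>z. mem z _" "\<lambda>z. mem z _" W], assumption, erule S_in, assumption, rule mem_if_d,
        assumption+, intro definable_mkE definables rrefl_sep)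
  then show ?thesis by (simp add: Extensionality_Axiom_def Iff_def)
qed

lemma Pairing: "sem Pairing_Axiom [] \<in> \<Sigma>"
proof -
  have "(INF p\<in>W \<times> W. ex W (\<lambda>b. INF z\<in>W. (mem z b \<leadsto> E z (fst p) \<oplus> E z (snd p)) \<otimes> (E z (fst p) \<oplus> E z (snd p) \<leadsto> mem z b))) \<in> \<Sigma>"
  proof (rule comprehension(2)[where X = "\<lambda>p. {fst p, snd p}"])
    show "(INF p\<in>W \<times> W. INF z\<in>W. INF z'\<in>W. E z z' \<leadsto> E z (fst p) \<oplus> E z (snd p) \<leadsto> E z' (fst p) \<oplus> E z' (snd p)) \<in> \<Sigma>"
      unfolding INF_Times fst_conv snd_conv
      by (rule sepI, (rule seqI)+, erule cases_le, rule inl_le, rule WE.trans[OF WE.sym], assumption+,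
          rule inr_le, rule WE.trans[OF WE.sym], assumption+, intro definables WE.seps)
    show "(INF p\<in>W \<times> W. INF z\<in>W. E z (fst p) \<oplus> E z (snd p) \<leadsto> ex {fst p, snd p} (E z)) \<in> \<Sigma>"
      unfolding INF_Times fst_conv snd_conv
      by (rule sepI, (rule seqI)+, erule cases_le, erule wit_le, simp, erule wit_le, simp, intro definables)
  qed (auto intro: small_insert small_empty)
  then show ?thesis by (simp add: Pairing_Axiom_def Iff_def INF_Times)
qed

text \<open>If \<open>z\<close> belongs to a member \<open>y\<close> of \<open>a\<close>, then
  \<open>y\<close> equals some \<open>v\<close> in \<open>S a\<close>, so \<open>z\<close> belongs
  to \<open>v\<close> and equals a name in \<open>S v\<close>. Potential elements of potential
  elements are therefore candidates enough.\<close>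

lemma Union: "sem Union_Axiom [] \<in> \<Sigma>"
proof -
  have "(INF a\<in>W. ex W (\<lambda>b. INF z\<in>W. (mem z b \<leadsto> ex W (\<lambda>y. mem y a \<otimes> mem z y)) \<otimes> (ex W (\<lambda>y. mem y a \<otimes> mem z y) \<leadsto> mem z b))) \<in> \<Sigma>"
  proof (rule comprehension(2)[where X = "\<lambda>a. \<Union>v\<in>S a. S v"])
    show "(\<Union>v\<in>S a. S v) \<subseteq> W" if "a \<in> W" for a using that S_in by blast
    show "small (\<Union>v\<in>S a. S v)" if "a \<in> W" for a
      by (rule small_UN[OF S_small[OF that]], rule S_small, erule S_in, rule that)
    show "(INF a\<in>W. INF z\<in>W. INF z'\<in>W. E z z' \<leadsto> ex W (\<lambda>y. mem y a \<otimes> mem z y) \<leadsto> ex W (\<lambda>y. mem y a \<otimes> mem z' y)) \<in> \<Sigma>"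
      by (rule sepI, (rule seqI | erule unwit_le le_cnjE)+, rule wit_le, rule pr_le, assumption, rule mem_cong,
          assumption, erule E_refl, assumption+, intro definables rmem_sep rrefl_sep)
    have in_UN: "t \<in> S v \<Longrightarrow> v \<in> S a \<Longrightarrow> t \<in> (\<Union>v\<in>S a. S v)" for t v a by blast
    show "(INF a\<in>W. INF z\<in>W. ex W (\<lambda>y. mem y a \<otimes> mem z y) \<leadsto> ex (\<Union>v\<in>S a. S v) (E z)) \<in> \<Sigma>"
      by (rule sepI, (rule seqI | erule unwit_le le_cnjE)+, rule unwit_le, erule memD,
          erule le_cnjE, rule unwit_le, rule memD, rule mem_cong, erule E_refl, assumption+,
          erule S_in, assumption, erule le_cnjE, erule wit_le, erule in_UN, assumption, intro definables rmem_sep rrefl_sep)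
  qed
  then show ?thesis by (simp add: Union_Axiom_def Iff_def)
qed

text \<open>Up to equality every subset of \<open>a\<close> has the potential elements of
  \<open>a\<close>, only with other weights. The candidates are thus indexed by the functions from
  \<open>S a\<close> to the algebra, of which there is a small set.\<close>

lemma Powerset: "sem Powerset_Axiom [] \<in> \<Sigma>"
proof -
  let ?X = "\<lambda>a. nm (S a) ` (S a \<rightarrow>\<^sub>E UNIV)"
  have "(INF a\<in>W. ex W (\<lambda>b. INF z\<in>W. (mem z b \<leadsto> (INF y\<in>W. mem y z \<leadsto> mem y a)) \<otimes> ((INF y\<in>W. mem y z \<leadsto> mem y a) \<leadsto> mem z b))) \<in> \<Sigma>"
  proof (rule comprehension(2)[where X = ?X])
    show "?X a \<subseteq> W" if "a \<in> W" for a using nm_in[OF S_subset[OF that] S_small[OF that]] by blast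
    show "small (?X a)" if "a \<in> W" for a using that by (intro small_weights S_small)
    have D: "u \<cdot> v \<le> mem y a" if "u \<le> (INF y\<in>W. mem y z \<leadsto> mem y a)" "v \<le> mem y z" "y \<in> W" for u v y z a
      using that unfolding le_INF_iff le_arr_iff by blast
    show "(INF a\<in>W. INF z\<in>W. INF z'\<in>W. E z z' \<leadsto> (INF y\<in>W. mem y z \<leadsto> mem y a) \<leadsto> (INF y\<in>W. mem y z' \<leadsto> mem y a)) \<in> \<Sigma>"
      by (rule sepI, (rule seqI)+, rule D, assumption, rule mem_cong, erule E_refl, erule WE.sym, assumption+,
          intro definables rmem_sep rrefl_sep WE.seps)
    \<comment> \<open>The canonical copy of \<open>z\<close> inside \<open>a\<close>: each potential
      element of \<open>a\<close> is weighted by the extent of its membership in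
      \<open>z\<close>.\<close>
    define n where "n a z = nm (S a) (restrict (\<lambda>t. mem t z) (S a))" for a z
    have n: "n a z \<in> W" "n a z \<in> ?X a" "S (n a z) = S a" if "a \<in> W" for a z
      unfolding n_def using that S_nm[OF S_subset S_small] nm_in[OF S_subset S_small] by auto
    have d: "d (n a z) t = mem t z" if "a \<in> W" "t \<in> S a" for a z t
      unfolding n_def using that d_nm[OF S_subset S_small] by simp
    have mem_n: "wit (pr u v) \<le> mem t (n a z)" if "u \<le> mem s z" "v \<le> E t s" "s \<in> S a" "a \<in> W" for u v t s a z
      unfolding mem_def[of t] n(3)[OF that(4)] by (rule wit_le[of _ _ s], rule pr_le) (use that d in simp_all)
    have n_mem: "u \<le> mem t z" if "u \<le> d (n a z) t" "t \<in> S (n a z)" "a \<in> W" for u a z t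
      using that n(3) d by simp
    have "(INF a\<in>W. INF z\<in>W. (INF y\<in>W. mem y z \<leadsto> mem y a) \<leadsto> E z (n a z)) \<in> \<Sigma>"
      by (rule sepI, (rule seqI)+, rule mkE_le, (rule seqI)+, rule unwit_le,
          rule memD, rule D, assumption, rule mem_if_d, assumption+, erule S_in, assumption,
          erule le_cnjE, rule mem_n, rule mem_cong, assumption, erule E_refl, rule mem_if_d, assumption+,
          erule S_in, assumption, erule S_in, assumption+, (rule seqI)+, erule n_mem, assumption+, erule n(1),
          intro definable_mkE definables rmem_sep rrefl_sep)
    then obtain t where t: "t \<in> \<Sigma>" "t \<le> (INF a\<in>W. INF z\<in>W. (INF y\<in>W. mem y z \<leadsto> mem y a) \<leadsto> E z (n a z))"
      by (rule sepE)
    have t': "t \<cdot> u \<le> E z (n a z)" if "u \<le> (INF y\<in>W. mem y z \<leadsto> mem y a)" "a \<in> W" "z \<in> W" for u a z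
      using t(2) that unfolding le_INF_iff[of t] le_arr_iff[of t] by blast
    show "(INF a\<in>W. INF z\<in>W. (INF y\<in>W. mem y z \<leadsto> mem y a) \<leadsto> ex (?X a) (E z)) \<in> \<Sigma>"
      by (rule sepI, (rule seqI)+, rule wit_le, erule t', assumption+, erule n(2), intro definables t(1))
  qed
  then show ?thesis by (simp add: Powerset_Axiom_def Iff_def)
qed

lemma Separation:
  assumes "in_context \<phi> (n + 2)"
  shows "sem (closure n (Separation \<phi>)) [] \<in> \<Sigma>"
proof (rule closure_sep)
  obtain c where c: "c \<in> \<Sigma>" "\<And>l x x' u v. \<lbrakk>u \<le> E x x'; v \<le> sem \<phi> (l[0 := x]); l \<in> tup W (n + 2); x \<in> W; x' \<in> W\<rbrakk>
      \<Longrightarrow> c \<cdot> u \<cdot> v \<le> sem \<phi> (l[0 := x'])"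
    using sem_update[OF assms, of 0] by auto
  have c': "c \<cdot> u \<cdot> v \<le> sem \<phi> (x' # a # l)"
    if "u \<le> E x x'" "v \<le> sem \<phi> (x # a # l)" "l \<in> tup W n" "a \<in> W" "x \<in> W" "x' \<in> W" for u v x x' a l
    using c(2)[of u x x' v "x # a # l"] that by (simp add: Cons_tup)
  have "(INF p\<in>tup W n \<times> W. ex W (\<lambda>b. INF z\<in>W.
      (mem z b \<leadsto> mem z (snd p) \<otimes> sem \<phi> (z # snd p # fst p)) \<otimes> (mem z (snd p) \<otimes> sem \<phi> (z # snd p # fst p) \<leadsto> mem z b))) \<in> \<Sigma>"
  proof (rule comprehension(2)[where X = "\<lambda>p. S (snd p)"])
    show "(INF p\<in>tup W n \<times> W. INF z\<in>W. INF z'\<in>W. E z z' \<leadsto> mem z (snd p) \<otimes> sem \<phi> (z # snd p # fst p)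
        \<leadsto> mem z' (snd p) \<otimes> sem \<phi> (z' # snd p # fst p)) \<in> \<Sigma>"
      unfolding INF_Times fst_conv snd_conv
      by (rule sepI, (rule seqI | erule le_cnjE)+, rule pr_le, rule mem_cong, assumption, erule E_refl, assumption+,
          rule c', assumption+, intro definables rmem_sep rrefl_sep c(1))
    show "(INF p\<in>tup W n \<times> W. INF z\<in>W. mem z (snd p) \<otimes> sem \<phi> (z # snd p # fst p) \<leadsto> ex (S (snd p)) (E z)) \<in> \<Sigma>"
      unfolding INF_Times fst_conv snd_conv mem_def
      by (rule sepI, (rule seqI | erule unwit_le le_cnjE)+, rule wit_le, assumption+, intro definables)
  qed (auto dest: S_in S_small)
  moreover have "sem (insert_var (Suc 0) \<phi>) (z # b # a # l) = sem \<phi> (z # a # l)" for z b a l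
    using sem_insert_var[of "[z]"] by simp
  ultimately show "(INF l\<in>tup W n. sem (Separation \<phi>) l) \<in> \<Sigma>"
    by (simp add: Separation_def Iff_def INF_Times)
qed

text \<open>The fixed point supplies \<open>\<phi>\<close> at the potential elements of
  \<open>x\<close>. A member of \<open>x\<close> is only equal to one of these, and extensionality
  of \<open>\<phi>\<close> closes the gap.\<close>

lemma Mem_Induction:
  assumes "in_context \<phi> (n + 1)"
  shows "sem (closure n (Mem_Induction \<phi>)) [] \<in> \<Sigma>"
proof (rule closure_sep)
  obtain c where c: "c \<in> \<Sigma>" "\<And>l x x' u v. \<lbrakk>u \<le> E x x'; v \<le> sem \<phi> (l[0 := x]); l \<in> tup W (n + 1); x \<in> W; x' \<in> W\<rbrakk>
      \<Longrightarrow> c \<cdot> u \<cdot> v \<le> sem \<phi> (l[0 := x'])"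
    using sem_update[OF assms, of 0] by auto
  have c': "c \<cdot> u \<cdot> v \<le> sem \<phi> (x' # l)"
    if "u \<le> E x x'" "v \<le> sem \<phi> (x # l)" "l \<in> tup W n" "x \<in> W" "x' \<in> W" for u v x x' l
    using c(2)[of u x x' v "x # l"] that by (simp add: Cons_tup)
  have IH: "u \<le> sem \<phi> (z # l)" if "u \<le> (INF z\<in>S x. sem \<phi> (z # l))" "z \<in> S x" for u x z l
    using that by (rule le_INF_D)
  have D: "h \<cdot> u \<le> sem \<phi> (x # l)" if "h \<le> (INF x\<in>W. (INF y\<in>W. mem y x \<leadsto> sem \<phi> (y # l)) \<leadsto> sem \<phi> (x # l))"
    "u \<le> (INF y\<in>W. mem y x \<leadsto> sem \<phi> (y # l))" "x \<in> W" for h u x l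
    using that unfolding le_INF_iff[of h] le_arr_iff[of h] by blast
  have "(INF l\<in>tup W n. (INF x\<in>W. (INF y\<in>W. mem y x \<leadsto> sem \<phi> (y # l)) \<leadsto> sem \<phi> (x # l)) \<leadsto> (INF x\<in>W. sem \<phi> (x # l))) \<in> \<Sigma>"
    by (rule sepI, (rule seqI)+, rule names_induct[of "\<lambda>x. sem \<phi> (x # _)"], rule D, assumption,
        (rule seqI)+, rule unwit_le, erule memD, erule le_cnjE, rule c', erule WE.sym, assumption, erule S_in, assumption,
        erule IH, assumption+, erule S_in, assumption+, intro definables c(1) WE.seps)
  moreover have "sem (insert_var (Suc 0) \<phi>) (y # x # l) = sem \<phi> (y # l)" for y x l
    using sem_insert_var[of "[y]"] by simp
  ultimately show "(INF l\<in>tup W n. sem (Mem_Induction \<phi>) l) \<in> \<Sigma>"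
    by (simp add: Mem_Induction_def)
qed

end

section \<open>Infinity, Collection and excluded middle\<close>

context names begin

lemma mem_nm_top: "\<lbrakk>z \<in> X; X \<subseteq> W; small X\<rbrakk> \<Longrightarrow> wit (pr cK rrefl) \<le> mem z (nm X (\<lambda>_. top))"
  unfolding mem_nm by (rule wit_le[where i = z], rule pr_le, rule top_greatest) (auto intro: E_refl)

definition succ_name :: "'u \<Rightarrow> 'u" where
  "succ_name x = nm (insert x (S x)) (\<lambda>z. mem z x \<oplus> E z x)"

primrec nat_name :: "nat \<Rightarrow> 'u" where
  "nat_name 0 = nm {} (\<lambda>_. bot)"
| "nat_name (Suc n) = succ_name (nat_name n)"

lemma succ_name_in: "x \<in> W \<Longrightarrow> succ_name x \<in> W"
  unfolding succ_name_def by (intro nm_in small_insert S_small) (auto dest: S_in)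

lemma nat_name_in: "range nat_name \<subseteq> W"
proof -
  have "nat_name n \<in> W" for n
    by (induction n) (simp_all add: nm_in small_empty succ_name_in)
  then show ?thesis by blast
qed

lemma succ_name_range: "x \<in> range nat_name \<Longrightarrow> succ_name x \<in> range nat_name"
  by (elim imageE, simp only: nat_name.simps(2)[symmetric]) (rule rangeI)

lemma succ_name_sep:
  "(INF x\<in>W. INF z\<in>W. (mem z (succ_name x) \<leadsto> mem z x \<oplus> E z x) \<otimes> (mem z x \<oplus> E z x \<leadsto> mem z (succ_name x))) \<in> \<Sigma>"
  unfolding succ_name_def
proof (rule comprehension(1)[where X = "\<lambda>x. insert x (S x)" and f = "\<lambda>x z. mem z x \<oplus> E z x"])
  show "(INF x\<in>W. INF z\<in>W. INF z'\<in>W. E z z' \<leadsto> mem z x \<oplus> E z x \<leadsto> mem z' x \<oplus> E z' x) \<in> \<Sigma>"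
    by (rule sepI, (rule seqI)+, erule cases_le, rule inl_le, rule mem_cong, assumption, erule E_refl, assumption+,
        rule inr_le, rule WE.trans[OF WE.sym], assumption+, intro definables WE.seps rmem_sep rrefl_sep)
  show "(INF x\<in>W. INF z\<in>W. mem z x \<oplus> E z x \<leadsto> ex (insert x (S x)) (E z)) \<in> \<Sigma>"
    by (rule sepI, (rule seqI)+, erule cases_le, rule unwit_le, erule memD, erule le_cnjE, rule wit_le[of _ "E _"], assumption,
        erule insertI2, rule wit_le[of _ "E _"], assumption, rule insertI1, intro definables)
qed (auto dest: S_in S_small intro: small_insert)

lemma Infinity: "sem Infinity_Axiom [] \<in> \<Sigma>"
proof -
  let ?w = "nm (range nat_name) (\<lambda>_. top)"
  note w = nat_name_in small_nat[of nat_name]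
  obtain t where t: "t \<in> \<Sigma>" and "t \<le> (INF x\<in>W. INF z\<in>W. (mem z (succ_name x) \<leadsto> mem z x \<oplus> E z x)
      \<otimes> (mem z x \<oplus> E z x \<leadsto> mem z (succ_name x)))"
    using succ_name_sep by (rule sepE)
  then have le: "t \<le> (mem z (succ_name x) \<leadsto> mem z x \<oplus> E z x) \<otimes> (mem z x \<oplus> E z x \<leadsto> mem z (succ_name x))"
    if "x \<in> W" "z \<in> W" for x z
    using that unfolding le_INF_iff by blast
  have t1: "p1 t \<cdot> u \<le> mem z x \<oplus> E z x" if "u \<le> mem z (succ_name x)" "x \<in> W" "z \<in> W" for u x z
    using app_le[OF p1_le[OF le]] that by blast
  have t2: "p2 t \<cdot> u \<le> mem z (succ_name x)" if "u \<le> mem z x \<oplus> E z x" "x \<in> W" "z \<in> W" for u x z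
    using app_le[OF p2_le[OF le]] that by blast
  have in_w: "wit (pr cK rrefl) \<le> mem x ?w" if "x \<in> range nat_name" for x
    using that w by (rule mem_nm_top)
  have w_out: "u \<le> ex (range nat_name) (\<lambda>z. top \<otimes> E x z)" if "u \<le> mem x ?w" for u x
    using that by (simp add: mem_nm[OF w])
  \<comment> \<open>An empty set of potential elements lets a realizer of membership be eliminated
    into any type.\<close>
  have zero: "unwit u (\<lambda>v. v) \<le> c" if "u \<le> mem z (nat_name 0)" for u z c
    by (rule unwit_le[of _ "{}" "\<lambda>v. bot \<otimes> E z v"]) (use that in \<open>simp_all add: mem_nm small_empty\<close>)
  have nat_W: "x \<in> range nat_name \<Longrightarrow> x \<in> W" for x using nat_name_in by blast
  \<comment> \<open>A member \<open>x\<close> of \<open>?w\<close> is only equal to some numeral.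
    The successor of that numeral is the witness, and its description is transported to
    \<open>x\<close> along the equality.\<close>
  have "ex W (\<lambda>w. ex W (\<lambda>x. mem x w \<otimes> (INF z\<in>W. mem z x \<leadsto> bot)) \<otimes> (INF x\<in>W. mem x w \<leadsto>
      ex W (\<lambda>y. mem y w \<otimes> (INF z\<in>W. (mem z y \<leadsto> mem z x \<oplus> E z x) \<otimes> (mem z x \<oplus> E z x \<leadsto> mem z y))))) \<in> \<Sigma>"
    by (rule sepI, rule wit_le[where i = ?w], rule pr_le, rule wit_le[where i = "nat_name 0"], rule pr_le, rule in_w, rule rangeI,
        (rule seqI)+, erule zero, rule nat_W, rule rangeI,
        (rule seqI)+, rule unwit_le, erule w_out, erule le_cnjE, rule wit_le, rule pr_le, rule in_w, erule succ_name_range,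
        rule seqI, rule pr_le, rule seqI, rule cases_le, erule t1, erule nat_W, assumption,
        rule inl_le, rule mem_cong, erule E_refl, rule WE.sym, assumption+, erule nat_W, assumption+, erule nat_W, assumption,
        rule inr_le, rule WE.trans, assumption, rule WE.sym, (assumption | erule nat_W)+,
        rule seqI, rule t2, erule cases_le, rule inl_le, rule mem_cong, erule E_refl, assumption+, erule nat_W,
        rule inr_le, rule WE.trans, assumption+, erule nat_W, erule nat_W, assumption,
        rule succ_name_in, erule nat_W, rule nm_in, rule w, rule w,
        intro definables t cK_sep rrefl_sep rmem_sep WE.seps)
  then show ?thesis by (simp add: Infinity_Axiom_def Iff_def Neg_def)
qed

text \<open>The collecting name has weight \<open>top\<close> on all of \<open>Y l a\<close>, which
  is chosen from the potential elements of \<open>a\<close> without regard to realizers. A member of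
  \<open>a\<close> is equal to a potential element, and \<open>c\<close> exchanges the two at
  position 1 of the tuple.\<close>

lemma Collection:
  assumes "in_context \<phi> (n + 3)"
  shows "sem (closure n (Collection \<phi>)) [] \<in> \<Sigma>"
proof (rule closure_sep)
  obtain c where c: "c \<in> \<Sigma>" "\<And>l x x' u v. \<lbrakk>u \<le> E x x'; v \<le> sem \<phi> (l[1 := x]); l \<in> tup W (n + 3); x \<in> W; x' \<in> W\<rbrakk>
      \<Longrightarrow> c \<cdot> u \<cdot> v \<le> sem \<phi> (l[1 := x'])"
    using sem_update[OF assms, of 1] by auto
  have c': "c \<cdot> u \<cdot> v \<le> sem \<phi> (y # x' # a # l)"
    if "u \<le> E x x'" "v \<le> sem \<phi> (y # x # a # l)" "l \<in> tup W n" "a \<in> W" "x \<in> W" "x' \<in> W" "y \<in> W" for u v x x' y a l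
    using c(2)[of u x x' v "y # x # a # l"] that by (simp add: Cons_tup eval_nat_numeral)
  obtain w\<^sub>0 where w\<^sub>0: "w\<^sub>0 \<in> W" using W_infinite by fastforce
  \<comment> \<open>One witness for each truth value attained suffices, so a small set of witnesses gives the same
    value to the existential quantifier as all of \<open>W\<close>.\<close>
  define pick where "pick l a x v = (if \<exists>y\<in>W. sem \<phi> (y # x # a # l) = v
      then SOME y. y \<in> W \<and> sem \<phi> (y # x # a # l) = v else w\<^sub>0)" for l a x v
  define Y where "Y l a = (\<Union>x\<in>S a. range (pick l a x))" for l a
  have pick: "pick l a x v \<in> W" for l a x v
    unfolding pick_def using w\<^sub>0 by (auto intro: someI2_ex)
  have Y: "Y l a \<subseteq> W" "small (Y l a)" if "a \<in> W" for l a
    unfolding Y_def using pick small_UN[OF S_small[OF that] small_values] by blast+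
  have all: "(\<lambda>y. sem \<phi> (y # x # a # l)) ` W \<subseteq> (\<lambda>y. sem \<phi> (y # x # a # l)) ` Y l a" if x: "x \<in> S a" for l a x
  proof
    fix v assume "v \<in> (\<lambda>y. sem \<phi> (y # x # a # l)) ` W"
    then have ex: "\<exists>y. y \<in> W \<and> sem \<phi> (y # x # a # l) = v" by auto
    from someI_ex[OF this] ex have "sem \<phi> (pick l a x v # x # a # l) = v"
      unfolding pick_def by auto
    then show "v \<in> (\<lambda>y. sem \<phi> (y # x # a # l)) ` Y l a"
      using x unfolding Y_def by (intro image_eqI[of _ _ "pick l a x v"]) auto
  qed
  \<comment> \<open>This is an inequality in the lattice, so passing from all of \<open>W\<close> to
    the small set leaves the realizer unchanged.\<close>
  have le: "ex W (\<lambda>y. sem \<phi> (y # x # a # l)) \<le> ex (Y l a) (\<lambda>y. sem \<phi> (y # x # a # l))" if x: "x \<in> S a" for l a x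
  proof -
    have "(INF y\<in>Y l a. sem \<phi> (y # x # a # l) \<leadsto> v) \<le> (INF y\<in>W. sem \<phi> (y # x # a # l) \<leadsto> v)" for v
      using INF_superset_mono[OF all[OF x] order_refl, where f = "\<lambda>b. b \<leadsto> v"] by (simp add: image_image)
    then show ?thesis
      unfolding alg_ex_def by (intro INF_mono) (blast intro: arr_mono)
  qed
  have h: "h \<cdot> m \<le> ex (Y l a) (\<lambda>y. sem \<phi> (y # x # a # l))"
    if "h \<le> (INF x\<in>W. mem x a \<leadsto> ex W (\<lambda>y. sem \<phi> (y # x # a # l)))" "m \<le> mem x a" "x \<in> S a" "a \<in> W" for h m x a l
    using app_le[OF le_INF_D[OF that(1) S_in[OF that(3,4)]] that(2)] le[OF that(3)] by (rule order_trans)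
  have b: "wit (pr cK rrefl) \<le> mem y (nm (Y l a) (\<lambda>_. top))" if "y \<in> Y l a" "a \<in> W" for y a l
    using that Y by (intro mem_nm_top)
  have YW: "y \<in> Y l a \<Longrightarrow> a \<in> W \<Longrightarrow> y \<in> W" for y l a using Y by blast
  have "(INF l\<in>tup W n. INF a\<in>W. (INF x\<in>W. mem x a \<leadsto> ex W (\<lambda>y. sem \<phi> (y # x # a # l))) \<leadsto>
      ex W (\<lambda>b. INF x\<in>W. mem x a \<leadsto> ex W (\<lambda>y. mem y b \<otimes> sem \<phi> (y # x # a # l)))) \<in> \<Sigma>"
    by (rule sepI, (rule seqI)+, rule wit_le, (rule seqI)+, rule unwit_le, erule memD, erule le_cnjE,
        rule unwit_le, erule h, rule mem_if_d, assumption+, rule wit_le, rule pr_le, erule b, assumption, rule c',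
        rule WE.sym, assumption+, erule S_in, assumption+, erule S_in, assumption+, erule YW, assumption, erule YW, assumption,
        rule nm_in, (erule Y)+, intro definables cK_sep rrefl_sep c(1) WE.seps)
  moreover have "sem (insert_var 2 \<phi>) (y # x # b # a # l) = sem \<phi> (y # x # a # l)" for y x b a l
    using sem_insert_var[of "[y, x]"] by (simp add: numeral_2_eq_2)
  ultimately show "(INF l\<in>tup W n. sem (Collection \<phi>) l) \<in> \<Sigma>"
    by (simp add: Collection_def)
qed

text \<open>Peirce's law is applied to \<open>a \<oplus> (a \<leadsto> bot)\<close> and
  \<open>bot\<close>: a refutation of the disjunction refutes \<open>a\<close> through the left
  injection, and this refutation of \<open>a\<close> is the right disjunct.\<close>

lemma Excluded_Middle:
  assumes "classical_alg A"
  shows "sem (closure n (Or \<phi> (Neg \<phi>))) [] \<in> \<Sigma>"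
proof (rule closure_sep)
  let ?p = "INF a. INF b. ((a \<leadsto> b) \<leadsto> a) \<leadsto> a"
  have p: "?p \<in> \<Sigma>" using assms by (simp add: classical_alg_def)
  have "?p \<le> ((a \<oplus> (a \<leadsto> bot) \<leadsto> bot) \<leadsto> a \<oplus> (a \<leadsto> bot)) \<leadsto> a \<oplus> (a \<leadsto> bot)" for a
    by (meson INF_lower2 INF_lower UNIV_I order_refl)
  then have p': "?p \<cdot> u \<le> a \<oplus> (a \<leadsto> bot)" if "u \<le> (a \<oplus> (a \<leadsto> bot) \<leadsto> bot) \<leadsto> a \<oplus> (a \<leadsto> bot)" for u a
    using that app_le by blast
  have "(INF l\<in>tup W n. sem \<phi> l \<oplus> (sem \<phi> l \<leadsto> bot)) \<in> \<Sigma>"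
    by (rule sepI, rule INF_greatest, rule p', rule lam_le, rule inr_le, rule lam_le, rule app_le, assumption,
        rule inl_le, assumption, intro definables p)
  then show "(INF l\<in>tup W n. sem (Or \<phi> (Neg \<phi>)) l) \<in> \<Sigma>"
    by (simp add: Neg_def)
qed

theorem hosts_models: "hosts_model C IZF \<and> (classical_alg A \<longrightarrow> hosts_model C ZF)"
proof -
  have ctx: "in_context \<phi> 0" if "\<phi> \<in> ZF" for \<phi>
    using that unfolding ZF_def IZF_def
    by (auto simp: Extensionality_Axiom_def Pairing_Axiom_def Union_Axiom_def Powerset_Axiom_def Infinity_Axiom_def
        Separation_def Collection_def Mem_Induction_def Iff_def Neg_def eval_nat_numeral
        intro!: in_context_closure in_context_insert_var)
  have izf: "sem \<phi> [] \<in> \<Sigma>" if "\<phi> \<in> IZF" for \<phi>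
    using that unfolding IZF_def
    by (auto intro: Extensionality Pairing Union Powerset Infinity Separation Collection Mem_Induction)
  have zf: "sem \<phi> [] \<in> \<Sigma>" if "classical_alg A" "\<phi> \<in> ZF" for \<phi>
    using that izf unfolding ZF_def by (auto intro: Excluded_Middle)
  have sub: "IZF \<subseteq> ZF" by (simp add: ZF_def)
  show ?thesis
  proof (intro conjI impI)
    show "hosts_model C IZF"
      by (rule hosts_model_if_sem, rule ctx, erule subsetD[OF sub], erule izf)
    show "hosts_model C ZF" if "classical_alg A"
      by (rule hosts_model_if_sem, erule ctx, erule zf[OF that])
  qed
qed

end

section \<open>Names below a strongly inaccessible cardinal\<close>

locale inaccessible =
  fixes \<kappa> :: "'u rel"
  assumes inaccessible: "strongly_inaccessible \<kappa>"
begin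

lemma card: "Card_order \<kappa>" and regular: "regularCard \<kappa>" and nat_less: "natLeq <o \<kappa>"
  and Pow_less_Field: "|Y :: 'u set| <o \<kappa> \<Longrightarrow> |Pow Y| <o \<kappa>"
  using inaccessible unfolding strongly_inaccessible_def by blast+

lemma Field_ordIso: "|Field \<kappa>| =o \<kappa>"
  using card by (rule card_of_Field_ordIso)

lemma Field_infinite: "infinite (Field \<kappa>)"
  using ordLess_imp_ordLeq[OF ordLess_ordIso_trans[OF nat_less ordIso_symmetric[OF Field_ordIso]]]
  using infinite_iff_natLeq_ordLeq by blast

lemma Cinf: "Cinfinite \<kappa>"
  using card Field_infinite by (simp add: cinfinite_def)

lemma less_mono: "|X| \<le>o |Y| \<Longrightarrow> |Y| <o \<kappa> \<Longrightarrow> |X| <o \<kappa>"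
  by (rule ordLeq_ordLess_trans)

lemma finite_less: "finite X \<Longrightarrow> |X| <o \<kappa>"
  by (rule finite_ordLess_infinite[OF card_of_Well_order]) (use card Field_infinite in \<open>auto simp: Field_card_of card_order_on_def\<close>)

lemma UN_less: "|I| <o \<kappa> \<Longrightarrow> (\<And>i. i \<in> I \<Longrightarrow> |G i| <o \<kappa>) \<Longrightarrow> |\<Union>i\<in>I. G i| <o \<kappa>"
  by (rule regularCard_UNION_bound[OF Cinf regular])

lemma insert_less: "|X| <o \<kappa> \<Longrightarrow> |insert x X| <o \<kappa>"
  using card_of_Un_ordLess_infinite_Field[OF Field_infinite card finite_less[of "{x}"]] by simp

lemma Times_less:
  assumes "|X| <o \<kappa>" "|Y| <o \<kappa>"
  shows "|X \<times> Y| <o \<kappa>"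
proof -
  have "X \<times> Y = (\<Union>x\<in>X. Pair x ` Y)" by auto
  then show ?thesis
    using UN_less[OF assms(1) less_mono[OF card_of_image assms(2)], of "\<lambda>x. Pair x"] by simp
qed

text \<open>The strong limit property is assumed for subsets of the type of \<open>\<kappa>\<close>
  only; a set of any other type is first injected into \<open>Field \<kappa>\<close>.\<close>

lemma Pow_less:
  assumes "|X| <o \<kappa>"
  shows "|Pow X| <o \<kappa>"
proof -
  have "|X| \<le>o |Field \<kappa>|"
    using assms ordIso_symmetric[OF Field_ordIso] ordLess_imp_ordLeq ordLess_ordIso_trans by blast
  then obtain f where f: "inj_on f X" "f ` X \<subseteq> Field \<kappa>" by (metis card_of_ordLeq)
  have "|Pow X| \<le>o |Pow (f ` X)|"
    using inj_on_image_Pow[OF f(1)] by (subst card_of_ordLeq[symmetric]) (auto intro!: exI[of _ "(`) f"])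
  moreover have "|Pow (f ` X)| <o \<kappa>"
    by (rule Pow_less_Field[OF less_mono[OF card_of_image assms]])
  ultimately show ?thesis by (rule less_mono)
qed

text \<open>A function with its domain is recovered from its graph, a subset of
  \<open>B \<times> UNIV\<close>; the strong limit property then bounds the number of
  graphs.\<close>

lemma partial_functions_less:
  fixes B :: "'i set"
  assumes "|B| <o \<kappa>" "|UNIV :: 'a set| <o \<kappa>"
  shows "|SIGMA X : Pow B. X \<rightarrow>\<^sub>E (UNIV :: 'a set)| <o \<kappa>"
proof (rule less_mono)
  show "|Pow (B \<times> (UNIV :: 'a set))| <o \<kappa>"
    by (intro Pow_less Times_less assms)
  let ?g = "\<lambda>(X, f). (\<lambda>x. (x, f x)) ` X"
  have "inj_on ?g (SIGMA X : Pow B. X \<rightarrow>\<^sub>E (UNIV :: 'a set))"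
  proof (rule inj_onI, clarify)
    fix X Y :: "'i set" and f g :: "'i \<Rightarrow> 'a"
    assume *: "f \<in> X \<rightarrow>\<^sub>E UNIV" "g \<in> Y \<rightarrow>\<^sub>E UNIV" "(\<lambda>x. (x, f x)) ` X = (\<lambda>x. (x, g x)) ` Y"
    then have "fst ` (\<lambda>x. (x, f x)) ` X = fst ` (\<lambda>x. (x, g x)) ` Y" by simp
    then have "X = Y" by (simp add: image_image)
    moreover have "f = g"
    proof (rule PiE_ext[OF *(1)])
      show "g \<in> X \<rightarrow>\<^sub>E UNIV" using * \<open>X = Y\<close> by simp
      show "f x = g x" if "x \<in> X" for x
        using *(3) that by (metis (no_types, lifting) image_iff prod.inject)
    qed
    ultimately show "X = Y \<and> f = g" by simp
  qed
  then show "|SIGMA X : Pow B. X \<rightarrow>\<^sub>E (UNIV :: 'a set)| \<le>o |Pow (B \<times> (UNIV :: 'a set))|"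
    by (subst card_of_ordLeq[symmetric]) (intro exI[of _ ?g], auto)
qed

lemma functions_less:
  fixes B :: "'i set"
  assumes "|B| <o \<kappa>" "|UNIV :: 'a set| <o \<kappa>"
  shows "|B \<rightarrow>\<^sub>E (UNIV :: 'a set)| <o \<kappa>"
  by (rule less_mono[OF _ partial_functions_less[OF assms]], subst card_of_ordLeq[symmetric])
    (auto intro!: exI[of _ "Pair B"] inj_onI)

text \<open>By regularity a set of fewer than \<kappa> elements is not cofinal. Cofinality asks for
  strictly larger elements, so its failure at \<open>a\<close> still allows \<open>a\<close> itself,
  hence the \<open>insert\<close>.\<close>

lemma bounded:
  assumes "X \<subseteq> Field \<kappa>" "|X| <o \<kappa>"
  obtains a where "a \<in> Field \<kappa>" and "X \<subseteq> insert a (underS \<kappa> a)"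
proof -
  have "\<not> |X| =o \<kappa>" using assms(2) not_ordLess_ordIso by blast
  then have "\<not> cofinal X \<kappa>" using regular assms(1) unfolding regularCard_def by blast
  then obtain a where a: "a \<in> Field \<kappa>" "\<And>b. b \<in> X \<Longrightarrow> a = b \<or> (a, b) \<notin> \<kappa>" unfolding cofinal_def by blast
  have "total_on (Field \<kappa>) \<kappa>"
    using card unfolding card_order_on_def well_order_on_def linear_order_on_def by blast
  then have "b \<in> insert a (underS \<kappa> a)" if "b \<in> X" for b
    using a that assms(1) unfolding underS_def total_on_def by blast
  then show thesis using that a(1) by blast
qed

section \<open>Counting the weighted small sets of names\<close>

definition codes :: "('u set \<times> ('u \<Rightarrow> 'a)) set" where
  "codes = {(X, f). X \<subseteq> Field \<kappa> \<and> |X| <o \<kappa> \<and> f \<in> X \<rightarrow>\<^sub>E UNIV}"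

text \<open>Each code lives on an initial segment. There are \<kappa> many segments, and each
  carries fewer than \<kappa> codes.\<close>

lemma codes_le:
  assumes "|UNIV :: 'a set| <o \<kappa>"
  shows "|codes :: ('u set \<times> ('u \<Rightarrow> 'a)) set| \<le>o |Field \<kappa>|"
proof -
  let ?D = "\<lambda>a. SIGMA X : Pow (insert a (underS \<kappa> a)). X \<rightarrow>\<^sub>E (UNIV :: 'a set)"
  have "codes \<subseteq> (\<Union>a\<in>Field \<kappa>. ?D a)"
    unfolding codes_def by (auto elim!: bounded)
  then have "|codes :: ('u set \<times> ('u \<Rightarrow> 'a)) set| \<le>o |\<Union>a\<in>Field \<kappa>. ?D a|" by (rule card_of_mono1)
  also have "|?D a| \<le>o |Field \<kappa>|" if "a \<in> Field \<kappa>" for a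
  proof -
    have "|insert a (underS \<kappa> a)| <o \<kappa>" using card_of_underS[OF card that] by (rule insert_less)
    then have "|?D a| <o \<kappa>" using assms by (rule partial_functions_less)
    then show ?thesis
      using ordLess_ordIso_trans[OF _ ordIso_symmetric[OF Field_ordIso]] ordLess_imp_ordLeq by blast
  qed
  then have "|\<Union>a\<in>Field \<kappa>. ?D a| \<le>o |Field \<kappa>|"
    by (intro card_of_UNION_ordLeq_infinite Field_infinite ballI) (auto intro: card_of_mono1)
  finally show ?thesis .
qed

text \<open>Each code is attached to \<open>\<kappa>\<close> many elements of \<open>Field \<kappa>\<close>, hence to one above all its members;
  elements that are not above all members of their code are names of the empty set.\<close>

lemma names_exist:
  assumes "|UNIV :: 'a set| <o \<kappa>"
  obtains S :: "'u \<Rightarrow> 'u set" and d :: "'u \<Rightarrow> 'u \<Rightarrow> 'a" where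
    "\<And>x. S x \<subseteq> underS \<kappa> x" and "\<And>x. |S x| <o \<kappa>"
    and "\<And>X f. X \<subseteq> Field \<kappa> \<Longrightarrow> |X| <o \<kappa> \<Longrightarrow> \<exists>y\<in>Field \<kappa>. S y = X \<and> (\<forall>z\<in>X. d y z = f z)"
proof -
  let ?D = "codes :: ('u set \<times> ('u \<Rightarrow> 'a)) set" and ?W = "Field \<kappa>"
  have "|?D \<times> ?W| \<le>o |?W|"
    using codes_le[OF assms] by (intro card_of_Sigma_ordLeq_infinite Field_infinite) (auto intro: card_of_mono1)
  then obtain j where j: "inj_on j (?D \<times> ?W)" "j ` (?D \<times> ?W) \<subseteq> ?W" by (metis card_of_ordLeq)
  define c where "c w = fst (inv_into (?D \<times> ?W) j w)" for w
  define S where "S w = (if w \<in> j ` (?D \<times> ?W) \<and> fst (c w) \<subseteq> underS \<kappa> w then fst (c w) else {})" for w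
  have c: "c (j (p, v)) = p" if "p \<in> ?D" "v \<in> ?W" for p v
    unfolding c_def using that j(1) by (simp add: inv_into_f_f)
  have c_in: "c w \<in> ?D" if "w \<in> j ` (?D \<times> ?W)" for w
    using that c by auto
  show thesis
  proof (rule that[of S "\<lambda>w. snd (c w)"])
    show "S x \<subseteq> underS \<kappa> x" for x by (simp add: S_def)
    show "|S x| <o \<kappa>" for x
      using c_in[of x] finite_less[of "{}"] by (auto simp: S_def codes_def split: prod.splits)
    fix X and f :: "'u \<Rightarrow> 'a" assume X: "X \<subseteq> ?W" "|X| <o \<kappa>"
    let ?p = "(X, restrict f X)"
    have p: "?p \<in> ?D" using X by (simp add: codes_def)
    obtain a where a: "a \<in> ?W" "X \<subseteq> insert a (underS \<kappa> a)" using bounded[OF X] by blast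
    \<comment> \<open>An injective image of \<open>Field \<kappa>\<close> does not fit into an
      initial segment, so some element attached to this code lies beyond the bound
      \<open>a\<close>.\<close>
    have "\<not> (\<lambda>v. j (?p, v)) ` ?W \<subseteq> insert a (underS \<kappa> a)"
    proof
      assume "(\<lambda>v. j (?p, v)) ` ?W \<subseteq> insert a (underS \<kappa> a)"
      moreover have "inj_on (\<lambda>v. j (?p, v)) ?W"
        using j(1) p by (auto simp: inj_on_def)
      ultimately have "|?W| \<le>o |insert a (underS \<kappa> a)|" by (metis card_of_ordLeq)
      then have "|?W| <o \<kappa>"
        using insert_less[OF card_of_underS[OF card a(1)]] by (rule less_mono)
      then show False using Field_ordIso not_ordLess_ordIso by blast
    qed
    then obtain v where v: "v \<in> ?W" "j (?p, v) \<notin> insert a (underS \<kappa> a)" by auto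
    let ?y = "j (?p, v)"
    have y: "?y \<in> j ` (?D \<times> ?W)" "?y \<in> ?W" using v(1) p j(2) by auto
    have wo: "total_on ?W \<kappa>" "trans \<kappa>" "antisym \<kappa>"
      using card unfolding card_order_on_def well_order_on_def linear_order_on_def partial_order_on_def preorder_on_def
      by blast+
    then have "(a, ?y) \<in> \<kappa>" "a \<noteq> ?y"
      using v(2) a(1) y(2) unfolding underS_def total_on_def by blast+
    then have "X \<subseteq> underS \<kappa> ?y"
      using a(2) wo(2,3) unfolding underS_def by (auto dest: transD antisymD)
    then have "S ?y = X" using y(1) c[OF p v(1)] by (simp add: S_def)
    then show "\<exists>y\<in>?W. S y = X \<and> (\<forall>z\<in>X. snd (c y) z = f z)"
      using y(2) c[OF p v(1)] by (intro bexI[of _ ?y]) simp_all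
  qed
qed

end

theorem theorem6p1:
  fixes A :: "'a::complete_lattice impl_alg"
    and U :: "'u set set"
    and \<kappa> :: "'u rel"
  assumes "set_universe U"
    and "implicative_algebra A"
    and "strongly_inaccessible \<kappa>"
    and "Field \<kappa> \<in> U"
    and "|UNIV :: 'a set| <o \<kappa>"
  shows "hosts_model (tripos_topos U A) IZF
    \<and> (classical_alg A \<longrightarrow> hosts_model (tripos_topos U A) ZF)"
proof -
  interpret inaccessible \<kappa> by unfold_locales (rule assms(3))
  show ?thesis
  proof (rule names_exist[OF assms(5)])
    fix S :: "'u \<Rightarrow> 'u set" and d :: "'u \<Rightarrow> 'u \<Rightarrow> 'a"
    assume S: "\<And>x. S x \<subseteq> underS \<kappa> x" "\<And>x. |S x| <o \<kappa>"
      and name: "\<And>X f. X \<subseteq> Field \<kappa> \<Longrightarrow> |X| <o \<kappa> \<Longrightarrow> \<exists>y\<in>Field \<kappa>. S y = X \<and> (\<forall>z\<in>X. d y z = f z)"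
    \<comment> \<open>Potential elements lie strictly below their name in the well-order, from which
      induction on names is inherited.\<close>
    have "wf (\<kappa> - Id)"
      using card unfolding card_order_on_def well_order_on_def by blast
    then have wf: "wf {(z, x). x \<in> Field \<kappa> \<and> z \<in> S x}"
      by (rule wf_subset) (use S(1) in \<open>auto simp: underS_def\<close>)
    \<comment> \<open>The names are all elements of \<open>Field \<kappa>\<close>, a member of
      \<open>U\<close>, and smallness means having fewer than \<kappa> elements.\<close>
    interpret names A U "Field \<kappa>" S d "\<lambda>X. |X| <o \<kappa>"
    proof
      show "implicative_algebra A" "set_universe U" "Field \<kappa> \<in> U" by fact+
      show "infinite (Field \<kappa>)" by (rule Field_infinite)
      show "S x \<subseteq> Field \<kappa>" for x using S(1) underS_Field by fastforce
      show "wf {(z, x). x \<in> Field \<kappa> \<and> z \<in> S x}" by fact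
      show "|{}| <o \<kappa>" by (simp add: finite_less)
      show "|range h| <o \<kappa>" for h :: "nat \<Rightarrow> 'u"
        using ordLeq_ordIso_trans[OF card_of_image card_of_nat] nat_less by (rule ordLeq_ordLess_trans)
      show "|range k| <o \<kappa>" for k :: "'a \<Rightarrow> 'u"
        using card_of_image assms(5) by (rule less_mono)
      show "|F ` (X \<rightarrow>\<^sub>E (UNIV :: 'a set))| <o \<kappa>" if "|X| <o \<kappa>" for X :: "'u set" and F :: "_ \<Rightarrow> 'u"
        using card_of_image functions_less[OF that assms(5)] by (rule less_mono)
      show "|\<Union>x\<in>X. G x| <o \<kappa>" if "|X| <o \<kappa>" "\<And>x. x \<in> X \<Longrightarrow> |G x| <o \<kappa>" for X :: "'u set" and G :: "'u \<Rightarrow> 'u set"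
        using that by (rule UN_less)
    qed (simp_all add: S(2) name insert_less)
    show ?thesis by (rule hosts_models)
  qed
qed

end
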